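(* Let $B$ be a real separable Banach space with topological dual $B^*$, let $X, X_1, X_2, \ldots$ be i.i.d. $B$-valued random vectors with law $\mu=\mathcal{L}(X)$, and set $S_n=\sum_{j=1}^n X_j$. Assume that $\mathcal{L}(S_n/n^{1/2})$ converges weakly to a nondegenerate probability measure $\gamma$ on $B$ (necessarily a centered Gaussian measure), and that $\{b_n\}$ is a sequence of positive constants with $b_n/n^{1/2}\to\infty$ and $b_n/n^{2/3}\to 0$. Assume that for every $f\in B^*$ there is $t_f>0$ with $E(e^{t|f(X)|})<\infty$ for $0<|t|<t_f$. Let $D\subset B$ be an open convex set with $D\cap H_\gamma\neq\emptyset$ and $0\notin\overline{D}$, let $a_0$ be the unique dominating point for $(D,\gamma)$, and let $g=t_0f\in B^*$ be the functional associated with $a_0$ (see context). Then, as $n\to\infty$, $$P(S_n/b_n\in D)\sim \exp\{-n^{-1}b_n^2\lambda_\gamma(a_0)\}\,E\big[\exp\{-g(T_n-E(T_n))\}\,I\{T_n\in b_n^2D/n\}\big],$$ where $T_n=\frac{b_n}{n}\sum_{j=1}^n Z_{n,j}$ and $Z^{(n)},Z_{n,1},\ldots,Z_{n,n}$ are i.i.d. $B$-valued random vectors (defined for all $n$ large enough that $\hat\mu(b_ng/n)<\infty$) with $$\frac{d\mathcal{L}(Z^{(n)})}{d\mu}(x)=\exp\{g(b_nx/n)\}/\hat\mu(b_ng/n),$$ and $$E(Z^{(n)})=(b_n/n)a_0+O(b_n^2/n^2)\quad\text{(in the norm of }B).$$ Furthermore, $$\limsup_{n\to\infty} n^{-1/2}b_n\,P(S_n/b_n\in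 D)\exp\{n^{-1}b_n^2\lambda_\gamma(a_0)\}\le(2\pi\sigma_g^2)^{-1/2},$$ where $\sigma_g^2=E(g^2(X))$.
   Context: Notation: $a_n\sim c_n$ means $\lim_n a_n/c_n=1$. $\hat\mu(f)=\int_B e^{f(x)}\,d\mu(x)$ and $\hat\gamma(f)=\int_B e^{f(x)}\,d\gamma(x)$ for $f\in B^*$. For the centered Gaussian measure $\gamma$, $H_\gamma\subset B$ is the Hilbert space generating $\gamma$: the completion of $S(B^* )$, where $Sf=\int_B xf(x)\,d\gamma(x)$ (Bochner integral), under the inner product $\langle Sf,Sg\rangle_\gamma=\int_B fg\,d\gamma$. The rate function is $\lambda_\gamma(x)=\sup_{f\in B^*}[f(x)-\log\hat\gamma(f)]$, which equals $\|x\|_\gamma^2/2$ for $x\in H_\gamma$ and $+\infty$ otherwise. Dominating point (known facts): for open convex $D$ with $D\cap H_\gamma\ne\emptyset$ and $0\notin\overline D$, there is a unique point $a_0\in\partial D$ (the dominating point for $(D,\gamma)$) such that (i) $\lambda_\gamma(a_0)=\inf_{x\in D}\lambda_\gamma(x)=\inf_{x\in\overline D}\lambda_\gamma(x)<\infty$, and for some $g\in B^*$: (ii) $D\subset\{x:g(x)\ge g(a_0)\}$; (iii) $\lambda_\gamma(a_0)=g(a_0)-\log\hat\gamma(g)$; (iv) $a_0=\int_B x\exp\{g(x)-\log\hat\gamma(g)\}\,d\gamma(x)$ (Bochner integral). Moreover, if $f\in B^*$ satisfies $\sup_{\{z:\lambda_\gamma(z)\le\lambda_\gamma(a_0)\}}f(z)=f(a_0)<f(x)$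 for all $x\in D$ (such $f$ exists by Hahn–Banach), there is a unique $t_0>0$ such that $g=t_0f$ satisfies (ii)–(iv). "The functional $g=t_0f$ associated with $a_0$" means such a $g$. *)

theory Defs
  imports "HOL-Probability.Probability" "HOL-Library.Landau_Symbols"
begin

text \<open>The dual of a Banach space is the type of bounded linear functionals
  \<open>'a \<Rightarrow>\<^sub>L real\<close>; real separable Banach spaces are the types of sort
  \<open>{banach, second_countable_topology}\<close>.\<close>

definition weak_conv_to ::
  "(nat \<Rightarrow> 'a::{banach, second_countable_topology} measure) \<Rightarrow> 'a measure \<Rightarrow> bool" where
  "weak_conv_to \<nu> \<gamma> \<longleftrightarrow>
    (\<forall>h::'a \<Rightarrow> real. continuous_on UNIV h \<longrightarrow> bounded (range h) \<longrightarrow>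
      (\<lambda>n. \<integral>x. h x \<partial>\<nu> n) \<longlonglongrightarrow> (\<integral>x. h x \<partial>\<gamma>))"

text \<open>Not concentrated at a single point.\<close>

definition nondegenerate_measure :: "'a::{banach, second_countable_topology} measure \<Rightarrow> bool" where
  "nondegenerate_measure \<gamma> \<longleftrightarrow> (\<forall>x. \<gamma> \<noteq> return borel x)"

definition iid_with_law ::
  "'w measure \<Rightarrow> 'a::{banach, second_countable_topology} measure \<Rightarrow> 'i set \<Rightarrow> ('i \<Rightarrow> 'w \<Rightarrow> 'a) \<Rightarrow> bool" where
  "iid_with_law M \<nu> I Y \<longleftrightarrow>
    prob_space M \<and> prob_space.indep_vars M (\<lambda>_. borel) Y I \<and>
    (\<forall>i\<in>I. distr M borel (Y i) = \<nu>)"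

text \<open>The transform \<open>\<integral> e\<^sup>f d\<nu>\<close>, with values in \<open>(0, \<infinity>]\<close> for a probability measure \<open>\<nu>\<close>,
  and its logarithm.\<close>

definition laplace :: "'a::{banach, second_countable_topology} measure \<Rightarrow> ('a \<Rightarrow>\<^sub>L real) \<Rightarrow> ennreal" where
  "laplace \<nu> f = (\<integral>\<^sup>+ x. ennreal (exp (blinfun_apply f x)) \<partial>\<nu>)"

definition log_laplace :: "'a::{banach, second_countable_topology} measure \<Rightarrow> ('a \<Rightarrow>\<^sub>L real) \<Rightarrow> ereal" where
  "log_laplace \<nu> f = (if laplace \<nu> f = \<infinity> then \<infinity> else ereal (ln (enn2real (laplace \<nu> f))))"

definition rate :: "'a::{banach, second_countable_topology} measure \<Rightarrow> 'a \<Rightarrow> ereal" where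
  "rate \<gamma> x = (SUP f. ereal (blinfun_apply f x) - log_laplace \<gamma> f)"

definition cov_op :: "'a::{banach, second_countable_topology} measure \<Rightarrow> ('a \<Rightarrow>\<^sub>L real) \<Rightarrow> 'a" where
  "cov_op \<gamma> f = (\<integral>x. blinfun_apply f x *\<^sub>R x \<partial>\<gamma>)"

text \<open>\<open>cov_inner \<gamma> f g\<close> is the inner product of \<open>cov_op \<gamma> f\<close> and \<open>cov_op \<gamma> g\<close> in the Hilbert
  space generating \<open>\<gamma>\<close>. The completion of the range of \<open>cov_op \<gamma>\<close> is realised inside the Banach
  space: its elements are the limits, in the norm of the Banach space, of sequences in that range
  that are Cauchy for the Hilbert norm.\<close>

definition cov_inner ::
  "'a::{banach, second_countable_topology} measure \<Rightarrow> ('a \<Rightarrow>\<^sub>L real) \<Rightarrow> ('a \<Rightarrow>\<^sub>L real) \<Rightarrow> real" where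
  "cov_inner \<gamma> f g = (\<integral>x. blinfun_apply f x * blinfun_apply g x \<partial>\<gamma>)"

definition gen_hilbert :: "'a::{banach, second_countable_topology} measure \<Rightarrow> 'a set" where
  "gen_hilbert \<gamma> =
    {x. \<exists>F::nat \<Rightarrow> ('a \<Rightarrow>\<^sub>L real).
      (\<forall>e>0. \<exists>N. \<forall>m\<ge>N. \<forall>n\<ge>N. sqrt (cov_inner \<gamma> (F m - F n) (F m - F n)) < e) \<and>
      (\<lambda>k. cov_op \<gamma> (F k)) \<longlonglongrightarrow> x}"

definition dominating_functional ::
  "'a::{banach, second_countable_topology} measure \<Rightarrow> 'a set \<Rightarrow> 'a \<Rightarrow> ('a \<Rightarrow>\<^sub>L real) \<Rightarrow> bool" where
  "dominating_functional \<gamma> D a g \<longleftrightarrow>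
    D \<subseteq> {x. blinfun_apply g x \<ge> blinfun_apply g a} \<and>
    rate \<gamma> a = ereal (blinfun_apply g a) - log_laplace \<gamma> g \<and>
    has_bochner_integral \<gamma>
      (\<lambda>x. exp (blinfun_apply g x - real_of_ereal (log_laplace \<gamma> g)) *\<^sub>R x) a"

definition dominating_point ::
  "'a::{banach, second_countable_topology} measure \<Rightarrow> 'a set \<Rightarrow> 'a \<Rightarrow> bool" where
  "dominating_point \<gamma> D a \<longleftrightarrow>
    a \<in> frontier D \<and>
    rate \<gamma> a = (INF x\<in>D. rate \<gamma> x) \<and>
    rate \<gamma> a = (INF x\<in>closure D. rate \<gamma> x) \<and>
    rate \<gamma> a < \<infinity> \<and>
    (\<exists>g. dominating_functional \<gamma> D a g)"

definition associated_functional ::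
  "'a::{banach, second_countable_topology} measure \<Rightarrow> 'a set \<Rightarrow> 'a \<Rightarrow> ('a \<Rightarrow>\<^sub>L real) \<Rightarrow> bool" where
  "associated_functional \<gamma> D a g \<longleftrightarrow>
    (\<exists>f t. (SUP z\<in>{z. rate \<gamma> z \<le> rate \<gamma> a}. ereal (blinfun_apply f z)) = ereal (blinfun_apply f a) \<and>
      (\<forall>x\<in>D. blinfun_apply f a < blinfun_apply f x) \<and>
      t > 0 \<and> g = t *\<^sub>R f \<and> dominating_functional \<gamma> D a g)"

text \<open>The measure with density \<open>e\<^sup>f / \<integral> e\<^sup>f d\<nu>\<close> with respect to \<open>\<nu>\<close>, meaningful
  when \<open>laplace \<nu> f < \<infinity>\<close>.\<close>

definition tilted :: "'a::{banach, second_countable_topology} measure \<Rightarrow> ('a \<Rightarrow>\<^sub>L real) \<Rightarrow> 'a measure" where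
  "tilted \<nu> f = density \<nu> (\<lambda>x. ennreal (exp (blinfun_apply f x)) / laplace \<nu> f)"

end

theory Submission
  imports Defs "HOL-Real_Asymp.Real_Asymp"
begin

text \<open>Write \<open>\<epsilon> = b\<^sub>n / n\<close>. Exponential tilting of every summand by \<open>\<epsilon> g\<close> gives the exact identity
  \<open>P(S\<^sub>n / b\<^sub>n \<in> D) = exp (n log \<mu>(\<epsilon> g) - E g(T\<^sub>n)) E W\<^sub>n\<close>, and expanding the exponent in \<open>\<epsilon>\<close> produces
  \<open>- n \<epsilon>\<^sup>2 E g\<^sup>2(X) / 2 + O(n \<epsilon>\<^sup>3)\<close>, where \<open>n \<epsilon>\<^sup>3 = b\<^sub>n\<^sup>3 / n\<^sup>2 \<rightarrow> 0\<close>. Since every functional is Gaussian under \<open>\<gamma>\<close>,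
  \<open>a\<^sub>0 = E g(X) X\<close> and \<open>\<lambda>(a\<^sub>0) = E g\<^sup>2(X) / 2\<close>. The expansion of the mean holds in norm because tightness of \<open>S\<^sub>n / \<surd>n\<close>
  and Ottaviani's inequality give \<open>P(\<parallel>X\<parallel> > t) = O(t\<^sup>-\<^sup>2)\<close>, hence \<open>E \<parallel>X\<parallel>\<^sup>3\<^sup>/\<^sup>2 < \<infinity>\<close>, so that \<open>\<parallel>X\<parallel>\<close> times any
  function of \<open>g(X)\<close> of small exponential growth is integrable.

  Dividing by \<open>E W\<^sub>n\<close> requires \<open>P(S\<^sub>n / b\<^sub>n \<in> D) > 0\<close>: if no multiple of \<open>D\<close> were reachable by the sums, a functional
  \<open>h\<close> would separate \<open>D\<close> from the semigroup of reachable points, so \<open>h(X) \<le> 0\<close> almost surely; as \<open>E h(X) = 0\<close>, \<open>h\<close> would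
  vanish on the Hilbert space of \<open>\<gamma>\<close>.

  For the final bound, \<open>W\<^sub>n \<le> exp (- \<xi>)\<close> on \<open>\<xi> \<ge> - o(1)\<close> and \<open>W\<^sub>n = 0\<close> elsewhere, where \<open>\<xi> = g(T\<^sub>n - E T\<^sub>n)\<close> has variance
  of order \<open>n \<epsilon>\<^sup>2 \<rightarrow> \<infinity>\<close>. After smoothing by a small Gaussian, \<open>\<xi>\<close> has a density bounded by the \<open>L\<^sup>1\<close> norm of its
  characteristic function, which only involves the characteristic function of one summand near the origin.\<close>

subsection \<open>Separation by continuous functionals\<close>

text \<open>Exponential moments are assumed only along single functionals, never for the norm, so
  the integrability of norm(X) exp(s g(X)) is not given; this is the obstacle behind the tail
  estimate. The exponent 3/2 is taken because its dual exponent is 3: products are controlled by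
  a^(3/2) + b^3, and the cube of a function of g(X) of small exponential growth is again of that
  kind. No smoothness of the law is assumed, so g(X) may be lattice-valued, and the characteristic
  function of \<xi> is under control only up to frequencies of order 1 / \<epsilon>. Smoothing at a
  fixed scale damps the other frequencies to an error of order \<epsilon>^2. This stays negligible
  after multiplication by sqrt(n) \<epsilon>, the order of the standard deviation of \<xi>, because
  sqrt(n) \<epsilon>^3 = n \<epsilon>^3 / sqrt(n) tends to 0. The smoothing scale itself is sent to
  0 only after n has gone to infinity. A quotient with vanishing denominator is 0 by convention, so
  positivity of the probabilities is a genuine part of the first limit.\<close>

lemma convex_positive_multiples_add:
  fixes E :: "'a::real_vector set"
  assumes "convex E" "x \<in> (\<Union>t\<in>{0<..}. (*\<^sub>R) t ` E)" "y \<in> (\<Union>t\<in>{0<..}. (*\<^sub>R) t ` E)"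
  shows "x + y \<in> (\<Union>t\<in>{0<..}. (*\<^sub>R) t ` E)"
proof -
  obtain s u where s: "s > 0" "u \<in> E" "x = s *\<^sub>R u" using assms by auto
  obtain t v where t: "t > 0" "v \<in> E" "y = t *\<^sub>R v" using assms by auto
  have "(s / (s + t)) *\<^sub>R u + (t / (s + t)) *\<^sub>R v \<in> E"
    using s t by (intro convexD[OF assms(1)]) (auto simp: add_divide_distrib[symmetric])
  moreover have "x + y = (s + t) *\<^sub>R ((s / (s + t)) *\<^sub>R u + (t / (s + t)) *\<^sub>R v)"
    using s t by (simp add: scaleR_add_right)
  ultimately show ?thesis using s t by (intro UN_I[of "s + t"]) auto
qed

text \<open>Among the open convex cones that contain \<open>E\<close> and miss the origin, Zorn's
  lemma provides a maximal one, \<open>C\<close>. Maximality makes it an open half-space: the whole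
  space is the disjoint union of \<open>C\<close>, \<open>- C\<close> and the subspace
  \<open>N\<close> of directions along which \<open>C\<close> is invariant, and connectedness of a
  line shows that \<open>N\<close> has codimension one. The functional is the coordinate along a
  point \<open>e\<close> of \<open>C\<close> modulo \<open>N\<close>.\<close>

lemma open_convex_positive_functional:
  fixes E :: "'a::real_normed_vector set"
  assumes "open E" "convex E" "0 \<notin> E"
  shows "\<exists>h::'a \<Rightarrow>\<^sub>L real. \<forall>x\<in>E. h x > 0"
proof (cases "E = {}")
  case False
  define \<C> where "\<C> = {C::'a set. open C \<and> C \<noteq> {} \<and> 0 \<notin> C \<and>
    (\<forall>x\<in>C. \<forall>y\<in>C. x + y \<in> C) \<and> (\<forall>x\<in>C. \<forall>t>0. t *\<^sub>R x \<in> C)}"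
  define C0 where "C0 = (\<Union>t\<in>{0<..}. (*\<^sub>R) t ` E)"
  have C0: "C0 \<in> \<C>"
  proof -
    have "open C0"
      unfolding C0_def by (intro open_UN ballI open_scaling assms) auto
    moreover have "C0 \<noteq> {}" using False by (auto simp: C0_def intro!: exI[of _ 1])
    moreover have "0 \<notin> C0" using assms by (auto simp: C0_def)
    moreover have "x + y \<in> C0" if "x \<in> C0" "y \<in> C0" for x y
      using convex_positive_multiples_add[OF assms(2)] that unfolding C0_def by blast
    moreover have "t *\<^sub>R x \<in> C0" if "x \<in> C0" "t > 0" for x t
    proof -
      obtain s u where s: "s > 0" "u \<in> E" "x = s *\<^sub>R u" using \<open>x \<in> C0\<close> by (auto simp: C0_def)
      then show ?thesis using that unfolding C0_def by (intro UN_I[of "t * s"]) auto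
    qed
    ultimately show ?thesis by (auto simp: \<C>_def)
  qed
  have "\<exists>C\<in>\<C>. C0 \<subseteq> C \<and> (\<forall>C'\<in>\<C>. C \<subseteq> C' \<longrightarrow> C' = C)"
  proof -
    let ?A = "{C\<in>\<C>. C0 \<subseteq> C}"
    have "\<exists>M\<in>?A. \<forall>X\<in>?A. M \<subseteq> X \<longrightarrow> X = M"
    proof (rule subset_Zorn_nonempty)
      show "?A \<noteq> {}" using C0 by auto
    next
      fix \<D> assume "\<D> \<noteq> {}" and ch: "subset.chain ?A \<D>"
      have sub: "\<D> \<subseteq> ?A" using ch by (auto simp: subset.chain_def)
      have tot: "X \<subseteq> Y \<or> Y \<subseteq> X" if "X \<in> \<D>" "Y \<in> \<D>" for X Y
        using ch that unfolding subset_chain_def by blast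
      have "x + y \<in> \<Union>\<D>" if "x \<in> \<Union>\<D>" "y \<in> \<Union>\<D>" for x y
      proof -
        obtain X Y where XY: "X \<in> \<D>" "x \<in> X" "Y \<in> \<D>" "y \<in> Y" using \<open>x \<in> \<Union>\<D>\<close> \<open>y \<in> \<Union>\<D>\<close> by blast
        then have "\<exists>Z\<in>\<D>. x \<in> Z \<and> y \<in> Z" using tot[of X Y] by auto
        then obtain Z where Z: "Z \<in> \<D>" "x \<in> Z" "y \<in> Z" by blast
        then have "Z \<in> \<C>" using sub by auto
        then have "x + y \<in> Z" using Z unfolding \<C>_def by simp
        then show ?thesis using Z by auto
      qed
      moreover have "t *\<^sub>R x \<in> \<Union>\<D>" if "x \<in> \<Union>\<D>" "t > 0" for x t
        using that sub unfolding \<C>_def by fastforce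
      moreover have "open (\<Union>\<D>)" using sub by (auto simp: \<C>_def)
      moreover have "0 \<notin> \<Union>\<D>" using sub by (auto simp: \<C>_def)
      moreover have "C0 \<subseteq> \<Union>\<D> \<and> \<Union>\<D> \<noteq> {}"
      proof -
        obtain Z where Z: "Z \<in> \<D>" using \<open>\<D> \<noteq> {}\<close> by blast
        then have "Z \<in> \<C>" "C0 \<subseteq> Z" using sub by auto
        then show ?thesis using Z unfolding \<C>_def by blast
      qed
      ultimately show "\<Union>\<D> \<in> ?A" unfolding \<C>_def by blast
    qed
    then obtain C where C: "C \<in> ?A" "\<forall>X\<in>?A. C \<subseteq> X \<longrightarrow> X = C" by (rule bexE)
    have "\<forall>C'\<in>\<C>. C \<subseteq> C' \<longrightarrow> C' = C"
    proof (intro ballI impI)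
      fix C' assume "C' \<in> \<C>" "C \<subseteq> C'"
      then have "C' \<in> ?A" using C(1) by auto
      then show "C' = C" using C(2) \<open>C \<subseteq> C'\<close> by (auto dest: bspec)
    qed
    then show ?thesis using C(1) by (intro bexI[of _ C]) auto
  qed
  then obtain C where C: "C \<in> \<C>" "C0 \<subseteq> C" "\<forall>C'\<in>\<C>. C \<subseteq> C' \<longrightarrow> C' = C" by blast
  then have max: "\<And>C'. C' \<in> \<C> \<Longrightarrow> C \<subseteq> C' \<Longrightarrow> C' = C" by blast
  have oC: "open C" and neC: "C \<noteq> {}" and zC: "0 \<notin> C"
    and addC: "\<And>x y. x \<in> C \<Longrightarrow> y \<in> C \<Longrightarrow> x + y \<in> C"
    and scC: "\<And>x t. x \<in> C \<Longrightarrow> t > 0 \<Longrightarrow> t *\<^sub>R x \<in> C"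
    using C(1) by (auto simp: \<C>_def)
  \<comment> \<open>Adding the ray through \<open>x\<close> to \<open>C\<close> gives a larger open
    convex cone, which misses the origin as long as \<open>- x\<close> is outside \<open>C\<close>.
    Maximality then forces it to be \<open>C\<close> itself.\<close>
  have key: "c + x \<in> C" if "- x \<notin> C" "c \<in> C" for x c
  proof -
    define C' where "C' = (\<Union>t\<in>{0..}. (+) (t *\<^sub>R x) ` C)"
    have "open C'" unfolding C'_def by (intro open_UN ballI open_translation oC)
    moreover have CC': "C \<subseteq> C'" unfolding C'_def by (auto intro!: bexI[of _ 0])
    moreover have "0 \<notin> C'"
    proof
      assume "0 \<in> C'"
      then obtain t d where td: "t \<in> {0..}" "d \<in> C" "0 = t *\<^sub>R x + d" unfolding C'_def by blast
      then have d: "d = t *\<^sub>R (- x)" using minus_unique[OF td(3)[symmetric]] by simp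
      with td zC have "t > 0" by (cases "t = 0") auto
      then have "- x = (1 / t) *\<^sub>R d" by (simp add: d)
      then show False using scC[OF td(2), of "1/t"] \<open>t > 0\<close> that by simp
    qed
    moreover have "u + v \<in> C'" if "u \<in> C'" "v \<in> C'" for u v
    proof -
      obtain s a where "s \<ge> 0" "a \<in> C" "u = s *\<^sub>R x + a" using \<open>u \<in> C'\<close> unfolding C'_def by auto
      moreover obtain t b where "t \<ge> 0" "b \<in> C" "v = t *\<^sub>R x + b" using \<open>v \<in> C'\<close> unfolding C'_def by auto
      ultimately show ?thesis unfolding C'_def
        by (intro UN_I[of "s + t"]) (auto simp: scaleR_add_left intro!: image_eqI[of _ _ "a + b"] addC)
    qed
    moreover have "t *\<^sub>R u \<in> C'" if "u \<in> C'" "t > 0" for u t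
    proof -
      obtain s a where "s \<ge> 0" "a \<in> C" "u = s *\<^sub>R x + a" using \<open>u \<in> C'\<close> unfolding C'_def by auto
      then show ?thesis unfolding C'_def using \<open>t > 0\<close>
        by (intro UN_I[of "t * s"]) (auto simp: scaleR_add_right intro!: image_eqI[of _ _ "t *\<^sub>R a"] scC)
    qed
    ultimately have "C' \<in> \<C>" using neC by (auto simp: \<C>_def)
    then have "C' = C" using max CC' by auto
    moreover have "c + x \<in> C'" unfolding C'_def using that by (intro UN_I[of 1]) auto
    ultimately show ?thesis by simp
  qed
  obtain e where e: "e \<in> C" using neC by auto
  \<comment> \<open>This will be the kernel of the functional; by \<open>key\<close> it contains
    every \<open>x\<close> such that neither \<open>x\<close> nor \<open>- x\<close> lies in
    \<open>C\<close>.\<close>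
  define N where "N = {x. (\<forall>c\<in>C. c + x \<in> C) \<and> (\<forall>c\<in>C. c - x \<in> C)}"
  have N_add: "x + y \<in> N" if "x \<in> N" "y \<in> N" for x y
    using that unfolding N_def by (auto simp: add.assoc[symmetric] diff_diff_eq[symmetric])
  have N_neg: "- x \<in> N" if "x \<in> N" for x using that unfolding N_def by auto
  have N_sc_pos: "t *\<^sub>R x \<in> N" if "x \<in> N" "t > 0" for x t
  proof -
    have "c + t *\<^sub>R x \<in> C \<and> c - t *\<^sub>R x \<in> C" if "c \<in> C" for c
    proof -
      have "(1/t) *\<^sub>R c \<in> C" using scC that \<open>t > 0\<close> by simp
      then have "(1/t) *\<^sub>R c + x \<in> C" "(1/t) *\<^sub>R c - x \<in> C" using \<open>x \<in> N\<close> by (auto simp: N_def)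
      from this[THEN scC, OF \<open>t > 0\<close>] show ?thesis using \<open>t > 0\<close>
        by (simp add: scaleR_add_right scaleR_diff_right)
    qed
    then show ?thesis by (simp add: N_def)
  qed
  have N0: "0 \<in> N" by (simp add: N_def)
  have N_sc: "t *\<^sub>R x \<in> N" if "x \<in> N" for x t
  proof (cases "t = 0")
    case False
    then consider "t > 0" | "t < 0" by linarith
    then show ?thesis
    proof cases
      case 2
      then have "(- t) *\<^sub>R x \<in> N" using N_sc_pos[OF that, of "-t"] by simp
      then show ?thesis using N_neg by fastforce
    qed (use N_sc_pos that in auto)
  qed (simp add: N0)
  have CN: "x \<notin> N" if "x \<in> C" for x
    using that zC unfolding N_def by force
  have tri: "x \<in> C \<or> - x \<in> C \<or> x \<in> N" for x
    using key[of x] key[of "- x"] by (auto simp: N_def)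
  have disj: "- x \<notin> C" if "x \<in> C" for x
    using addC[OF that, of "- x"] zC by auto
  \<comment> \<open>Otherwise the real line would split into the two disjoint open sets of those
    \<open>t\<close> for which \<open>x - t e\<close> lies in \<open>C\<close> or in
    \<open>- C\<close>. Both are nonempty, because \<open>e + x / T\<close> and
    \<open>e - x / T\<close> are close to \<open>e\<close> for large \<open>T\<close>.\<close>
  have ex: "\<exists>t. x - t *\<^sub>R e \<in> N" for x
  proof (rule ccontr)
    assume no: "\<not> ?thesis"
    define A where "A = (\<lambda>t. x - t *\<^sub>R e) -` C"
    define B where "B = (\<lambda>t. t *\<^sub>R e - x) -` C"
    have "open A" "open B"
      unfolding A_def B_def by (intro open_vimage oC continuous_intros)+
    moreover have "A \<union> B = UNIV" using tri[of "x - _ *\<^sub>R e"] no by (auto simp: A_def B_def)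
    moreover have "A \<inter> B = {}" using disj[of "x - _ *\<^sub>R e"] by (auto simp: A_def B_def)
    moreover obtain r where r: "r > 0" "\<And>y. dist y e < r \<Longrightarrow> y \<in> C"
      using oC e unfolding open_dist by blast
    have *: "e + y \<in> C" if "norm y < r" for y using r(2)[of "e + y"] that by (simp add: dist_norm)
    obtain T :: real where T: "T > 0" "norm x / T < r"
    proof
      show "norm x / r + 1 > 0" using r by (simp add: add_nonneg_pos)
      show "norm x / (norm x / r + 1) < r" using r \<open>norm x / r + 1 > 0\<close>
        by (simp add: divide_less_eq algebra_simps)
    qed
    have "e + (1/T) *\<^sub>R x \<in> C" "e + (1/T) *\<^sub>R (- x) \<in> C" using T by (intro *; simp)+
    from this[THEN scC, OF T(1)] have "x - (- T) *\<^sub>R e \<in> C" "T *\<^sub>R e - x \<in> C"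
      using T by (auto simp: scaleR_add_right scaleR_diff_right add.commute)
    then have "- T \<in> A" "T \<in> B" by (auto simp: A_def B_def)
    ultimately show False
      using connected_UNIV[where 'a=real] unfolding connected_def by blast
  qed
  have uniq: "s = t" if "x - s *\<^sub>R e \<in> N" "x - t *\<^sub>R e \<in> N" for x s t
  proof (rule ccontr)
    assume "s \<noteq> t"
    have "(x - s *\<^sub>R e) + - (x - t *\<^sub>R e) \<in> N" using that N_add N_neg by blast
    then have "(t - s) *\<^sub>R e \<in> N" by (simp add: algebra_simps)
    then have "(1/(t - s)) *\<^sub>R ((t - s) *\<^sub>R e) \<in> N" by (rule N_sc)
    then show False using CN[OF e] \<open>s \<noteq> t\<close> by simp
  qed
  define h where "h x = (THE t. x - t *\<^sub>R e \<in> N)" for x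
  have h: "x - h x *\<^sub>R e \<in> N" for x unfolding h_def using ex uniq by (metis (mono_tags) the_equality)
  have hI: "h x = t" if "x - t *\<^sub>R e \<in> N" for x t using uniq h that by blast
  have h_add: "h (x + y) = h x + h y" for x y
  proof (rule hI)
    have "(x + y) - (h x + h y) *\<^sub>R e = (x - h x *\<^sub>R e) + (y - h y *\<^sub>R e)" by (simp add: algebra_simps)
    then show "(x + y) - (h x + h y) *\<^sub>R e \<in> N" using N_add[OF h[of x] h[of y]] by (simp only:)
  qed
  have h_sc: "h (t *\<^sub>R x) = t * h x" for t x
  proof (rule hI)
    have "t *\<^sub>R x - (t * h x) *\<^sub>R e = t *\<^sub>R (x - h x *\<^sub>R e)" by (simp add: algebra_simps)
    then show "t *\<^sub>R x - (t * h x) *\<^sub>R e \<in> N" using N_sc[OF h[of x], of t] by (simp only:)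
  qed
  have he: "h e = 1" by (rule hI) (simp add: N0)
  have h_pos: "h x > 0" if "x \<in> C" for x
  proof (rule ccontr)
    assume "\<not> h x > 0"
    have "x - h x *\<^sub>R e \<in> C"
    proof (cases "h x = 0")
      case False
      then have "(- h x) *\<^sub>R e \<in> C" using \<open>\<not> h x > 0\<close> e by (intro scC) auto
      then show ?thesis using addC[OF that] by fastforce
    qed (use that in simp)
    then show False using CN h by blast
  qed
  obtain r where r: "r > 0" "\<And>y. dist y e < r \<Longrightarrow> y \<in> C"
    using oC e unfolding open_dist by blast
  \<comment> \<open>Continuity comes from openness of \<open>C\<close> at \<open>e\<close>:
    \<open>h\<close> is positive at \<open>e + y\<close> for small \<open>y\<close>, and using both
    signs of a multiple of \<open>x\<close> bounds the absolute value.\<close>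
  have lt1: "- h y < 1" if "norm y < r" for y
    using h_pos[OF r(2)[of "e + y"]] that by (simp add: dist_norm h_add he)
  have bound: "norm (h x) \<le> norm x * (2 / r)" for x
  proof (cases "x = 0")
    case True
    then show ?thesis using h_sc[of 0 0] by simp
  next
    case False
    let ?c = "r / (2 * norm x)"
    have c: "?c > 0" "norm (?c *\<^sub>R x) < r" "norm ((- ?c) *\<^sub>R x) < r" using False r by auto
    have "- (?c * h x) < 1" "- ((- ?c) * h x) < 1"
      using lt1[OF c(2)] lt1[OF c(3)] unfolding h_sc .
    then have "?c * \<bar>h x\<bar> \<le> 1" by (auto simp: abs_if)
    then show ?thesis using False r by (simp add: field_simps)
  qed
  have bl: "bounded_linear h"
    by (rule bounded_linear_intro[OF _ _ bound]) (auto simp: h_add h_sc)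
  have "E \<subseteq> C0" by (auto simp: C0_def intro!: bexI[of _ 1])
  then have "blinfun_apply (Blinfun h) x > 0" if "x \<in> E" for x
    using h_pos[of x] C(2) that bounded_linear_Blinfun_apply[OF bl] by auto
  then show ?thesis by blast
qed auto

text \<open>The open ball around \<open>x - y\<close> with radius \<open>norm (x - y)\<close> misses
  the origin, so some functional is positive at its centre.\<close>

lemma blinfun_real_separates:
  fixes x y :: "'a::real_normed_vector"
  assumes "\<And>h::'a \<Rightarrow>\<^sub>L real. h x = h y"
  shows "x = y"
proof (rule ccontr)
  assume "x \<noteq> y"
  then have "0 \<notin> ball (x - y) (norm (x - y))" by (simp add: dist_norm)
  then obtain h :: "'a \<Rightarrow>\<^sub>L real" where "\<forall>z\<in>ball (x - y) (norm (x - y)). h z > 0"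
    using open_convex_positive_functional[OF open_ball convex_ball] by blast
  moreover have "x - y \<in> ball (x - y) (norm (x - y))" using \<open>x \<noteq> y\<close> by simp
  ultimately have "h (x - y) > 0" by blast
  then show False using assms[of h] by (simp add: blinfun.diff_right)
qed

text \<open>\<open>R\<close> is only a semigroup, neither convex nor closed under scaling, so it
  cannot be separated from the cone \<open>K\<close> over \<open>D\<close> directly. Instead
  \<open>K\<close> is enlarged to the set \<open>E\<close> of all \<open>x\<close> for which some
  \<open>k x + y\<close>, with an integer \<open>k\<close> at least 1 and \<open>y\<close> in
  \<open>R\<close>, lies in \<open>K\<close>. Integer multipliers give closure under sums and under
  positive rational factors, openness extends this to real factors, and \<open>E\<close> misses the
  origin because \<open>K\<close> misses \<open>R\<close>. A functional positive on the open convex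
  cone \<open>E\<close> is then nonpositive on \<open>R\<close>.\<close>

lemma semigroup_separation:
  fixes R D :: "'a::real_normed_vector set"
  assumes R0: "0 \<in> R" and Radd: "\<And>x y. x \<in> R \<Longrightarrow> y \<in> R \<Longrightarrow> x + y \<in> R"
    and D: "open D" "convex D" "D \<noteq> {}"
    and disj: "\<And>c x. c > 0 \<Longrightarrow> x \<in> D \<Longrightarrow> c *\<^sub>R x \<notin> R"
  shows "\<exists>h::'a \<Rightarrow>\<^sub>L real. (\<forall>x\<in>D. h x > 0) \<and> (\<forall>x\<in>R. h x \<le> 0)"
proof -
  define K where "K = (\<Union>t\<in>{0<..}. (*\<^sub>R) t ` D)"
  have oK: "open K" unfolding K_def by (intro open_UN ballI open_scaling D) auto
  have DK: "D \<subseteq> K" by (auto simp: K_def intro!: bexI[of _ 1])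
  have addK: "x + y \<in> K" if "x \<in> K" "y \<in> K" for x y
    using convex_positive_multiples_add[OF D(2)] that unfolding K_def by blast
  have scK: "t *\<^sub>R x \<in> K" if "x \<in> K" "t > 0" for x t
  proof -
    obtain s u where s: "s > 0" "u \<in> D" "x = s *\<^sub>R u" using \<open>x \<in> K\<close> by (auto simp: K_def)
    then show ?thesis using that unfolding K_def by (intro UN_I[of "t * s"]) auto
  qed
  have KR: "x \<notin> R" if "x \<in> K" for x using that disj by (auto simp: K_def)
  have Rmult: "real k *\<^sub>R x \<in> R" if "x \<in> R" for k x
    by (induction k) (auto simp: R0 scaleR_add_left intro!: Radd that)
  define E where "E = {x. \<exists>k::nat. \<exists>y\<in>R. k \<ge> 1 \<and> real k *\<^sub>R x + y \<in> K}"
  have "E = (\<Union>k\<in>{1::nat..}. \<Union>y\<in>R. (\<lambda>x. real k *\<^sub>R x + y) -` K)" by (auto simp: E_def)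
  then have oE: "open E" by (auto intro!: open_vimage oK continuous_intros)
  have KE: "x \<in> E" if "x \<in> K" for x
    unfolding E_def using R0 that by (intro CollectI exI[of _ 1] bexI[of _ 0]) auto
  have E0: "0 \<notin> E" using KR by (auto simp: E_def)
  have addE: "x1 + x2 \<in> E" if "x1 \<in> E" "x2 \<in> E" for x1 x2
  proof -
    obtain k1 y1 where 1: "k1 \<ge> 1" "y1 \<in> R" "real k1 *\<^sub>R x1 + y1 \<in> K"
      using \<open>x1 \<in> E\<close> by (auto simp: E_def)
    obtain k2 y2 where 2: "k2 \<ge> 1" "y2 \<in> R" "real k2 *\<^sub>R x2 + y2 \<in> K"
      using \<open>x2 \<in> E\<close> by (auto simp: E_def)
    have "real k2 *\<^sub>R (real k1 *\<^sub>R x1 + y1) + real k1 *\<^sub>R (real k2 *\<^sub>R x2 + y2) \<in> K"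
      using scK[OF 1(3), of "real k2"] scK[OF 2(3), of "real k1"] 1(1) 2(1) by (intro addK) auto
    moreover have "real k2 *\<^sub>R y1 + real k1 *\<^sub>R y2 \<in> R" using 1 2 by (intro Radd Rmult)
    ultimately show ?thesis using 1 2 unfolding E_def
      by (intro CollectI exI[of _ "k1 * k2"] bexI[of _ "real k2 *\<^sub>R y1 + real k1 *\<^sub>R y2"])
        (auto simp: algebra_simps)
  qed
  have natE: "real k *\<^sub>R x \<in> E" if "x \<in> E" "k \<ge> 1" for x k
    using \<open>k \<ge> 1\<close> by (induction k rule: dec_induct) (auto simp: scaleR_add_left intro!: addE \<open>x \<in> E\<close>)
  have divE: "(1 / real q) *\<^sub>R x \<in> E" if "x \<in> E" "q \<ge> 1" for x q
  proof -
    obtain k y where 1: "k \<ge> 1" "y \<in> R" "real k *\<^sub>R x + y \<in> K"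
      using \<open>x \<in> E\<close> by (auto simp: E_def)
    then show ?thesis using that unfolding E_def
      by (intro CollectI exI[of _ "k * q"] bexI[of _ y]) auto
  qed
  \<comment> \<open>Write \<open>c = q * (c / q)\<close> with \<open>q\<close> rational and
    \<open>c / q\<close> so close to 1 that openness of \<open>E\<close> keeps
    \<open>(c / q) x\<close> inside; the rational factor is handled by \<open>divE\<close> and
    \<open>natE\<close>.\<close>
  have scE: "c *\<^sub>R x \<in> E" if "x \<in> E" "c > 0" for x c
  proof -
    have "open ((\<lambda>t. t *\<^sub>R x) -` E)" by (intro open_vimage oE continuous_intros)
    moreover have "1 \<in> (\<lambda>t. t *\<^sub>R x) -` E" using \<open>x \<in> E\<close> by simp
    ultimately obtain d where d: "d > 0" "\<And>t. dist t 1 < d \<Longrightarrow> t *\<^sub>R x \<in> E"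
      unfolding open_dist by blast
    have "c / (1 + d) < c" using \<open>c > 0\<close> d by (simp add: field_simps)
    then obtain q where q: "q \<in> \<rat>" "c / (1 + d) < q" "q < c" using Rats_dense_in_real by blast
    have "q > 0" using q(2) \<open>c > 0\<close> d(1) by (smt (verit) divide_pos_pos)
    then obtain m n where mn: "n \<noteq> 0" "q = real m / real n"
      using Rats_abs_nat_div_natE[OF q(1)] by (metis abs_of_pos)
    then have m: "m \<ge> 1" using \<open>q > 0\<close> by (cases m) auto
    have "c / q < 1 + d" "c / q > 1" using q \<open>q > 0\<close> d by (auto simp: field_simps)
    then have "(c / q) *\<^sub>R x \<in> E" by (intro d) (auto simp: dist_real_def)
    then have "real m *\<^sub>R ((1 / real n) *\<^sub>R ((c / q) *\<^sub>R x)) \<in> E"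
      using mn m by (intro natE divE) auto
    moreover have "real m * (1 / real n * (c / q)) = c" using mn m by (simp add: field_simps)
    ultimately show ?thesis by (simp add: scaleR_scaleR)
  qed
  have "convex E" unfolding convex_def
  proof (intro ballI allI impI)
    fix x y and u v :: real assume "x \<in> E" "y \<in> E" "0 \<le> u" "0 \<le> v" "u + v = 1"
    then consider "u = 0" "v = 1" | "u = 1" "v = 0" | "u > 0" "v > 0" by linarith
    then show "u *\<^sub>R x + v *\<^sub>R y \<in> E"
      by cases (use \<open>x \<in> E\<close> \<open>y \<in> E\<close> addE scE in auto)
  qed
  from open_convex_positive_functional[OF oE this E0]
  obtain h :: "'a \<Rightarrow>\<^sub>L real" where h: "\<And>x. x \<in> E \<Longrightarrow> h x > 0" by blast
  obtain d where d: "d \<in> D" using D by auto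
  \<comment> \<open>For every \<open>t > 0\<close> the point \<open>t d - y\<close> belongs to
    \<open>E\<close>, with witnesses 1 and \<open>y\<close>, so
    \<open>h y < t * h d\<close>.\<close>
  have "h y \<le> 0" if "y \<in> R" for y
  proof (rule field_le_epsilon)
    fix \<epsilon> :: real assume "\<epsilon> > 0"
    have hd: "h d > 0" using d DK KE h by auto
    define t where "t = \<epsilon> / h d"
    have "t > 0" using hd \<open>\<epsilon> > 0\<close> by (simp add: t_def)
    have "t *\<^sub>R d - y \<in> E" unfolding E_def
      using that scK[of d t] d DK \<open>t > 0\<close> by (intro CollectI exI[of _ 1] bexI[of _ y]) auto
    then have "h y < t * h d" using h by (fastforce simp: blinfun.diff_right blinfun.scaleR_right)
    then show "h y \<le> 0 + \<epsilon>" using hd by (simp add: t_def)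
  qed
  then show ?thesis using DK KE h by blast
qed

subsection \<open>Sums of independent identically distributed vectors\<close>

text \<open>If every point of \<open>U\<close> were the centre of a null ball, countably many of
  these balls would cover \<open>U\<close> by Lindelof's theorem.\<close>

lemma open_positive_imp_support_point:
  fixes \<nu> :: "'a::{metric_space, second_countable_topology} measure"
  assumes sets: "sets \<nu> = sets borel" and U: "open U" "emeasure \<nu> U \<noteq> 0"
  shows "\<exists>y\<in>U. \<forall>d>0. emeasure \<nu> (ball y d) \<noteq> 0"
proof (rule ccontr)
  assume "\<not> ?thesis"
  then obtain d where d: "\<And>y. y \<in> U \<Longrightarrow> d y > 0 \<and> emeasure \<nu> (ball y (d y)) = 0"
    by metis
  define F where "F = (\<lambda>y. ball y (d y)) ` U"
  obtain F' where F': "F' \<subseteq> F" "countable F'" "\<Union>F' = \<Union>F"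
    by (rule Lindelof[of F]) (auto simp: F_def)
  have "B \<in> null_sets \<nu>" if "B \<in> F'" for B
    using that F'(1) d by (auto simp: F_def null_sets_def sets)
  then have null: "(\<Union>B\<in>F'. B) \<in> null_sets \<nu>"
    using F'(2) by (intro null_sets_UN') auto
  have "U \<subseteq> \<Union>F"
  proof
    fix y assume "y \<in> U"
    then have "y \<in> ball y (d y)" "ball y (d y) \<in> F" using d[of y] by (auto simp: F_def)
    then show "y \<in> \<Union>F" by blast
  qed
  then have sub: "U \<subseteq> (\<Union>B\<in>F'. B)" using F'(3) by simp
  have "U \<in> sets \<nu>" using U(1) sets by simp
  from null_sets_subset[OF null this sub] have "U \<in> null_sets \<nu>" .
  then show False using U(2) by auto
qed

text \<open>On the layer between \<open>4 ^ k\<close> and \<open>4 ^ Suc k\<close> the power 3/2 is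
  at most \<open>8 ^ Suc k\<close>, since 4^(3/2) = 8; the summand 1 takes care of \<open>r\<close>
  up to 1.\<close>

lemma sqrt_cube_layers:
  fixes r :: real
  assumes "r \<ge> 0"
  shows "ennreal (r * sqrt r) \<le> 1 + (\<Sum>k. ennreal (8 ^ Suc k) * indicator {4 ^ k<..} r)"
proof (cases "r \<le> 1")
  case True
  then have "r * sqrt r \<le> 1 * 1" using assms by (intro mult_mono) auto
  then have "ennreal (r * sqrt r) \<le> 1" by (metis ennreal_1 ennreal_leI mult_1)
  then show ?thesis by (simp add: add_increasing2)
next
  case False
  define k where "k = (LEAST k. r \<le> 4 ^ Suc k)"
  have "\<exists>k. r \<le> 4 ^ Suc k"
  proof -
    obtain n where "r < 4 ^ n" using real_arch_pow[of 4 r] by auto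
    also have "(4::real) ^ n \<le> 4 ^ Suc n" by simp
    finally show ?thesis by (intro exI[of _ n]) simp
  qed
  then have k: "r \<le> 4 ^ Suc k" unfolding k_def by (rule LeastI_ex)
  have "4 ^ k < r"
  proof (cases k)
    case (Suc m)
    then have "\<not> r \<le> 4 ^ Suc m" unfolding k_def using not_less_Least[of m] by (metis lessI)
    then show ?thesis by (simp add: Suc)
  qed (use False in simp)
  have "sqrt r \<le> sqrt (4 ^ Suc k)" using k by (intro real_sqrt_le_mono)
  also have "\<dots> = 2 ^ Suc k" by (simp add: real_sqrt_power real_sqrt_mult)
  finally have "r * sqrt r \<le> 4 ^ Suc k * 2 ^ Suc k" using k assms by (intro mult_mono) auto
  also have "\<dots> = 8 ^ Suc k" by (simp flip: power_mult_distrib)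
  finally have le: "r * sqrt r \<le> 8 ^ Suc k" .
  define f where "f k = ennreal (8 ^ Suc k) * indicator {4 ^ k<..} r" for k
  have "ennreal (r * sqrt r) \<le> f k"
    unfolding f_def using \<open>4 ^ k < r\<close> ennreal_leI[OF le] by simp
  also have "\<dots> \<le> (\<Sum>k. f k)" using sum_le_suminf[of f "{k}"] by simp
  finally show ?thesis by (simp add: f_def add_increasing)
qed

text \<open>The hypothesis is a tail of order t^(-2) at the points \<open>4 ^ k\<close>. The layer
  \<open>k\<close> contributes at most \<open>8 ^ Suc k / 16 ^ k\<close>, a geometric series with
  ratio 1/2.\<close>

lemma (in prob_space) integrable_sqrt_cube:
  assumes R[measurable]: "random_variable borel R" and R0: "\<And>\<omega>. R \<omega> \<ge> 0"
    and tail: "\<And>k::nat. prob {\<omega>\<in>space M. R \<omega> > 4 ^ k} \<le> 1 / 16 ^ k"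
  shows "integrable M (\<lambda>\<omega>. R \<omega> * sqrt (R \<omega>))"
proof (rule integrableI_nonneg)
  have "(\<integral>\<^sup>+\<omega>. ennreal (R \<omega> * sqrt (R \<omega>)) \<partial>M)
    \<le> (\<integral>\<^sup>+\<omega>. 1 + (\<Sum>k. ennreal (8 ^ Suc k) * indicator {4 ^ k<..} (R \<omega>)) \<partial>M)"
    by (intro nn_integral_mono sqrt_cube_layers R0)
  also have "\<dots> = 1 + (\<Sum>k. ennreal (8 ^ Suc k) * (\<integral>\<^sup>+\<omega>. indicator {4 ^ k<..} (R \<omega>) \<partial>M))"
    by (simp add: nn_integral_add nn_integral_suminf nn_integral_cmult emeasure_space_1)
  also have "\<dots> \<le> 1 + (\<Sum>k. ennreal (8 * (1 / 2) ^ k))"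
  proof (intro add_left_mono suminf_le summableI)
    fix k :: nat
    have "(\<integral>\<^sup>+\<omega>. indicator {4 ^ k<..} (R \<omega>) \<partial>M) = (\<integral>\<^sup>+\<omega>. indicator {\<omega>\<in>space M. R \<omega> > 4 ^ k} \<omega> \<partial>M)"
      by (intro nn_integral_cong) (auto split: split_indicator)
    also have "\<dots> \<le> ennreal (1 / 16 ^ k)"
      using tail[of k] by (simp add: emeasure_eq_measure ennreal_leI)
    finally have "ennreal (8 ^ Suc k) * (\<integral>\<^sup>+\<omega>. indicator {4 ^ k<..} (R \<omega>) \<partial>M)
      \<le> ennreal (8 ^ Suc k) * ennreal (1 / 16 ^ k)" by (rule mult_left_mono) simp
    also have "\<dots> = ennreal (8 ^ Suc k * (1 / 16 ^ k))" by (rule ennreal_mult[symmetric]) auto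
    also have "8 ^ Suc k * (1 / 16 ^ k) = 8 * (1 / 2 :: real) ^ k"
      by (simp add: power_divide flip: power_mult_distrib)
        (simp add: field_simps flip: power_mult_distrib)
    finally show "ennreal (8 ^ Suc k) * (\<integral>\<^sup>+\<omega>. indicator {4 ^ k<..} (R \<omega>) \<partial>M)
      \<le> ennreal (8 * (1 / 2) ^ k)" .
  qed
  also have "(\<Sum>k. ennreal (8 * (1 / 2) ^ k)) = ennreal (\<Sum>k. 8 * (1 / 2) ^ k)"
    by (intro suminf_ennreal_eq summable_sums) (auto intro!: summable_mult summable_geometric)
  also have "1 + \<dots> < \<infinity>" by simp
  finally show "(\<integral>\<^sup>+\<omega>. ennreal (R \<omega> * sqrt (R \<omega>)) \<partial>M) < \<infinity>" .
qed (auto simp: R0)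

section \<open>Laws of block sums, a maximal inequality, and tails of the norm of one
  summand\<close>

locale iid_seq = prob_space M for M :: "'w measure" +
  fixes X :: "nat \<Rightarrow> 'w \<Rightarrow> 'a::{banach, second_countable_topology}" and \<mu> :: "'a measure"
  assumes indep: "indep_vars (\<lambda>_. borel) X UNIV" and law: "\<And>i. distr M borel (X i) = \<mu>"
begin

lemma X_measurable[measurable]: "X i \<in> borel_measurable M"
  using indep unfolding indep_vars_def by auto

sublocale \<mu>: prob_space \<mu>
  unfolding law[of 0, symmetric] by (rule prob_space_distr) simp

lemma sets_law[measurable_cong, simp]: "sets \<mu> = sets borel"
  unfolding law[of 0, symmetric] by simp

lemma space_law[simp]: "space \<mu> = UNIV"
  unfolding law[of 0, symmetric] by simp

lemma distr_tuple:
  assumes "I \<noteq> {}"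
  shows "distr M (PiM I (\<lambda>_. borel)) (\<lambda>\<omega>. \<lambda>i\<in>I. X i \<omega>) = PiM I (\<lambda>_. \<mu>)"
  using indep_vars_iff_distr_eq_PiM[where I=I and M'="\<lambda>_. borel" and X=X] assms indep_vars_subset[OF indep, of I]
  by (simp add: law)

lemma distr_sum_eq_PiM:
  assumes "finite I" "I \<noteq> {}"
  shows "distr M borel (\<lambda>\<omega>. \<Sum>i\<in>I. X i \<omega>) = distr (PiM I (\<lambda>_. \<mu>)) borel (\<lambda>x. \<Sum>i\<in>I. x i)"
proof -
  have [measurable]: "(\<lambda>x::nat \<Rightarrow> 'a. \<Sum>i\<in>I. x i) \<in> borel_measurable (PiM I (\<lambda>_. borel))"
    by (intro borel_measurable_sum measurable_component_singleton) auto
  show ?thesis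
    unfolding distr_tuple[OF assms(2), symmetric]
    by (subst distr_distr) (auto simp: comp_def intro!: distr_cong sum.cong)
qed

text \<open>This allows a block such as \<open>{k..<n}\<close> to be shifted to an initial segment,
  and the sums over \<open>{1..n}\<close> of the theorem to be replaced by sums over
  \<open>{..<n}\<close>.\<close>

lemma distr_sum_cong:
  assumes "finite I" "finite J" "card I = card J"
  shows "distr M borel (\<lambda>\<omega>. \<Sum>i\<in>I. X i \<omega>) = distr M borel (\<lambda>\<omega>. \<Sum>i\<in>J. X i \<omega>)"
proof (cases "I = {}")
  case True
  then show ?thesis using assms by auto
next
  case False
  then have "J \<noteq> {}" using assms by auto
  obtain f where f: "bij_betw f I J" using finite_same_card_bij[OF assms] by blast
  have [measurable]: "(\<lambda>x::nat \<Rightarrow> 'a. \<Sum>i\<in>I. x i) \<in> borel_measurable (PiM I (\<lambda>_. \<mu>))"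
    by (intro borel_measurable_sum measurable_component_singleton) auto
  have "PiM I (\<lambda>_. \<mu>) = distr (PiM J (\<lambda>_. \<mu>)) (PiM I (\<lambda>_. \<mu>)) (\<lambda>\<omega>. \<lambda>n\<in>I. \<omega> (f n))"
    using distr_PiM_reindex[of J "\<lambda>_. \<mu>" f I] f \<mu>.prob_space_axioms
    by (auto simp: bij_betw_def)
  then have "distr (PiM I (\<lambda>_. \<mu>)) borel (\<lambda>x. \<Sum>i\<in>I. x i)
    = distr (distr (PiM J (\<lambda>_. \<mu>)) (PiM I (\<lambda>_. \<mu>)) (\<lambda>\<omega>. \<lambda>n\<in>I. \<omega> (f n))) borel (\<lambda>x. \<Sum>i\<in>I. x i)"
    by simp
  also have "\<dots> = distr (PiM J (\<lambda>_. \<mu>)) borel ((\<lambda>x. \<Sum>i\<in>I. x i) \<circ> (\<lambda>\<omega>. \<lambda>n\<in>I. \<omega> (f n)))"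
    using f by (intro distr_distr) (auto intro!: measurable_restrict measurable_component_singleton
        simp: bij_betw_def)
  also have "\<dots> = distr (PiM J (\<lambda>_. \<mu>)) borel (\<lambda>x. \<Sum>i\<in>J. x i)"
  proof (rule distr_cong)
    show "((\<lambda>x. \<Sum>i\<in>I. x i) \<circ> (\<lambda>\<omega>. \<lambda>n\<in>I. \<omega> (f n))) x = (\<Sum>i\<in>J. x i)" for x :: "nat \<Rightarrow> 'a"
      using sum.reindex_bij_betw[OF f, of x] by simp
  qed auto
  finally show ?thesis
    using distr_sum_eq_PiM[OF assms(1) False] distr_sum_eq_PiM[OF assms(2) \<open>J \<noteq> {}\<close>] by simp
qed

lemma prob_sum_cong:
  assumes "finite I" "finite J" "card I = card J" and A: "A \<in> sets borel"
  shows "prob {\<omega>\<in>space M. (\<Sum>i\<in>I. X i \<omega>) \<in> A} = prob {\<omega>\<in>space M. (\<Sum>i\<in>J. X i \<omega>) \<in> A}"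
proof -
  have "prob {\<omega>\<in>space M. (\<Sum>i\<in>I. X i \<omega>) \<in> A} = measure (distr M borel (\<lambda>\<omega>. \<Sum>i\<in>I. X i \<omega>)) A" for I
    using A by (subst measure_distr) (auto intro!: arg_cong[where f=prob])
  then show ?thesis using distr_sum_cong[OF assms(1-3)] by metis
qed

lemma prob_sum_inter:
  assumes I: "finite I" "finite J" "I \<inter> J = {}" and A: "A \<in> sets borel" "B \<in> sets borel"
  shows "prob {\<omega>\<in>space M. (\<Sum>i\<in>I. X i \<omega>) \<in> A \<and> (\<Sum>i\<in>J. X i \<omega>) \<in> B}
    = prob {\<omega>\<in>space M. (\<Sum>i\<in>I. X i \<omega>) \<in> A} * prob {\<omega>\<in>space M. (\<Sum>i\<in>J. X i \<omega>) \<in> B}"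
proof (rule prob_indep_random_variable[OF _ A])
  have "indep_var borel ((\<lambda>f. \<Sum>i\<in>I. f i) \<circ> (\<lambda>\<omega>. restrict (\<lambda>i. X i \<omega>) I))
    borel ((\<lambda>f. \<Sum>i\<in>J. f i) \<circ> (\<lambda>\<omega>. restrict (\<lambda>i. X i \<omega>) J))"
    using I by (intro indep_var_compose[OF indep_var_restrict[OF indep]]) auto
  also have "((\<lambda>f. \<Sum>i\<in>I. f i) \<circ> (\<lambda>\<omega>. restrict (\<lambda>i. X i \<omega>) I)) = (\<lambda>\<omega>. \<Sum>i\<in>I. X i \<omega>)"
    by auto
  also have "((\<lambda>f. \<Sum>i\<in>J. f i) \<circ> (\<lambda>\<omega>. restrict (\<lambda>i. X i \<omega>) J)) = (\<lambda>\<omega>. \<Sum>i\<in>J. X i \<omega>)"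
    by auto
  finally show "indep_var borel (\<lambda>\<omega>. \<Sum>i\<in>I. X i \<omega>) borel (\<lambda>\<omega>. \<Sum>i\<in>J. X i \<omega>)" .
qed

text \<open>Split according to the first index \<open>k\<close> at which the partial sum exceeds
  \<open>2 * t\<close>. This event \<open>E k\<close> is determined by the first \<open>k\<close>
  summands, hence independent of the event \<open>G k\<close> that the remaining block has norm at
  most \<open>t\<close>, whose probability is at least \<open>c\<close>. Where both occur, the full
  sum exceeds \<open>t\<close>.\<close>

lemma ottaviani:
  fixes c t :: real
  assumes c: "\<And>m. m \<le> n \<Longrightarrow> prob {\<omega>\<in>space M. norm (\<Sum>i<m. X i \<omega>) \<le> t} \<ge> c"
  shows "c * prob {\<omega>\<in>space M. \<exists>k\<le>n. norm (\<Sum>i<k. X i \<omega>) > 2 * t}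
    \<le> prob {\<omega>\<in>space M. norm (\<Sum>i<n. X i \<omega>) > t}"
proof -
  define E where "E k = {\<omega>\<in>space M. (\<forall>i\<in>{..<k}. norm (\<Sum>j<i. X j \<omega>) \<le> 2 * t)
    \<and> norm (\<Sum>j<k. X j \<omega>) > 2 * t}" for k
  define G where "G k = {\<omega>\<in>space M. norm (\<Sum>j\<in>{k..<n}. X j \<omega>) \<le> t}" for k
  have [measurable]: "E k \<in> events" "G k \<in> events" for k
    unfolding E_def G_def by measurable
  have EG: "prob (E k \<inter> G k) = prob (E k) * prob (G k)" if "k \<le> n" for k
  proof -
    define P where "P = PiM {..<k} (\<lambda>_. borel :: 'a measure)"
    define Q where "Q = PiM {k..<n} (\<lambda>_. borel :: 'a measure)"
    \<comment> \<open>The truncation at \<open>k\<close> makes \<open>f i\<close> a function of the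
      coordinates below \<open>k\<close> for every \<open>i\<close>, as measurability with respect
      to \<open>P\<close> requires.\<close>
    define f where "f i x = (\<Sum>j<min i k. x j)" for i and x :: "nat \<Rightarrow> 'a"
    have [measurable]: "f i \<in> borel_measurable P" for i
      unfolding f_def P_def by (intro borel_measurable_sum measurable_component_singleton) auto
    have [measurable]: "(\<lambda>x::nat \<Rightarrow> 'a. \<Sum>j\<in>{k..<n}. x j) \<in> borel_measurable Q"
      unfolding Q_def by (intro borel_measurable_sum measurable_component_singleton) auto
    have "indep_var P (\<lambda>\<omega>. restrict (\<lambda>i. X i \<omega>) {..<k}) Q (\<lambda>\<omega>. restrict (\<lambda>i. X i \<omega>) {k..<n})"
      unfolding P_def Q_def by (intro indep_var_restrict[OF indep]) auto
    note * = indep_varD[OF this, of "{x\<in>space P. (\<forall>i\<in>{..<k}. norm (f i x) \<le> 2 * t) \<and> norm (f k x) > 2 * t}"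
        "{x\<in>space Q. norm (\<Sum>j\<in>{k..<n}. x j) \<le> t}"]
    have sp: "restrict (\<lambda>i. X i \<omega>) {..<k} \<in> space P" "restrict (\<lambda>i. X i \<omega>) {k..<n} \<in> space Q" for \<omega>
      by (auto simp: P_def Q_def space_PiM)
    have fX: "f i (restrict (\<lambda>i. X i \<omega>) {..<k}) = (\<Sum>j<i. X j \<omega>)" if "i \<le> k" for i \<omega>
      using that by (auto simp: f_def intro!: sum.cong)
    have "prob (E k \<inter> G k) = prob ((\<lambda>\<omega>. (restrict (\<lambda>i. X i \<omega>) {..<k}, restrict (\<lambda>i. X i \<omega>) {k..<n})) -`
      ({x\<in>space P. (\<forall>i\<in>{..<k}. norm (f i x) \<le> 2 * t) \<and> norm (f k x) > 2 * t} \<times>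
       {x\<in>space Q. norm (\<Sum>j\<in>{k..<n}. x j) \<le> t}) \<inter> space M)"
      using sp fX by (intro arg_cong[where f=prob]) (auto simp: E_def G_def)
    also have "\<dots> = prob ((\<lambda>\<omega>. restrict (\<lambda>i. X i \<omega>) {..<k}) -`
        {x\<in>space P. (\<forall>i\<in>{..<k}. norm (f i x) \<le> 2 * t) \<and> norm (f k x) > 2 * t} \<inter> space M) *
      prob ((\<lambda>\<omega>. restrict (\<lambda>i. X i \<omega>) {k..<n}) -` {x\<in>space Q. norm (\<Sum>j\<in>{k..<n}. x j) \<le> t} \<inter> space M)"
      by (rule *) measurable
    also have "(\<lambda>\<omega>. restrict (\<lambda>i. X i \<omega>) {..<k}) -`
        {x\<in>space P. (\<forall>i\<in>{..<k}. norm (f i x) \<le> 2 * t) \<and> norm (f k x) > 2 * t} \<inter> space M = E k"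
      using sp fX by (auto simp: E_def)
    also have "(\<lambda>\<omega>. restrict (\<lambda>i. X i \<omega>) {k..<n}) -` {x\<in>space Q. norm (\<Sum>j\<in>{k..<n}. x j) \<le> t} \<inter> space M = G k"
      using sp by (auto simp: G_def)
    finally show ?thesis .
  qed
  have Gc: "prob (G k) \<ge> c" if "k \<le> n" for k
    using prob_sum_cong[of "{k..<n}" "{..<n-k}" "cball 0 t"] c[of "n - k"] that by (simp add: G_def)
  have "E k \<inter> E l = {}" if "k < l" for k l using that by (force simp: E_def)
  then have "E k \<inter> E l = {}" if "k \<noteq> l" for k l
    using that by (metis Int_commute linorder_neqE_nat)
  then have disj: "disjoint_family_on (\<lambda>k. E k \<inter> G k) {..n}" "disjoint_family_on E {..n}"
    unfolding disjoint_family_on_def by blast+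
  have "{\<omega>\<in>space M. \<exists>k\<le>n. norm (\<Sum>i<k. X i \<omega>) > 2 * t} = (\<Union>k\<in>{..n}. E k)" (is "?L = _")
  proof
    show "?L \<subseteq> (\<Union>k\<in>{..n}. E k)"
    proof
      fix \<omega> assume "\<omega> \<in> ?L"
      then obtain k where \<omega>: "\<omega> \<in> space M" and k: "k \<le> n" "norm (\<Sum>i<k. X i \<omega>) > 2 * t" by auto
      define k0 where "k0 = (LEAST k. norm (\<Sum>i<k. X i \<omega>) > 2 * t)"
      have "norm (\<Sum>i<k0. X i \<omega>) > 2 * t" unfolding k0_def by (rule LeastI) (rule k(2))
      moreover have "k0 \<le> k" unfolding k0_def by (rule Least_le) (rule k(2))
      moreover have "norm (\<Sum>j<i. X j \<omega>) \<le> 2 * t" if "i < k0" for i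
        using not_less_Least[of i "\<lambda>k. norm (\<Sum>i<k. X i \<omega>) > 2 * t"] that
        by (auto simp: k0_def)
      ultimately show "\<omega> \<in> (\<Union>k\<in>{..n}. E k)" using \<omega> k(1)
        by (intro UN_I[of k0]) (auto simp: E_def)
    qed
  qed (auto simp: E_def)
  then have "c * prob ?L = (\<Sum>k\<le>n. c * prob (E k))"
    by (simp add: finite_measure_finite_Union[OF _ _ disj(2)] sum_distrib_left image_subset_iff)
  also have "\<dots> \<le> (\<Sum>k\<le>n. prob (E k \<inter> G k))"
    by (intro sum_mono) (auto simp: EG mult.commute[of c] intro!: mult_left_mono Gc)
  also have "\<dots> = prob (\<Union>k\<in>{..n}. E k \<inter> G k)"
    by (intro finite_measure_finite_Union[symmetric] disj) auto
  also have "\<dots> \<le> prob {\<omega>\<in>space M. norm (\<Sum>i<n. X i \<omega>) > t}"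
  proof (rule finite_measure_mono)
    show "(\<Union>k\<in>{..n}. E k \<inter> G k) \<subseteq> {\<omega>\<in>space M. norm (\<Sum>i<n. X i \<omega>) > t}"
    proof
      fix \<omega> assume "\<omega> \<in> (\<Union>k\<in>{..n}. E k \<inter> G k)"
      then obtain k where k: "k \<in> {..n}" "\<omega> \<in> E k" "\<omega> \<in> G k" by blast
      have "(\<Sum>i<n. X i \<omega>) = (\<Sum>i<k. X i \<omega>) + (\<Sum>i\<in>{k..<n}. X i \<omega>)"
        using k(1) sum.atLeastLessThan_concat[of 0 k n "\<lambda>i. X i \<omega>"] by (simp add: lessThan_atLeast0)
      then have "norm (\<Sum>i<n. X i \<omega>) \<ge> norm (\<Sum>i<k. X i \<omega>) - norm (\<Sum>i\<in>{k..<n}. X i \<omega>)"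
        using norm_diff_ineq by metis
      then show "\<omega> \<in> {\<omega>\<in>space M. norm (\<Sum>i<n. X i \<omega>) > t}" using k by (auto simp: E_def G_def)
    qed
  qed measurable
  finally show ?thesis .
qed

text \<open>A summand is the difference of two consecutive partial sums, so if these stay within
  \<open>2 * t\<close>, all summands stay within \<open>4 * t\<close>. Ottaviani's inequality gives
  this probability at least 2/3, whereas by independence the summands stay within
  \<open>4 * t\<close> with probability exactly \<open>(1 - p) ^ n\<close>; hence \<open>p\<close>
  is of order 1/n.\<close>

lemma prob_norm_gt_le:
  assumes t: "\<And>m. m \<le> n \<Longrightarrow> prob {\<omega>\<in>space M. norm (\<Sum>i<m. X i \<omega>) > t} \<le> 1 / 4" and "n \<ge> 1"
  shows "prob {\<omega>\<in>space M. norm (X 0 \<omega>) > 4 * t} \<le> 1 / (2 * real n)"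
proof -
  define p where "p = prob {\<omega>\<in>space M. norm (X 0 \<omega>) > 4 * t}"
  have compl: "prob {\<omega>\<in>space M. norm (f \<omega>) \<le> s} = 1 - prob {\<omega>\<in>space M. norm (f \<omega>) > s}"
    if [measurable]: "f \<in> borel_measurable M" for f :: "'w \<Rightarrow> 'a" and s
    using prob_compl[of "{\<omega>\<in>space M. norm (f \<omega>) > s}"]
    by (simp add: set_diff_eq not_less cong: conj_cong)
  have "3 / 4 * prob {\<omega>\<in>space M. \<exists>k\<le>n. norm (\<Sum>i<k. X i \<omega>) > 2 * t}
      \<le> prob {\<omega>\<in>space M. norm (\<Sum>i<n. X i \<omega>) > t}"
    by (rule ottaviani) (use t in \<open>simp add: compl\<close>)
  also have "\<dots> \<le> 1 / 4" by (rule t) simp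
  finally have 1: "prob {\<omega>\<in>space M. \<exists>k\<le>n. norm (\<Sum>i<k. X i \<omega>) > 2 * t} \<le> 1 / 3" by simp
  have Xi: "prob {\<omega>\<in>space M. norm (X i \<omega>) \<le> 4 * t} = 1 - p" for i
    using prob_sum_cong[of "{i}" "{0}" "cball 0 (4*t)"] compl[of "X 0" "4 * t"] by (simp add: p_def)
  have "0 \<in> {..<n}" using \<open>n \<ge> 1\<close> by simp
  then have ne: "{..<n} \<noteq> {}" by blast
  have "(1 - p) ^ n = prob (\<Inter>i\<in>{..<n}. X i -` cball 0 (4 * t) \<inter> space M)"
    using ne Xi by (subst indep_varsD[OF indep]) (auto simp: vimage_def Int_def conj_commute)
  also have "(\<Inter>i\<in>{..<n}. X i -` cball 0 (4 * t) \<inter> space M) = {\<omega>\<in>space M. \<forall>i\<in>{..<n}. norm (X i \<omega>) \<le> 4 * t}"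
    using ne by auto
  finally have 2: "(1 - p) ^ n = prob {\<omega>\<in>space M. \<forall>i\<in>{..<n}. norm (X i \<omega>) \<le> 4 * t}" .
  have "1 \<le> prob {\<omega>\<in>space M. \<exists>k\<le>n. norm (\<Sum>i<k. X i \<omega>) > 2 * t} +
      prob {\<omega>\<in>space M. \<forall>i\<in>{..<n}. norm (X i \<omega>) \<le> 4 * t}"
  proof -
    have "space M \<subseteq> {\<omega>\<in>space M. \<exists>k\<le>n. norm (\<Sum>i<k. X i \<omega>) > 2 * t} \<union>
      {\<omega>\<in>space M. \<forall>i\<in>{..<n}. norm (X i \<omega>) \<le> 4 * t}"
    proof
      fix \<omega> assume \<omega>: "\<omega> \<in> space M"
      have "norm (X i \<omega>) \<le> 4 * t" if "\<forall>k\<le>n. norm (\<Sum>i<k. X i \<omega>) \<le> 2 * t" "i < n" for i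
      proof -
        have "X i \<omega> = (\<Sum>i<Suc i. X i \<omega>) - (\<Sum>i<i. X i \<omega>)" by simp
        then have "norm (X i \<omega>) \<le> norm (\<Sum>i<Suc i. X i \<omega>) + norm (\<Sum>i<i. X i \<omega>)"
          using norm_triangle_ineq4 by metis
        moreover have "norm (\<Sum>i<Suc i. X i \<omega>) \<le> 2 * t" "norm (\<Sum>i<i. X i \<omega>) \<le> 2 * t"
          using that by (auto simp del: sum.lessThan_Suc)
        ultimately show ?thesis by linarith
      qed
      then show "\<omega> \<in> {\<omega>\<in>space M. \<exists>k\<le>n. norm (\<Sum>i<k. X i \<omega>) > 2 * t} \<union>
        {\<omega>\<in>space M. \<forall>i\<in>{..<n}. norm (X i \<omega>) \<le> 4 * t}" using \<omega> by (force simp: not_less)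
    qed
    moreover have [measurable]: "{\<omega>\<in>space M. \<exists>k\<le>n. norm (\<Sum>i<k. X i \<omega>) > 2 * t} \<in> events"
      by measurable
    ultimately have "prob (space M) \<le> prob ({\<omega>\<in>space M. \<exists>k\<le>n. norm (\<Sum>i<k. X i \<omega>) > 2 * t} \<union>
      {\<omega>\<in>space M. \<forall>i\<in>{..<n}. norm (X i \<omega>) \<le> 4 * t})"
      by (intro finite_measure_mono sets.Un) measurable
    also have "\<dots> \<le> prob {\<omega>\<in>space M. \<exists>k\<le>n. norm (\<Sum>i<k. X i \<omega>) > 2 * t} +
      prob {\<omega>\<in>space M. \<forall>i\<in>{..<n}. norm (X i \<omega>) \<le> 4 * t}"
      by (rule measure_Un_le) measurable
    finally show ?thesis by (simp add: prob_space)
  qed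
  \<comment> \<open>With \<open>1 - p\<close> at most \<open>exp (- p)\<close> this becomes
    \<open>exp (n * p)\<close> at most 3/2, and the tangent line of exp at 0 gives
    \<open>n * p\<close> at most 1/2.\<close>
  then have "2 / 3 \<le> (1 - p) ^ n" using 1 2 by simp
  also have "\<dots> \<le> exp (- p) ^ n"
    using exp_ge_add_one_self[of "- p"] prob_le_1 by (intro power_mono) (auto simp: p_def)
  also have "\<dots> = exp (- (real n * p))" by (simp flip: exp_of_nat_mult)
  finally have "2 / 3 \<le> exp (- (real n * p))" .
  then have "exp (real n * p) \<le> 3 / 2" by (simp add: exp_minus field_simps)
  moreover have "1 + real n * p \<le> exp (real n * p)" by (rule exp_ge_add_one_self)
  ultimately have "real n * p \<le> 1 / 2" by linarith
  then show ?thesis using \<open>n \<ge> 1\<close> by (simp add: p_def field_simps)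
qed

text \<open>For \<open>n = 16 ^ k\<close> one has \<open>sqrt n = 4 ^ k\<close>, so the bound of
  order 1/n at level \<open>4 * K * sqrt n\<close> is, after rescaling by \<open>4 * K\<close>, the
  quadratic tail that \<open>integrable_sqrt_cube\<close> asks for.\<close>

lemma integrable_norm_sqrt:
  assumes "K > 0"
    and K: "\<And>n. prob {\<omega>\<in>space M. norm (\<Sum>i<n. X i \<omega>) > K * sqrt (real n)} \<le> 1 / 4"
  shows "integrable \<mu> (\<lambda>x. norm x * sqrt (norm x))"
proof -
  define R where "R \<omega> = norm (X 0 \<omega>) / (4 * K)" for \<omega>
  have "integrable M (\<lambda>\<omega>. R \<omega> * sqrt (R \<omega>))"
  proof (rule integrable_sqrt_cube)
    fix k :: nat
    have "prob {\<omega>\<in>space M. norm (X 0 \<omega>) > 4 * (K * sqrt (real (16 ^ k)))} \<le> 1 / (2 * real (16 ^ k))"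
    proof (rule prob_norm_gt_le)
      fix m :: nat assume "m \<le> 16 ^ k"
      then have "K * sqrt (real m) \<le> K * sqrt (real (16 ^ k))"
        using \<open>K > 0\<close> by (intro mult_left_mono real_sqrt_le_mono) (auto simp flip: of_nat_le_iff)
      then have "prob {\<omega>\<in>space M. norm (\<Sum>i<m. X i \<omega>) > K * sqrt (real (16 ^ k))}
          \<le> prob {\<omega>\<in>space M. norm (\<Sum>i<m. X i \<omega>) > K * sqrt (real m)}"
        by (intro finite_measure_mono) auto
      then show "prob {\<omega>\<in>space M. norm (\<Sum>i<m. X i \<omega>) > K * sqrt (real (16 ^ k))} \<le> 1 / 4"
        using K[of m] by linarith
    qed simp
    also have "sqrt (real (16 ^ k)) = 4 ^ k" by (simp add: real_sqrt_power)
    also have "{\<omega>\<in>space M. norm (X 0 \<omega>) > 4 * (K * 4 ^ k)} = {\<omega>\<in>space M. R \<omega> > 4 ^ k}"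
      using \<open>K > 0\<close> by (auto simp: R_def field_simps)
    also have "1 / (2 * real (16 ^ k)) \<le> 1 / 16 ^ k" by (simp add: field_simps)
    finally show "prob {\<omega>\<in>space M. R \<omega> > 4 ^ k} \<le> 1 / 16 ^ k" .
  qed (use \<open>K > 0\<close> in \<open>auto simp: R_def\<close>)
  then have "integrable M (\<lambda>\<omega>. ((4 * K) * sqrt (4 * K)) * (R \<omega> * sqrt (R \<omega>)))"
    by (rule integrable_mult_right)
  also have "(\<lambda>\<omega>. ((4 * K) * sqrt (4 * K)) * (R \<omega> * sqrt (R \<omega>))) = (\<lambda>\<omega>. norm (X 0 \<omega>) * sqrt (norm (X 0 \<omega>)))"
    using \<open>K > 0\<close> by (auto simp: R_def real_sqrt_divide)
  finally show ?thesis unfolding law[of 0, symmetric] by (subst integrable_distr_eq) auto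
qed

end

text \<open>Young's inequality for the dual exponents 3/2 and 3, without constants: either
  \<open>h x\<close> is at most \<open>sqrt (norm x)\<close>, or \<open>norm x\<close> is at most
  the square of \<open>h x\<close>.\<close>

lemma integrable_norm_mult_of_cube:
  fixes \<mu> :: "'a::{banach, second_countable_topology} measure" and h :: "'a \<Rightarrow> real"
  assumes [measurable_cong]: "sets \<mu> = sets borel"
    and 1: "integrable \<mu> (\<lambda>x. norm x * sqrt (norm x))" and 2: "integrable \<mu> (\<lambda>x. (h x) ^ 3)"
    and h[measurable]: "h \<in> borel_measurable borel" and h0: "\<And>x. h x \<ge> 0"
  shows "integrable \<mu> (\<lambda>x. norm x * h x)"
proof (rule Bochner_Integration.integrable_bound[OF Bochner_Integration.integrable_add[OF 1 2]])
  have "norm x * h x \<le> norm x * sqrt (norm x) + (h x) ^ 3" for x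
  proof (cases "h x \<le> sqrt (norm x)")
    case True
    then show ?thesis using h0[of x] by (simp add: mult_left_mono add_increasing2)
  next
    case False
    then have "sqrt (norm x) ^ 2 \<le> (h x)^2" by (intro power_mono) auto
    then have "norm x \<le> (h x)^2" by simp
    then have "norm x * h x \<le> (h x)^2 * h x" using h0 by (intro mult_right_mono) auto
    then show ?thesis by (simp add: power2_eq_square power3_eq_cube add_increasing)
  qed
  then show "AE x in \<mu>. norm (norm x * h x) \<le> norm (norm x * sqrt (norm x) + (h x) ^ 3)"
    using h0 by (auto simp: abs_mult)
qed measurable

subsection \<open>The Gaussian limit\<close>

text \<open>Raise the inequality between \<open>x / k\<close> and \<open>exp (x / k)\<close> to the
  power \<open>k\<close>.\<close>

lemma power_le_exp:
  fixes x :: real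
  assumes "x \<ge> 0"
  shows "x ^ k \<le> real k ^ k * exp x"
proof (cases "k = 0")
  case False
  have "x / real k \<le> exp (x / real k)" using exp_ge_add_one_self[of "x / real k"] by linarith
  then have "(x / real k) ^ k \<le> exp (x / real k) ^ k" using assms by (intro power_mono) auto
  also have "\<dots> = exp x" using False by (simp flip: exp_of_nat_mult)
  finally show ?thesis using False by (simp add: power_divide field_simps)
qed (use assms in simp)

lemma std_normal_mgf:
  "(\<integral>\<^sup>+x. ennreal (exp (s * x)) \<partial>std_normal_distribution) = ennreal (exp (s\<^sup>2 / 2))"
proof -
  have "(\<integral>\<^sup>+x. ennreal (exp (s * x)) \<partial>std_normal_distribution)
    = (\<integral>\<^sup>+x. ennreal (std_normal_density x) * ennreal (exp (s * x)) \<partial>lborel)"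
    by (subst nn_integral_density) auto
  also have "\<dots> = (\<integral>\<^sup>+x. ennreal (exp (s\<^sup>2 / 2)) * ennreal (normal_density s 1 x) \<partial>lborel)"
  proof (intro nn_integral_cong)
    fix x :: real
    have "- x\<^sup>2 / 2 + s * x = s\<^sup>2 / 2 + - (x - s)\<^sup>2 / 2" by (simp add: power2_eq_square field_simps)
    then have "exp (- x\<^sup>2 / 2) * exp (s * x) = exp (s\<^sup>2 / 2) * exp (- (x - s)\<^sup>2 / 2)"
      by (metis exp_add)
    then have "std_normal_density x * exp (s * x) = exp (s\<^sup>2 / 2) * normal_density s 1 x"
      by (simp add: normal_density_def field_simps)
    then show "ennreal (std_normal_density x) * ennreal (exp (s * x))
      = ennreal (exp (s\<^sup>2 / 2)) * ennreal (normal_density s 1 x)"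
      by (simp flip: ennreal_mult)
  qed
  also have "\<dots> = ennreal (exp (s\<^sup>2 / 2))"
    by (subst nn_integral_cmult) (auto simp: nn_integral_eq_integral)
  finally show ?thesis .
qed

lemma (in prob_space) norm_tail_small:
  fixes Y :: "'a \<Rightarrow> 'b::{real_normed_vector, second_countable_topology}"
  assumes [measurable]: "random_variable borel Y" and "e > 0"
  shows "\<exists>k::nat. prob {\<omega>\<in>space M. norm (Y \<omega>) > real k} < e"
proof -
  have "(\<lambda>k::nat. prob {\<omega>\<in>space M. norm (Y \<omega>) > real k}) \<longlonglongrightarrow> prob (\<Inter>k. {\<omega>\<in>space M. norm (Y \<omega>) > real k})"
    by (rule finite_Lim_measure_decseq) (auto simp: decseq_def)
  also have "(\<Inter>k. {\<omega>\<in>space M. norm (Y \<omega>) > real k}) = {}"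
  proof (rule equals0I)
    fix \<omega> assume \<omega>: "\<omega> \<in> (\<Inter>k. {\<omega>\<in>space M. norm (Y \<omega>) > real k})"
    obtain k :: nat where "norm (Y \<omega>) < real k" using reals_Archimedean2 by blast
    moreover have "real k < norm (Y \<omega>)" using \<omega> by blast
    ultimately show False by simp
  qed
  finally have "eventually (\<lambda>k. prob {\<omega>\<in>space M. norm (Y \<omega>) > real k} < e) sequentially"
    using order_tendstoD(2)[of _ 0 _ e] \<open>e > 0\<close> by simp
  then show ?thesis by (rule eventually_happens'[OF sequentially_bot])
qed

lemma (in prob_space) second_moment_sum:
  fixes Y :: "nat \<Rightarrow> 'a \<Rightarrow> real"
  assumes indep: "indep_vars (\<lambda>_. borel) Y UNIV"
    and int: "\<And>i. integrable M (Y i)" "\<And>i. integrable M (\<lambda>\<omega>. (Y i \<omega>)\<^sup>2)"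
    and mean: "\<And>i. expectation (Y i) = 0" and var: "\<And>i. expectation (\<lambda>\<omega>. (Y i \<omega>)\<^sup>2) = v"
  shows "integrable M (\<lambda>\<omega>. (\<Sum>i<n. Y i \<omega>)\<^sup>2) \<and> expectation (\<lambda>\<omega>. (\<Sum>i<n. Y i \<omega>)\<^sup>2) = real n * v"
proof (induction n)
  case (Suc n)
  let ?S = "\<lambda>\<omega>. \<Sum>i<n. Y i \<omega>"
  have ind: "indep_var borel (Y n) borel ?S"
    by (intro indep_vars_sum indep_vars_subset[OF indep]) auto
  have S: "integrable M ?S" "expectation ?S = 0" using int mean by auto
  note I = indep_var_integrable[OF ind int(1) S(1)] and E = indep_var_lebesgue_integral[OF ind int(1) S(1)]
  have eq: "(\<lambda>\<omega>. (\<Sum>i<Suc n. Y i \<omega>)\<^sup>2) = (\<lambda>\<omega>. (?S \<omega>)\<^sup>2 + (Y n \<omega>)\<^sup>2 + 2 * (Y n \<omega> * ?S \<omega>))"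
    by (auto simp: power2_sum algebra_simps)
  show ?case unfolding eq using Suc int I E mean var S by (auto simp: algebra_simps)
qed simp

text \<open>A single positive exponent for each functional is enough to ask for, since smaller
  exponents follow by domination. The sums start at index 0 here; their laws agree with those of the
  sums in the theorem.\<close>

locale clt_seq = iid_seq M X \<mu> for M :: "'w measure" and X :: "nat \<Rightarrow> 'w \<Rightarrow> 'a::{banach, second_countable_topology}" and \<mu> +
  fixes \<gamma> :: "'a measure"
  assumes \<gamma>_sets[measurable_cong, simp]: "sets \<gamma> = sets borel" and \<gamma>_prob: "prob_space \<gamma>"
    and clt: "weak_conv_to (\<lambda>n. distr M borel (\<lambda>\<omega>. (1 / sqrt (real n)) *\<^sub>R (\<Sum>i<n. X i \<omega>))) \<gamma>"
    and exp_moments: "\<And>f::'a \<Rightarrow>\<^sub>L real. \<exists>t>0. integrable \<mu> (\<lambda>x. exp (t * \<bar>f x\<bar>))"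
begin

interpretation \<gamma>: prob_space \<gamma> by (rule \<gamma>_prob)

lemma blinfun_measurable[measurable]: "blinfun_apply f \<in> borel_measurable borel"
  for f :: "'a \<Rightarrow>\<^sub>L real"
  by (intro borel_measurable_continuous_onI continuous_intros)

lemma space_\<gamma>[simp]: "space \<gamma> = UNIV"
  using sets_eq_imp_space_eq[OF \<gamma>_sets] by simp

lemma clt_integral:
  fixes h :: "'a \<Rightarrow> real"
  assumes "continuous_on UNIV h" "bounded (range h)"
  shows "(\<lambda>n. expectation (\<lambda>\<omega>. h ((1 / sqrt (real n)) *\<^sub>R (\<Sum>i<n. X i \<omega>)))) \<longlonglongrightarrow> (\<integral>x. h x \<partial>\<gamma>)"
proof -
  have [measurable]: "h \<in> borel_measurable borel"
    using assms by (intro borel_measurable_continuous_onI)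
  have "expectation (\<lambda>\<omega>. h ((1 / sqrt (real n)) *\<^sub>R (\<Sum>i<n. X i \<omega>)))
    = (\<integral>x. h x \<partial>distr M borel (\<lambda>\<omega>. (1 / sqrt (real n)) *\<^sub>R (\<Sum>i<n. X i \<omega>)))" for n
    by (subst integral_distr) auto
  then show ?thesis using clt assms by (simp add: weak_conv_to_def)
qed

text \<open>The continuous cutoff \<open>h\<close> lies between the indicators of norm greater than
  \<open>k0 + 1\<close> and of norm greater than \<open>k0\<close>, so a tail bound for
  \<open>\<gamma>\<close> carries over to all large \<open>n\<close>. The finitely many remaining
  \<open>n\<close> are absorbed into \<open>K\<close>, one summand for each.\<close>

lemma tight: "\<exists>K>0. \<forall>n. prob {\<omega>\<in>space M. norm (\<Sum>i<n. X i \<omega>) > K * sqrt (real n)} \<le> 1 / 4"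
proof -
  obtain k0 :: nat where k0: "\<gamma>.prob {x\<in>space \<gamma>. norm x > real k0} < 1 / 4"
    using \<gamma>.norm_tail_small[of "\<lambda>x. x" "1/4"] by auto
  define h :: "'a \<Rightarrow> real" where "h x = min 1 (max 0 (norm x - real k0))" for x
  have h01: "0 \<le> h x" "h x \<le> 1" for x by (auto simp: h_def)
  have [measurable]: "h \<in> borel_measurable borel" unfolding h_def by measurable
  have "continuous_on UNIV h" unfolding h_def by (intro continuous_intros)
  moreover have "bounded (range h)"
    unfolding bounded_iff using h01 by (intro exI[of _ 1]) auto
  ultimately have lim: "(\<lambda>n. expectation (\<lambda>\<omega>. h ((1 / sqrt (real n)) *\<^sub>R (\<Sum>i<n. X i \<omega>)))) \<longlonglongrightarrow> (\<integral>x. h x \<partial>\<gamma>)"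
    by (rule clt_integral)
  have "(\<integral>x. h x \<partial>\<gamma>) \<le> (\<integral>x. indicator {x\<in>space \<gamma>. norm x > real k0} x \<partial>\<gamma>)"
    by (intro integral_mono \<gamma>.integrable_const_bound[where B=1])
      (auto simp: h_def split: split_indicator)
  also have "\<dots> < 1 / 4" using k0 by simp
  finally have "eventually (\<lambda>n. expectation (\<lambda>\<omega>. h ((1 / sqrt (real n)) *\<^sub>R (\<Sum>i<n. X i \<omega>))) < 1 / 4) sequentially"
    using order_tendstoD(2)[OF lim] by blast
  then obtain n0 where n0: "\<And>n. n \<ge> n0 \<Longrightarrow> expectation (\<lambda>\<omega>. h ((1 / sqrt (real n)) *\<^sub>R (\<Sum>i<n. X i \<omega>))) < 1 / 4"
    by (auto simp: eventually_sequentially)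
  have "\<exists>k::nat. prob {\<omega>\<in>space M. norm (\<Sum>i<n. X i \<omega>) > real k} < 1 / 4" for n
    by (rule norm_tail_small) auto
  then obtain k :: "nat \<Rightarrow> nat" where k: "\<And>n. prob {\<omega>\<in>space M. norm (\<Sum>i<n. X i \<omega>) > real (k n)} < 1 / 4"
    by metis
  define K where "K = real k0 + 1 + (\<Sum>n<n0. real (k n))"
  have K: "K \<ge> real k0 + 1" unfolding K_def by (simp add: sum_nonneg)
  have "prob {\<omega>\<in>space M. norm (\<Sum>i<n. X i \<omega>) > K * sqrt (real n)} \<le> 1 / 4" for n
  proof -
    consider "n = 0" | "n \<ge> 1" "n < n0" | "n \<ge> 1" "n \<ge> n0" by linarith
    then show ?thesis
    proof cases
      case 2
      have "real (k n) \<le> (\<Sum>n<n0. real (k n))" using 2 by (intro member_le_sum) auto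
      then have "real (k n) \<le> K * 1" by (simp add: K_def)
      also have "\<dots> \<le> K * sqrt (real n)" using 2 K by (intro mult_left_mono) auto
      finally have "prob {\<omega>\<in>space M. norm (\<Sum>i<n. X i \<omega>) > K * sqrt (real n)}
          \<le> prob {\<omega>\<in>space M. norm (\<Sum>i<n. X i \<omega>) > real (k n)}"
        by (intro finite_measure_mono) auto
      then show ?thesis using k[of n] by linarith
    next
      case 3
      have "prob {\<omega>\<in>space M. norm (\<Sum>i<n. X i \<omega>) > K * sqrt (real n)}
        = expectation (indicator {\<omega>\<in>space M. norm (\<Sum>i<n. X i \<omega>) > K * sqrt (real n)})" by simp
      also have "\<dots> \<le> expectation (\<lambda>\<omega>. h ((1 / sqrt (real n)) *\<^sub>R (\<Sum>i<n. X i \<omega>)))"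
      proof (intro integral_mono integrable_const_bound[where B=1])
        fix \<omega> assume "\<omega> \<in> space M"
        show "indicator {\<omega>\<in>space M. norm (\<Sum>i<n. X i \<omega>) > K * sqrt (real n)} \<omega> \<le> h ((1 / sqrt (real n)) *\<^sub>R (\<Sum>i<n. X i \<omega>))"
        proof (cases "norm (\<Sum>i<n. X i \<omega>) > K * sqrt (real n)")
          case True
          then have "K < norm ((1 / sqrt (real n)) *\<^sub>R (\<Sum>i<n. X i \<omega>))"
            using 3 by (simp add: field_simps)
          then have "h ((1 / sqrt (real n)) *\<^sub>R (\<Sum>i<n. X i \<omega>)) = 1" using K unfolding h_def by linarith
          then show ?thesis by (simp split: split_indicator)
        qed (use h01 in \<open>auto\<close>)
      qed (use h01 in auto)
      also have "\<dots> < 1 / 4" using n0 3 by blast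
      finally show ?thesis by simp
    qed simp
  qed
  then show ?thesis using K by (intro exI[of _ K]) auto
qed

text \<open>Half of an admissible exponent absorbs the power of \<open>f\<close>; the same threshold
  \<open>t\<close> therefore serves all \<open>k\<close>.\<close>

lemma integrable_power_exp:
  fixes f :: "'a \<Rightarrow>\<^sub>L real"
  shows "\<exists>t>0. \<forall>k. \<forall>s\<le>t. integrable \<mu> (\<lambda>x. \<bar>f x\<bar> ^ k * exp (s * \<bar>f x\<bar>))"
proof -
  obtain t where t: "t > 0" "integrable \<mu> (\<lambda>x. exp (t * \<bar>f x\<bar>))" using exp_moments[of f] by blast
  have "integrable \<mu> (\<lambda>x. \<bar>f x\<bar> ^ k * exp (s * \<bar>f x\<bar>))" if "s \<le> t / 2" for k s
  proof (rule Bochner_Integration.integrable_bound)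
    show "integrable \<mu> (\<lambda>x. ((2 / t) ^ k * real k ^ k) * exp (t * \<bar>f x\<bar>))"
      using t(2) by (rule integrable_mult_right)
    have "\<bar>y\<bar> ^ k * exp (s * \<bar>y\<bar>) \<le> ((2 / t) ^ k * real k ^ k) * exp (t * \<bar>y\<bar>)" for y :: real
    proof -
      have "\<bar>y\<bar> ^ k = (2 / t) ^ k * (t / 2 * \<bar>y\<bar>) ^ k"
        using t(1) by (simp add: power_mult_distrib power_divide)
      also have "\<dots> \<le> (2 / t) ^ k * (real k ^ k * exp (t / 2 * \<bar>y\<bar>))"
        using t(1) by (intro mult_left_mono power_le_exp) auto
      finally have "\<bar>y\<bar> ^ k * exp (s * \<bar>y\<bar>) \<le> (2 / t) ^ k * (real k ^ k * exp (t / 2 * \<bar>y\<bar>)) * exp (t / 2 * \<bar>y\<bar>)"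
        using t(1) mult_right_mono[OF that, of "\<bar>y\<bar>"] by (intro mult_mono) auto
      also have "\<dots> = ((2 / t) ^ k * real k ^ k) * (exp (t / 2 * \<bar>y\<bar>) * exp (t / 2 * \<bar>y\<bar>))" by simp
      also have "exp (t / 2 * \<bar>y\<bar>) * exp (t / 2 * \<bar>y\<bar>) = exp (t * \<bar>y\<bar>)" by (simp flip: exp_add)
      finally show ?thesis .
    qed
    then show "AE x in \<mu>. norm (\<bar>f x\<bar> ^ k * exp (s * \<bar>f x\<bar>)) \<le> norm (((2 / t) ^ k * real k ^ k) * exp (t * \<bar>f x\<bar>))"
      using t(1) by (auto simp: abs_mult)
  qed measurable
  then show ?thesis using t(1) by (intro exI[of _ "t / 2"]) simp
qed

lemma integrable_power: "integrable \<mu> (\<lambda>x. (blinfun_apply f x) ^ k)" for f :: "'a \<Rightarrow>\<^sub>L real"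
proof -
  obtain t where "t > 0" and t: "\<forall>k. \<forall>s\<le>t. integrable \<mu> (\<lambda>x. \<bar>f x\<bar> ^ k * exp (s * \<bar>f x\<bar>))"
    using integrable_power_exp[of f] by blast
  then have "integrable \<mu> (\<lambda>x. \<bar>f x\<bar> ^ k * exp (0 * \<bar>f x\<bar>))" using less_imp_le by blast
  then show ?thesis
    by (rule Bochner_Integration.integrable_bound) (auto simp: power_abs)
qed

lemma integrable_functional: "integrable \<mu> (blinfun_apply f)" for f :: "'a \<Rightarrow>\<^sub>L real"
  using integrable_power[of f 1] by simp

lemma integrable_functional_mult: "integrable \<mu> (\<lambda>x. blinfun_apply f x * blinfun_apply h x)" for f h :: "'a \<Rightarrow>\<^sub>L real"
proof (rule Bochner_Integration.integrable_bound[OF Bochner_Integration.integrable_add[OF integrable_power[of f 2] integrable_power[of h 2]]])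
  have "\<bar>a * b\<bar> \<le> a\<^sup>2 + b\<^sup>2" for a b :: real
  proof -
    have "2 * (\<bar>a\<bar> * \<bar>b\<bar>) \<le> \<bar>a\<bar>\<^sup>2 + \<bar>b\<bar>\<^sup>2" using sum_squares_bound[of "\<bar>a\<bar>" "\<bar>b\<bar>"] by simp
    moreover have "0 \<le> \<bar>a\<bar> * \<bar>b\<bar>" by simp
    ultimately show ?thesis unfolding abs_mult power2_abs by linarith
  qed
  then show "AE x in \<mu>. norm (f x * h x) \<le> norm ((f x)\<^sup>2 + (h x)\<^sup>2)" by auto
qed measurable

text \<open>By \<open>mean_functional_zero\<close> this is the variance of \<open>f\<close> under
  \<open>\<mu>\<close>, and by \<open>distr_functional\<close> it is also the variance of
  \<open>f\<close> under the limit \<open>\<gamma>\<close>.\<close>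

definition var :: "('a \<Rightarrow>\<^sub>L real) \<Rightarrow> real" where "var f = (\<integral>x. (blinfun_apply f x)\<^sup>2 \<partial>\<mu>)"

lemma var_nonneg: "var f \<ge> 0" unfolding var_def by (intro integral_nonneg_AE) auto

lemma integral_law: "integral\<^sup>L \<mu> h = expectation (\<lambda>\<omega>. h (X i \<omega>))" if "h \<in> borel_measurable borel"
  for h :: "'a \<Rightarrow> 'b::{banach, second_countable_topology}"
  using that unfolding law[of i, symmetric] by (subst integral_distr) auto

lemma integrable_law: "integrable \<mu> h \<longleftrightarrow> integrable M (\<lambda>\<omega>. h (X i \<omega>))" if "h \<in> borel_measurable borel"
  for h :: "'a \<Rightarrow> 'b::{banach, second_countable_topology}"
  using that unfolding law[of i, symmetric] by (subst integrable_distr_eq) auto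

lemma indep_functional: "indep_vars (\<lambda>_. borel) (\<lambda>i \<omega>. blinfun_apply f (X i \<omega>) - c) UNIV"
  for f :: "'a \<Rightarrow>\<^sub>L real"
  by (rule indep_vars_compose2[OF indep]) measurable

text \<open>By Chebyshev, \<open>f\<close> of the \<open>n\<close>-th sum is within order
  \<open>sqrt n\<close> of \<open>n * m\<close>; by tightness it is within order
  \<open>sqrt n\<close> of 0. Both happen at a common sample point, so
  \<open>n * \<bar>m\<bar>\<close> is of order \<open>sqrt n\<close> for every \<open>n\<close>,
  which forces \<open>m = 0\<close>.\<close>

lemma mean_functional_zero: "(\<integral>x. blinfun_apply f x \<partial>\<mu>) = 0" for f :: "'a \<Rightarrow>\<^sub>L real"
proof -
  define m where "m = (\<integral>x. blinfun_apply f x \<partial>\<mu>)"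
  obtain K where K: "K > 0" "\<And>n. prob {\<omega>\<in>space M. norm (\<Sum>i<n. X i \<omega>) > K * sqrt (real n)} \<le> 1 / 4"
    using tight by blast
  define Y where "Y i \<omega> = f (X i \<omega>) - m" for i \<omega>
  define v where "v = (\<integral>x. (f x - m)\<^sup>2 \<partial>\<mu>)"
  have [measurable]: "Y i \<in> borel_measurable M" for i unfolding Y_def by measurable
  have int2: "integrable \<mu> (\<lambda>x. (f x - m)\<^sup>2)"
    unfolding power2_diff using integrable_power[of f 2] integrable_functional[of f]
    by (intro Bochner_Integration.integrable_add Bochner_Integration.integrable_diff) auto
  have mom: "integrable M (\<lambda>\<omega>. (\<Sum>i<n. Y i \<omega>)\<^sup>2) \<and> expectation (\<lambda>\<omega>. (\<Sum>i<n. Y i \<omega>)\<^sup>2) = real n * v" for n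
  proof (rule second_moment_sum)
    show "indep_vars (\<lambda>_. borel) Y UNIV" unfolding Y_def by (rule indep_functional)
    show "integrable M (Y i)" for i
      unfolding Y_def using integrable_functional[of f] integrable_law[of "blinfun_apply f" i] by simp
    show "integrable M (\<lambda>\<omega>. (Y i \<omega>)\<^sup>2)" "expectation (\<lambda>\<omega>. (Y i \<omega>)\<^sup>2) = v" for i
      unfolding Y_def v_def using int2 integrable_law[of "\<lambda>x. (f x - m)\<^sup>2" i] integral_law[of "\<lambda>x. (f x - m)\<^sup>2" i]
      by auto
    show "expectation (Y i) = 0" for i
      unfolding Y_def using integrable_functional[of f] integrable_law[of "blinfun_apply f" i]
        integral_law[of "blinfun_apply f" i] by (simp add: m_def prob_space)
  qed
  have v0: "v \<ge> 0" unfolding v_def by (intro integral_nonneg_AE) auto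
  have bound: "sqrt (real n) * \<bar>m\<bar> \<le> norm f * K + 2 * sqrt (v + 1)" if "n \<ge> 1" for n
  proof -
    \<comment> \<open>The factor 2 brings Chebyshev's bound down to 1/4, which together with the 1/4
      from tightness stays below 1; \<open>v + 1\<close> in place of \<open>v\<close> keeps
      \<open>a\<close> positive.\<close>
    define a where "a = 2 * sqrt (real n * (v + 1))"
    have a: "a > 0" using that v0 by (simp add: a_def)
    have "prob {\<omega>\<in>space M. \<bar>\<Sum>i<n. Y i \<omega>\<bar> \<ge> a} \<le> prob {\<omega>\<in>space M. (\<Sum>i<n. Y i \<omega>)\<^sup>2 \<ge> a\<^sup>2}"
      using a by (intro finite_measure_mono) (auto intro: power2_le_iff_abs_le[THEN iffD2] simp: abs_le_square_iff[symmetric])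
    also have "\<dots> \<le> (real n * v) / a\<^sup>2"
      using integral_Markov_inequality_measure[of M "\<lambda>\<omega>. (\<Sum>i<n. Y i \<omega>)\<^sup>2" "{}" "a\<^sup>2"] mom[of n] a by simp
    also have "\<dots> \<le> 1 / 4"
    proof -
      have "a\<^sup>2 = 4 * (real n * (v + 1))" using v0 by (simp add: a_def power_mult_distrib)
      then have "real n * v \<le> 1 / 4 * a\<^sup>2" by (simp add: algebra_simps)
      then show ?thesis using a by (simp add: pos_divide_le_eq)
    qed
    finally have 1: "prob {\<omega>\<in>space M. \<bar>\<Sum>i<n. Y i \<omega>\<bar> \<ge> a} \<le> 1 / 4" .
    have "prob ({\<omega>\<in>space M. \<bar>\<Sum>i<n. Y i \<omega>\<bar> \<ge> a} \<union> {\<omega>\<in>space M. norm (\<Sum>i<n. X i \<omega>) > K * sqrt (real n)})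
      \<le> prob {\<omega>\<in>space M. \<bar>\<Sum>i<n. Y i \<omega>\<bar> \<ge> a} + prob {\<omega>\<in>space M. norm (\<Sum>i<n. X i \<omega>) > K * sqrt (real n)}"
      by (rule measure_Un_le) measurable
    also have "\<dots> < 1" using 1 K(2)[of n] by linarith
    finally have "{\<omega>\<in>space M. \<bar>\<Sum>i<n. Y i \<omega>\<bar> \<ge> a} \<union> {\<omega>\<in>space M. norm (\<Sum>i<n. X i \<omega>) > K * sqrt (real n)} \<noteq> space M"
      using prob_space by auto
    then obtain \<omega> where \<omega>: "\<bar>\<Sum>i<n. Y i \<omega>\<bar> < a" "norm (\<Sum>i<n. X i \<omega>) \<le> K * sqrt (real n)"
      by (force simp: not_less not_le)
    have "(\<Sum>i<n. Y i \<omega>) = f (\<Sum>i<n. X i \<omega>) - real n * m"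
      by (simp add: Y_def sum_subtractf blinfun.sum_right)
    then have "\<bar>real n * m\<bar> \<le> \<bar>f (\<Sum>i<n. X i \<omega>)\<bar> + a"
      using \<omega>(1) by linarith
    then have "real n * \<bar>m\<bar> \<le> \<bar>f (\<Sum>i<n. X i \<omega>)\<bar> + a" by (simp add: abs_mult)
    also have "\<bar>f (\<Sum>i<n. X i \<omega>)\<bar> \<le> norm f * (K * sqrt (real n))"
      using norm_blinfun[of f "\<Sum>i<n. X i \<omega>"] mult_left_mono[OF \<omega>(2) norm_ge_zero[of f]] by simp
    also have "norm f * (K * sqrt (real n)) + a = sqrt (real n) * (norm f * K + 2 * sqrt (v + 1))"
      unfolding a_def real_sqrt_mult by (simp add: algebra_simps)
    also have "real n * \<bar>m\<bar> = sqrt (real n) * (sqrt (real n) * \<bar>m\<bar>)" by (simp flip: mult.assoc)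
    finally show ?thesis using that by simp
  qed
  have "m = 0"
  proof (rule ccontr)
    assume "m \<noteq> 0"
    obtain n :: nat where n: "((norm f * K + 2 * sqrt (v + 1)) / \<bar>m\<bar>)\<^sup>2 < real n" using reals_Archimedean2 by blast
    have "(norm f * K + 2 * sqrt (v + 1)) / \<bar>m\<bar> < sqrt (real n)"
      by (rule real_less_rsqrt) (rule n)
    moreover have "n \<ge> 1" using n by (cases n) (auto simp: not_less[symmetric])
    ultimately show False using bound[of n] \<open>m \<noteq> 0\<close> by (simp add: field_simps)
  qed
  then show ?thesis by (simp add: m_def)
qed

lemma var_zero_AE: "AE x in \<mu>. blinfun_apply f x = 0" if "var f = 0" for f :: "'a \<Rightarrow>\<^sub>L real"
  using that integral_nonneg_eq_0_iff_AE[OF integrable_power[of f 2]] by (simp add: var_def)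

text \<open>Two limits of one sequence are compared. Weak convergence, tested with the cosine and
  the sine of \<open>t * f\<close>, gives the left-hand side; the scalar central limit theorem for
  \<open>f (X i)\<close>, read at frequency \<open>t * \<sigma>\<close>, gives the right-hand side.
  Variance zero is treated apart because the scalar theorem normalises by
  \<open>\<sigma>\<close>.\<close>

lemma char_limit:
  "char (distr \<gamma> borel (blinfun_apply f)) t = complex_of_real (exp (- (t\<^sup>2 * var f) / 2))"
  for f :: "'a \<Rightarrow>\<^sub>L real"
proof -
  define Sn where "Sn n \<omega> = f ((1 / sqrt (real n)) *\<^sub>R (\<Sum>i<n. X i \<omega>))" for n \<omega>
  have [measurable]: "Sn n \<in> borel_measurable M" for n unfolding Sn_def by measurable
  have char_eq: "char (distr M' borel Y) t = Complex (\<integral>\<omega>. cos (t * Y \<omega>) \<partial>M') (\<integral>\<omega>. sin (t * Y \<omega>) \<partial>M')"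
    if "prob_space M'" and Y[measurable]: "Y \<in> borel_measurable M'" for M' :: "'c measure" and Y and t
  proof -
    interpret P: prob_space M' by fact
    have i: "integrable M' (\<lambda>\<omega>. iexp (t * Y \<omega>))" by (intro P.integrable_const_bound[where B=1]) auto
    have "char (distr M' borel Y) t = (CLINT \<omega>|M'. iexp (t * Y \<omega>))"
      unfolding char_def by (subst integral_distr) auto
    moreover have "Re (CLINT \<omega>|M'. iexp (t * Y \<omega>)) = (\<integral>\<omega>. cos (t * Y \<omega>) \<partial>M')"
      by (subst integral_Re[OF i, symmetric]) (simp add: Re_exp)
    moreover have "Im (CLINT \<omega>|M'. iexp (t * Y \<omega>)) = (\<integral>\<omega>. sin (t * Y \<omega>) \<partial>M')"
      by (subst integral_Im[OF i, symmetric]) (simp add: Im_exp)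
    ultimately show ?thesis by (simp add: complex_eq_iff)
  qed
  have 1: "(\<lambda>n. char (distr M borel (Sn n)) t) \<longlonglongrightarrow> char (distr \<gamma> borel (blinfun_apply f)) t"
  proof -
    have "(\<lambda>n. expectation (\<lambda>\<omega>. cos (t * Sn n \<omega>))) \<longlonglongrightarrow> (\<integral>x. cos (t * f x) \<partial>\<gamma>)"
      unfolding Sn_def by (rule clt_integral) (auto intro!: continuous_intros boundedI[of _ 1])
    moreover have "(\<lambda>n. expectation (\<lambda>\<omega>. sin (t * Sn n \<omega>))) \<longlonglongrightarrow> (\<integral>x. sin (t * f x) \<partial>\<gamma>)"
      unfolding Sn_def by (rule clt_integral) (auto intro!: continuous_intros boundedI[of _ 1])
    ultimately show ?thesis
      by (subst char_eq[OF \<gamma>_prob], simp, subst char_eq[OF prob_space_axioms], simp) (rule tendsto_Complex)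
  qed
  have Sn_sum: "Sn n \<omega> = (\<Sum>i<n. f (X i \<omega>)) / sqrt (real n)" for n \<omega>
    by (simp add: Sn_def blinfun.scaleR_right blinfun.sum_right)
  have 2: "(\<lambda>n. char (distr M borel (Sn n)) t) \<longlonglongrightarrow> complex_of_real (exp (- (t\<^sup>2 * var f) / 2))"
  proof (cases "var f = 0")
    case True
    have "AE \<omega> in M. f (X i \<omega>) = 0" for i
      using var_zero_AE[OF True] unfolding law[of i, symmetric] by (subst (asm) AE_distr_iff) auto
    then have "AE \<omega> in M. \<forall>i. f (X i \<omega>) = 0" by (simp add: AE_all_countable)
    then have ae: "AE \<omega> in M. Sn n \<omega> = 0" for n by eventually_elim (simp add: Sn_sum)
    have "char (distr M borel (Sn n)) t = 1" for n
    proof -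
      have "(\<integral>\<omega>. cos (t * Sn n \<omega>) \<partial>M) = (\<integral>\<omega>. 1 \<partial>M)" "(\<integral>\<omega>. sin (t * Sn n \<omega>) \<partial>M) = (\<integral>\<omega>. 0 \<partial>M)"
        using ae[of n] by (intro integral_cong_AE; force elim!: eventually_mono)+
      then show ?thesis by (subst char_eq[OF prob_space_axioms]) (auto simp: prob_space complex_eq_iff)
    qed
    then show ?thesis using True by simp
  next
    case False
    define \<sigma> where "\<sigma> = sqrt (var f)"
    have \<sigma>: "\<sigma> > 0" "\<sigma>\<^sup>2 = var f" using False var_nonneg[of f] by (auto simp: \<sigma>_def less_le)
    have wc: "weak_conv_m (\<lambda>n. distr M borel (\<lambda>\<omega>. (\<Sum>i<n. f (X i \<omega>)) / sqrt (real n * \<sigma>\<^sup>2))) std_normal_distribution"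
    proof (rule central_limit_theorem_zero_mean)
      show "indep_vars (\<lambda>i. borel) (\<lambda>i \<omega>. f (X i \<omega>)) UNIV"
        by (rule indep_vars_compose2[OF indep]) measurable
      show E0: "expectation (\<lambda>\<omega>. f (X n \<omega>)) = 0" for n
        using mean_functional_zero[of f] integral_law[of "blinfun_apply f" n] by simp
      show "integrable M (\<lambda>\<omega>. (f (X n \<omega>))\<^sup>2)" for n
        using integrable_power[of f 2] integrable_law[of "\<lambda>x. (f x)\<^sup>2" n] by simp
      show "variance (\<lambda>\<omega>. f (X n \<omega>)) = \<sigma>\<^sup>2" for n
        using integral_law[of "\<lambda>x. (f x)\<^sup>2" n] by (simp add: E0 \<sigma> var_def)
      show "distr M borel (\<lambda>\<omega>. f (X n \<omega>)) = distr \<mu> borel f" for n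
        unfolding law[of n, symmetric] by (subst distr_distr) (auto simp: comp_def)
    qed (rule \<sigma>)
    have "(\<lambda>n. char (distr M borel (\<lambda>\<omega>. (\<Sum>i<n. f (X i \<omega>)) / sqrt (real n * \<sigma>\<^sup>2))) (t * \<sigma>))
        \<longlonglongrightarrow> char std_normal_distribution (t * \<sigma>)"
      by (rule levy_continuity1[OF _ _ wc]) (auto intro!: real_distribution_distr real_dist_normal_dist)
    also have "(\<lambda>n. char (distr M borel (\<lambda>\<omega>. (\<Sum>i<n. f (X i \<omega>)) / sqrt (real n * \<sigma>\<^sup>2))) (t * \<sigma>))
        = (\<lambda>n. char (distr M borel (Sn n)) t)"
      using \<sigma>(1) by (intro ext) (subst (1 2) char_eq[OF prob_space_axioms]; simp add: Sn_sum real_sqrt_mult field_simps)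
    also have "char std_normal_distribution (t * \<sigma>) = complex_of_real (exp (- (t\<^sup>2 * var f) / 2))"
      by (simp add: char_std_normal_distribution power_mult_distrib \<sigma>)
    finally show ?thesis .
  qed
  show ?thesis by (rule LIMSEQ_unique[OF 1 2])
qed

text \<open>Describing the law as an image of the standard normal law also covers
  \<open>var f = 0\<close>, where there is no density.\<close>

lemma distr_functional:
  "distr \<gamma> borel (blinfun_apply f) = distr std_normal_distribution borel (\<lambda>x. sqrt (var f) * x)"
  for f :: "'a \<Rightarrow>\<^sub>L real"
proof (rule Levy_uniqueness)
  interpret N: real_distribution std_normal_distribution by (rule real_dist_normal_dist)
  show "real_distribution (distr \<gamma> borel (blinfun_apply f))"
    by (rule \<gamma>.real_distribution_distr) simp
  show "real_distribution (distr std_normal_distribution borel (\<lambda>x. sqrt (var f) * x))"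
    by (rule N.real_distribution_distr) simp
  show "char (distr \<gamma> borel (blinfun_apply f)) = char (distr std_normal_distribution borel (\<lambda>x. sqrt (var f) * x))"
  proof
    fix t
    have "char (distr std_normal_distribution borel (\<lambda>x. sqrt (var f) * x)) t = char std_normal_distribution (t * sqrt (var f))"
      unfolding char_def by (subst integral_distr) (auto simp: mult.assoc)
    then show "char (distr \<gamma> borel (blinfun_apply f)) t = char (distr std_normal_distribution borel (\<lambda>x. sqrt (var f) * x)) t"
      by (simp add: char_limit char_std_normal_distribution power_mult_distrib var_nonneg)
  qed
qed

lemma laplace_gaussian: "laplace \<gamma> f = ennreal (exp (var f / 2))" for f :: "'a \<Rightarrow>\<^sub>L real"
proof -
  have "laplace \<gamma> f = (\<integral>\<^sup>+y. ennreal (exp y) \<partial>distr \<gamma> borel (blinfun_apply f))"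
    unfolding laplace_def by (subst nn_integral_distr) auto
  also have "\<dots> = (\<integral>\<^sup>+x. ennreal (exp (sqrt (var f) * x)) \<partial>std_normal_distribution)"
    unfolding distr_functional by (subst nn_integral_distr) auto
  also have "\<dots> = ennreal (exp (var f / 2))" by (simp add: std_normal_mgf var_nonneg)
  finally show ?thesis .
qed

lemma log_laplace_gaussian: "log_laplace \<gamma> f = ereal (var f / 2)" for f :: "'a \<Rightarrow>\<^sub>L real"
  by (simp add: log_laplace_def laplace_gaussian)

lemma exp_functional_gaussian:
  fixes f :: "'a \<Rightarrow>\<^sub>L real"
  shows "integrable \<gamma> (\<lambda>x. exp (f x))" "(\<integral>x. exp (f x) \<partial>\<gamma>) = exp (var f / 2)"
proof -
  have nn: "(\<integral>\<^sup>+x. ennreal (exp (f x)) \<partial>\<gamma>) = ennreal (exp (var f / 2))"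
    using laplace_gaussian[of f] by (simp add: laplace_def)
  then show "integrable \<gamma> (\<lambda>x. exp (f x))" by (intro integrableI_nonneg) auto
  show "(\<integral>x. exp (f x) \<partial>\<gamma>) = exp (var f / 2)" using nn by (subst integral_eq_nn_integral) auto
qed

lemma var_zero_AE_gaussian: "AE x in \<gamma>. blinfun_apply f x = 0" if "var f = 0" for f :: "'a \<Rightarrow>\<^sub>L real"
proof -
  have "AE y in distr \<gamma> borel (blinfun_apply f). y = 0"
    unfolding distr_functional that by (subst AE_distr_iff) auto
  then show ?thesis by (subst (asm) AE_distr_iff) auto
qed

text \<open>Needed for the positivity of the probabilities. \<open>h\<close> vanishes almost surely
  under \<open>\<gamma>\<close> and may be moved inside the Bochner integral; where the integrand is
  not integrable, the integral is 0 by convention.\<close>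

lemma functional_cov_op_zero:
  fixes f h :: "'a \<Rightarrow>\<^sub>L real"
  assumes "var h = 0"
  shows "h (cov_op \<gamma> f) = 0"
proof (cases "integrable \<gamma> (\<lambda>x. f x *\<^sub>R x)")
  case True
  have "h (cov_op \<gamma> f) = (\<integral>x. h (f x *\<^sub>R x) \<partial>\<gamma>)"
    unfolding cov_op_def by (rule integral_bounded_linear[OF blinfun.bounded_linear_right True, symmetric])
  also have "\<dots> = (\<integral>x. 0 \<partial>\<gamma>)"
    using var_zero_AE_gaussian[OF assms]
    by (intro integral_cong_AE) (auto simp: blinfun.scaleR_right elim!: eventually_mono)
  finally show ?thesis by simp
qed (simp add: cov_op_def not_integrable_integral_eq)

lemma var_add_scaled:
  fixes f h :: "'a \<Rightarrow>\<^sub>L real"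
  shows "var (f + s *\<^sub>R h) = var f + 2 * s * (\<integral>x. f x * h x \<partial>\<mu>) + s\<^sup>2 * var h"
proof -
  have "var (f + s *\<^sub>R h) = (\<integral>x. (f x)\<^sup>2 + 2 * s * (f x * h x) + s\<^sup>2 * (h x)\<^sup>2 \<partial>\<mu>)"
    unfolding var_def by (intro Bochner_Integration.integral_cong)
      (auto simp: blinfun.add_left blinfun.scaleR_left power2_eq_square algebra_simps)
  then show ?thesis
    using integrable_power[of f 2] integrable_power[of h 2] integrable_functional_mult[of f h]
    by (simp add: var_def)
qed

text \<open>The supporting line of \<open>s \<mapsto> \<integral> e\<^bsup>g + s h\<^esup> d\<gamma>\<close> at \<open>s = 0\<close> identifies the mean of the tilted Gaussian
  measure without differentiating under the integral.\<close>

lemma functional_tilted_gaussian_mean: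
  fixes g h :: "'a \<Rightarrow>\<^sub>L real"
  assumes "has_bochner_integral \<gamma> (\<lambda>x. exp (g x - var g / 2) *\<^sub>R x) a"
  shows "h a = (\<integral>x. g x * h x \<partial>\<mu>)"
proof -
  define C where "C = (\<integral>x. g x * h x \<partial>\<mu>)"
  have "has_bochner_integral \<gamma> (\<lambda>x. h (exp (g x - var g / 2) *\<^sub>R x)) (h a)"
    by (rule has_bochner_integral_bounded_linear[OF blinfun.bounded_linear_right assms])
  then have I: "integrable \<gamma> (\<lambda>x. exp (g x - var g / 2) * h x)" "(\<integral>x. exp (g x - var g / 2) * h x \<partial>\<gamma>) = h a"
    by (auto simp: has_bochner_integral_iff blinfun.scaleR_right)
  have J: "integrable \<gamma> (\<lambda>x. exp (f x - var g / 2))" "(\<integral>x. exp (f x - var g / 2) \<partial>\<gamma>) = exp (var f / 2 - var g / 2)"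
    for f :: "'a \<Rightarrow>\<^sub>L real"
    using exp_functional_gaussian[of f] by (auto simp: exp_diff)
  have ineq: "1 + s * h a \<le> exp (s * C + s\<^sup>2 * var h / 2)" for s
  proof -
    have "1 + s * h a = (\<integral>x. exp (g x - var g / 2) + s * (exp (g x - var g / 2) * h x) \<partial>\<gamma>)"
      using I J[of g] by simp
    also have "\<dots> \<le> (\<integral>x. exp ((g + s *\<^sub>R h) x - var g / 2) \<partial>\<gamma>)"
    proof (rule integral_mono)
      fix x
      have "exp (g x - var g / 2) * (1 + s * h x) \<le> exp (g x - var g / 2) * exp (s * h x)"
        by (intro mult_left_mono exp_ge_add_one_self) auto
      then show "exp (g x - var g / 2) + s * (exp (g x - var g / 2) * h x) \<le> exp ((g + s *\<^sub>R h) x - var g / 2)"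
        by (simp add: exp_add[symmetric] blinfun.add_left blinfun.scaleR_left algebra_simps)
    qed (use I J[of g] J[of "g + s *\<^sub>R h"] in auto)
    also have "\<dots> = exp (s * C + s\<^sup>2 * var h / 2)"
      unfolding J(2) var_add_scaled C_def by (simp add: field_simps)
    finally show ?thesis .
  qed
  define F where "F s = exp (s * C + s\<^sup>2 * var h / 2) - (1 + s * h a)" for s
  have "DERIV F 0 :> C - h a" unfolding F_def by (auto intro!: derivative_eq_intros)
  moreover have "\<forall>y. \<bar>0 - y\<bar> < 1 \<longrightarrow> F 0 \<le> F y" using ineq by (simp add: F_def)
  ultimately have "C - h a = 0" by (intro DERIV_local_min[of F _ 0 1]) auto
  then show ?thesis by (simp add: C_def)
qed

end

subsection \<open>Exponential tilting\<close>

lemma norm_integral_le: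
  fixes f :: "'a \<Rightarrow> 'b::{banach, second_countable_topology}"
  assumes "integrable M f" "integrable M g" "\<And>x. x \<in> space M \<Longrightarrow> norm (f x) \<le> g x"
  shows "norm (\<integral>x. f x \<partial>M) \<le> (\<integral>x. g x \<partial>M)"
proof -
  have "norm (\<integral>x. f x \<partial>M) \<le> (\<integral>x. norm (f x) \<partial>M)" by (rule integral_norm_bound)
  also have "\<dots> \<le> (\<integral>x. g x \<partial>M)" using assms by (intro integral_mono) auto
  finally show ?thesis .
qed

lemma exp_taylor_bound:
  fixes y :: real
  shows "\<bar>exp y - (\<Sum>m<n. y ^ m / fact m)\<bar> \<le> \<bar>y\<bar> ^ n * exp \<bar>y\<bar>"
proof -
  obtain s where s: "\<bar>s\<bar> \<le> \<bar>y\<bar>" "exp y = (\<Sum>m<n. y ^ m / fact m) + exp s / fact n * y ^ n"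
    using Maclaurin_exp_le[of y n] by blast
  have "\<bar>exp y - (\<Sum>m<n. y ^ m / fact m)\<bar> = exp s / fact n * \<bar>y\<bar> ^ n"
    using s(2) by (simp add: abs_mult power_abs)
  also have "\<dots> \<le> exp \<bar>y\<bar> * \<bar>y\<bar> ^ n"
  proof (intro mult_right_mono)
    have "exp s / fact n \<le> exp s / 1" by (intro divide_left_mono) (auto simp: fact_ge_1)
    also have "\<dots> \<le> exp \<bar>y\<bar>" using s(1) by simp
    finally show "exp s / fact n \<le> exp \<bar>y\<bar>" .
  qed simp
  finally show ?thesis by (simp add: mult.commute)
qed

text \<open>With \<open>L\<close> the normalising constant of a tilted law, this passes from an
  integral weighted by an exponential to the tilted mean. The loss is small relative to
  \<open>w\<close> when \<open>L\<close> is near 1.\<close>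

lemma norm_scaleR_inverse_diff_le:
  fixes m w :: "'a::real_normed_vector"
  assumes "L \<ge> 1"
  shows "norm ((1 / L) *\<^sub>R m - w) \<le> norm (m - w) + (L - 1) * norm w"
proof -
  have "(1 / L) *\<^sub>R m - w = (1 / L) *\<^sub>R ((m - w) - (L - 1) *\<^sub>R w)"
    using assms by (simp add: algebra_simps)
  then have "norm ((1 / L) *\<^sub>R m - w) = (1 / L) * norm ((m - w) - (L - 1) *\<^sub>R w)"
    using assms by simp
  also have "\<dots> \<le> 1 * norm ((m - w) - (L - 1) *\<^sub>R w)"
    using assms by (intro mult_right_mono) auto
  also have "\<dots> \<le> norm (m - w) + norm ((L - 1) *\<^sub>R w)"
    using norm_triangle_ineq4[of "m - w" "(L - 1) *\<^sub>R w"] by simp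
  finally show ?thesis using assms by simp
qed

text \<open>Product measures are determined by their values on boxes, and there the integral of a
  product of one-coordinate functions factorises.\<close>

lemma density_PiM_prod:
  fixes \<mu> :: "'a measure" and d :: "'a \<Rightarrow> ennreal"
  assumes \<mu>: "prob_space \<mu>" and \<nu>: "prob_space (density \<mu> d)" and I: "finite I"
    and d[measurable]: "d \<in> borel_measurable \<mu>"
  shows "density (PiM I (\<lambda>_. \<mu>)) (\<lambda>x. \<Prod>i\<in>I. d (x i)) = PiM I (\<lambda>_. density \<mu> d)"
proof -
  interpret \<mu>: product_prob_space "\<lambda>_. \<mu>" I
    using \<mu> by (simp add: product_prob_space_def product_sigma_finite_def product_prob_space_axioms_def prob_space_imp_sigma_finite)
  interpret \<nu>: product_prob_space "\<lambda>_. density \<mu> d" I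
    using \<nu> by (simp add: product_prob_space_def product_sigma_finite_def product_prob_space_axioms_def prob_space_imp_sigma_finite)
  have [measurable]: "(\<lambda>x. \<Prod>i\<in>I. d (x i)) \<in> borel_measurable (PiM I (\<lambda>_. \<mu>))"
    by (intro borel_measurable_prod_ennreal measurable_compose[of "\<lambda>x. x _" "PiM I (\<lambda>_. \<mu>)" \<mu>, OF _ d]
        measurable_component_singleton)
  show ?thesis
  proof (rule \<nu>.PiM_eqI[OF I])
    show "sets (density (PiM I (\<lambda>_. \<mu>)) (\<lambda>x. \<Prod>i\<in>I. d (x i))) = sets (PiM I (\<lambda>_. density \<mu> d))"
      by (simp cong: sets_PiM_cong)
    fix A assume A: "\<And>i. i \<in> I \<Longrightarrow> A i \<in> sets (density \<mu> d)"
    have [measurable]: "Pi\<^sub>E I A \<in> sets (PiM I (\<lambda>_. \<mu>))"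
      using A I by (intro sets_PiM_I_finite) auto
    have "emeasure (density (PiM I (\<lambda>_. \<mu>)) (\<lambda>x. \<Prod>i\<in>I. d (x i))) (Pi\<^sub>E I A)
      = (\<integral>\<^sup>+x. (\<Prod>i\<in>I. d (x i)) * indicator (Pi\<^sub>E I A) x \<partial>PiM I (\<lambda>_. \<mu>))"
      by (rule emeasure_density) measurable
    also have "\<dots> = (\<integral>\<^sup>+x. (\<Prod>i\<in>I. d (x i) * indicator (A i) (x i)) \<partial>PiM I (\<lambda>_. \<mu>))"
    proof (rule nn_integral_cong)
      fix x assume x: "x \<in> space (PiM I (\<lambda>_. \<mu>))"
      have "(\<Prod>i\<in>I. indicator (A i) (x i)) = (indicator (Pi\<^sub>E I A) x :: ennreal)"
        using x I by (auto simp: space_PiM PiE_iff split: split_indicator intro!: prod_zero)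
      then show "(\<Prod>i\<in>I. d (x i)) * indicator (Pi\<^sub>E I A) x = (\<Prod>i\<in>I. d (x i) * indicator (A i) (x i))"
        by (simp add: prod.distrib)
    qed
    also have "\<dots> = (\<Prod>i\<in>I. \<integral>\<^sup>+y. d y * indicator (A i) y \<partial>\<mu>)"
      using A by (intro \<mu>.product_nn_integral_prod[OF I]) auto
    also have "\<dots> = (\<Prod>i\<in>I. emeasure (density \<mu> d) (A i))"
      using A by (intro prod.cong refl emeasure_density[symmetric]) auto
    finally show "emeasure (density (PiM I (\<lambda>_. \<mu>)) (\<lambda>x. \<Prod>i\<in>I. d (x i))) (Pi\<^sub>E I A)
      = (\<Prod>i\<in>I. emeasure (density \<mu> d) (A i))" .
  qed
qed

lemma iid_with_law_rv:
  assumes "iid_with_law N \<nu> I Y" "i \<in> I"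
  shows "Y i \<in> borel_measurable N"
  using assms by (auto simp: iid_with_law_def prob_space.indep_vars_def)

lemma iid_with_law_nn_integral_sum:
  fixes \<nu> :: "'a::{banach, second_countable_topology} measure" and J :: "'i set"
  assumes iid: "iid_with_law N \<nu> I Y" and J: "J \<subseteq> I" "finite J" "J \<noteq> {}"
    and F[measurable]: "F \<in> borel_measurable borel"
  shows "(\<integral>\<^sup>+\<omega>. F (\<Sum>j\<in>J. Y j \<omega>) \<partial>N) = (\<integral>\<^sup>+x. F (\<Sum>j\<in>J. x j) \<partial>PiM J (\<lambda>_. \<nu>))"
proof -
  interpret prob_space N using iid by (simp add: iid_with_law_def)
  have rv: "random_variable borel (Y j)" if "j \<in> J" for j
    using iid_with_law_rv[OF iid] that J by blast
  have "indep_vars (\<lambda>_. borel) Y I" using iid by (simp add: iid_with_law_def)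
  then have "indep_vars (\<lambda>_. borel) Y J" by (rule indep_vars_subset) (rule J)
  then have eq: "distr N (PiM J (\<lambda>_. borel)) (\<lambda>\<omega>. \<lambda>j\<in>J. Y j \<omega>) = PiM J (\<lambda>j. distr N borel (Y j))"
    using indep_vars_iff_distr_eq_PiM'[where I=J and M'="\<lambda>_. borel" and X=Y] J rv by blast
  also have "\<dots> = PiM J (\<lambda>_. \<nu>)"
    using iid J by (intro PiM_cong) (auto simp: iid_with_law_def)
  finally have eq: "PiM J (\<lambda>_. \<nu>) = distr N (PiM J (\<lambda>_. borel)) (\<lambda>\<omega>. \<lambda>j\<in>J. Y j \<omega>)" by simp
  have m: "(\<lambda>\<omega>. \<lambda>j\<in>J. Y j \<omega>) \<in> measurable N (PiM J (\<lambda>_. borel))"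
    by (intro measurable_restrict rv)
  have "(\<lambda>x::'i \<Rightarrow> 'a. \<Sum>j\<in>J. x j) \<in> borel_measurable (PiM J (\<lambda>_. borel))"
    by (intro borel_measurable_sum measurable_component_singleton) auto
  then have "(\<lambda>x::'i \<Rightarrow> 'a. F (\<Sum>j\<in>J. x j)) \<in> borel_measurable (PiM J (\<lambda>_. borel))" by simp
  then show ?thesis unfolding eq by (subst nn_integral_distr[OF m]) (auto intro!: nn_integral_cong)
qed

text \<open>By linearity of \<open>f\<close> the product of the densities
  \<open>exp (f x) / L\<close> depends on the summands only through their sum, so it can be
  cancelled by a function of the sum. The two families live on unrelated probability spaces and are
  compared through the product of their laws; nonnegative integrals spare any integrability
  condition on \<open>F\<close>.\<close>

lemma change_of_measure_sum:
  fixes \<mu> :: "'a::{banach, second_countable_topology} measure" and f :: "'a \<Rightarrow>\<^sub>L real"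
    and J :: "'i set"
  assumes X: "iid_with_law M \<mu> I X" and Z: "iid_with_law N (tilted \<mu> f) I' Z"
    and J: "J \<subseteq> I" "J \<subseteq> I'" "finite J" "J \<noteq> {}"
    and \<mu>[measurable_cong]: "sets \<mu> = sets borel" and L: "laplace \<mu> f = ennreal L" "L > 0"
    and F[measurable]: "F \<in> borel_measurable borel"
  shows "(\<integral>\<^sup>+\<omega>. F (\<Sum>j\<in>J. X j \<omega>) \<partial>M)
    = (\<integral>\<^sup>+\<omega>. ennreal (L ^ card J * exp (- f (\<Sum>j\<in>J. Z j \<omega>))) * F (\<Sum>j\<in>J. Z j \<omega>) \<partial>N)"
proof -
  have [measurable]: "blinfun_apply f \<in> borel_measurable borel"
    by (intro borel_measurable_continuous_onI continuous_intros)
  define d where "d x = ennreal (exp (f x) / L)" for x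
  have [measurable]: "d \<in> borel_measurable borel" unfolding d_def by measurable
  have tilt: "tilted \<mu> f = density \<mu> d"
    using L by (simp add: tilted_def d_def[abs_def] divide_ennreal)
  obtain j where j: "j \<in> J" using J by blast
  have "prob_space \<mu>"
    using X J j prob_space.prob_space_distr[OF _ iid_with_law_rv[OF X, of j]]
    by (fastforce simp: iid_with_law_def)
  moreover have "prob_space (density \<mu> d)"
    using Z J j prob_space.prob_space_distr[OF _ iid_with_law_rv[OF Z, of j]]
    unfolding tilt by (fastforce simp: iid_with_law_def)
  ultimately have PiM: "PiM J (\<lambda>_. density \<mu> d) = density (PiM J (\<lambda>_. \<mu>)) (\<lambda>x. \<Prod>i\<in>J. d (x i))"
    using J by (intro density_PiM_prod[symmetric]) auto
  have [measurable]: "(\<lambda>x::'i \<Rightarrow> 'a. \<Sum>j\<in>J. x j) \<in> borel_measurable (PiM J (\<lambda>_. \<mu>))"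
    by (intro borel_measurable_sum) measurable
  have [measurable]: "(\<lambda>x. \<Prod>i\<in>J. d (x i)) \<in> borel_measurable (PiM J (\<lambda>_. \<mu>))"
    by (intro borel_measurable_prod_ennreal) measurable
  have "(\<integral>\<^sup>+\<omega>. ennreal (L ^ card J * exp (- f (\<Sum>j\<in>J. Z j \<omega>))) * F (\<Sum>j\<in>J. Z j \<omega>) \<partial>N)
    = (\<integral>\<^sup>+x. ennreal (L ^ card J * exp (- f (\<Sum>j\<in>J. x j))) * F (\<Sum>j\<in>J. x j) \<partial>PiM J (\<lambda>_. density \<mu> d))"
    using iid_with_law_nn_integral_sum[OF Z J(2-4), of "\<lambda>s. ennreal (L ^ card J * exp (- f s)) * F s"]
    by (simp add: tilt)
  also have "\<dots> = (\<integral>\<^sup>+x. (\<Prod>i\<in>J. d (x i)) * (ennreal (L ^ card J * exp (- f (\<Sum>j\<in>J. x j))) * F (\<Sum>j\<in>J. x j))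
      \<partial>PiM J (\<lambda>_. \<mu>))"
    unfolding PiM by (subst nn_integral_density) auto
  also have "\<dots> = (\<integral>\<^sup>+x. F (\<Sum>j\<in>J. x j) \<partial>PiM J (\<lambda>_. \<mu>))"
  proof (rule nn_integral_cong)
    fix x :: "'i \<Rightarrow> 'a"
    have "(\<Prod>i\<in>J. d (x i)) = ennreal (\<Prod>i\<in>J. exp (f (x i)) / L)"
      unfolding d_def using L by (intro prod_ennreal) auto
    also have "(\<Prod>i\<in>J. exp (f (x i)) / L) = exp (f (\<Sum>j\<in>J. x j)) / L ^ card J"
      using J by (simp add: prod_dividef exp_sum blinfun.sum_right)
    finally have "(\<Prod>i\<in>J. d (x i)) * ennreal (L ^ card J * exp (- f (\<Sum>j\<in>J. x j)))
        = ennreal (exp (f (\<Sum>j\<in>J. x j)) / L ^ card J * (L ^ card J * exp (- f (\<Sum>j\<in>J. x j))))"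
      using L by (simp flip: ennreal_mult)
    also have "\<dots> = 1" using L by (simp add: exp_minus)
    finally show "(\<Prod>i\<in>J. d (x i)) * (ennreal (L ^ card J * exp (- f (\<Sum>j\<in>J. x j))) * F (\<Sum>j\<in>J. x j)) = F (\<Sum>j\<in>J. x j)"
      by (simp flip: mult.assoc)
  qed
  also have "\<dots> = (\<integral>\<^sup>+\<omega>. F (\<Sum>j\<in>J. X j \<omega>) \<partial>M)"
    by (rule iid_with_law_nn_integral_sum[symmetric, OF X J(1,3,4) F])
  finally show ?thesis by simp
qed

section \<open>Moments of the tilted law for a small tilting parameter\<close>

context clt_seq
begin

text \<open>The threshold is divided by 3 because \<open>integrable_norm_mult_of_cube\<close> needs
  the cube of the factor in front of which the norm stands.\<close>

lemma integrable_norm_power_exp: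
  fixes f :: "'a \<Rightarrow>\<^sub>L real"
  shows "\<exists>t>0. \<forall>k. \<forall>s\<le>t. integrable \<mu> (\<lambda>x. \<bar>f x\<bar> ^ k * exp (s * \<bar>f x\<bar>)) \<and>
    integrable \<mu> (\<lambda>x. norm x * (\<bar>f x\<bar> ^ k * exp (s * \<bar>f x\<bar>)))"
proof -
  obtain K where K: "K > 0" "\<And>n. prob {\<omega>\<in>space M. norm (\<Sum>i<n. X i \<omega>) > K * sqrt (real n)} \<le> 1 / 4"
    using tight by blast
  have cube: "integrable \<mu> (\<lambda>x. norm x * sqrt (norm x))"
    by (rule integrable_norm_sqrt[OF K])
  obtain t where t: "t > 0" "\<forall>k. \<forall>s\<le>t. integrable \<mu> (\<lambda>x. \<bar>f x\<bar> ^ k * exp (s * \<bar>f x\<bar>))"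
    using integrable_power_exp[of f] by blast
  have "integrable \<mu> (\<lambda>x. norm x * (\<bar>f x\<bar> ^ k * exp (s * \<bar>f x\<bar>)))" if "s \<le> t / 3" for k s
  proof (rule integrable_norm_mult_of_cube[OF sets_law cube])
    have "integrable \<mu> (\<lambda>x. \<bar>f x\<bar> ^ (k * 3) * exp ((3 * s) * \<bar>f x\<bar>))" using that t(2) by auto
    also have "(\<lambda>x. \<bar>f x\<bar> ^ (k * 3) * exp ((3 * s) * \<bar>f x\<bar>)) = (\<lambda>x. (\<bar>f x\<bar> ^ k * exp (s * \<bar>f x\<bar>)) ^ 3)"
      by (auto simp: power_mult_distrib power_mult simp flip: exp_of_nat_mult)
    finally show "integrable \<mu> (\<lambda>x. (\<bar>f x\<bar> ^ k * exp (s * \<bar>f x\<bar>)) ^ 3)" .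
  qed auto
  moreover have "integrable \<mu> (\<lambda>x. \<bar>f x\<bar> ^ k * exp (s * \<bar>f x\<bar>))" if "s \<le> t / 3" for k s
    using that t by (intro t(2)[rule_format]) auto
  ultimately show ?thesis using t(1) by (intro exI[of _ "t / 3"]) auto
qed

lemma integrable_norm_mult_functional: "integrable \<mu> (\<lambda>x. norm x * \<bar>blinfun_apply f x\<bar> ^ k)"
  for f :: "'a \<Rightarrow>\<^sub>L real"
proof -
  obtain t where "t > 0" and t: "\<forall>k. \<forall>s\<le>t. integrable \<mu> (\<lambda>x. norm x * (\<bar>f x\<bar> ^ k * exp (s * \<bar>f x\<bar>)))"
    using integrable_norm_power_exp[of f] by blast
  then have "integrable \<mu> (\<lambda>x. norm x * (\<bar>f x\<bar> ^ k * exp (0 * \<bar>f x\<bar>)))" using less_imp_le by blast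
  then show ?thesis by simp
qed

lemma integrable_id: "integrable \<mu> (\<lambda>x. x)"
  using integrable_norm_mult_functional[of 0 0]
  by (intro Bochner_Integration.integrable_bound[of \<mu> norm "\<lambda>x. x"]) auto

lemma integrable_functional_scaleR: "integrable \<mu> (\<lambda>x. blinfun_apply f x *\<^sub>R x)" for f :: "'a \<Rightarrow>\<^sub>L real"
  by (rule Bochner_Integration.integrable_bound[OF integrable_norm_mult_functional[of f 1]]) auto

lemma mean_zero: "(\<integral>x. x \<partial>\<mu>) = 0"
proof (rule blinfun_real_separates)
  fix h :: "'a \<Rightarrow>\<^sub>L real"
  have "h (\<integral>x. x \<partial>\<mu>) = (\<integral>x. h x \<partial>\<mu>)"
    by (rule integral_bounded_linear[OF blinfun.bounded_linear_right integrable_id, symmetric])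
  then show "h (\<integral>x. x \<partial>\<mu>) = h 0" by (simp add: mean_functional_zero)
qed

text \<open>This moves \<open>a\<close> from an integral under \<open>\<gamma>\<close> to one under
  \<open>\<mu>\<close>, the form in which it appears as the first-order term of the tilted mean.
  Both sides are compared through functionals, where the scalar identity is known.\<close>

lemma tilted_gaussian_mean:
  fixes g :: "'a \<Rightarrow>\<^sub>L real"
  assumes "has_bochner_integral \<gamma> (\<lambda>x. exp (g x - var g / 2) *\<^sub>R x) a"
  shows "a = (\<integral>x. g x *\<^sub>R x \<partial>\<mu>)"
proof (rule blinfun_real_separates)
  fix h :: "'a \<Rightarrow>\<^sub>L real"
  have "h (\<integral>x. g x *\<^sub>R x \<partial>\<mu>) = (\<integral>x. h (g x *\<^sub>R x) \<partial>\<mu>)"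
    by (rule integral_bounded_linear[OF blinfun.bounded_linear_right integrable_functional_scaleR, symmetric])
  then show "h a = h (\<integral>x. g x *\<^sub>R x \<partial>\<mu>)"
    using functional_tilted_gaussian_mean[OF assms, of h] by (simp add: blinfun.scaleR_right)
qed

definition mgf :: "('a \<Rightarrow>\<^sub>L real) \<Rightarrow> real" where "mgf f = (\<integral>x. exp (blinfun_apply f x) \<partial>\<mu>)"

text \<open>The lower bound 1 for \<open>mgf f\<close> comes from the tangent line of exp together
  with the mean zero of \<open>f\<close>; it makes every later division by \<open>mgf f\<close>
  harmless.\<close>

lemma tilted_integral:
  fixes f :: "'a \<Rightarrow>\<^sub>L real" and F :: "'a \<Rightarrow> 'b::{banach, second_countable_topology}"
  assumes f: "integrable \<mu> (\<lambda>x. exp (f x))"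
  shows "laplace \<mu> f = ennreal (mgf f)" "mgf f \<ge> 1" "prob_space (tilted \<mu> f)"
    "sets (tilted \<mu> f) = sets borel"
    "F \<in> borel_measurable borel \<Longrightarrow> integrable (tilted \<mu> f) F \<longleftrightarrow> integrable \<mu> (\<lambda>x. exp (f x) *\<^sub>R F x)"
    "F \<in> borel_measurable borel \<Longrightarrow> (\<integral>x. F x \<partial>tilted \<mu> f) = (1 / mgf f) *\<^sub>R (\<integral>x. exp (f x) *\<^sub>R F x \<partial>\<mu>)"
proof -
  show L: "laplace \<mu> f = ennreal (mgf f)"
    unfolding laplace_def mgf_def by (intro nn_integral_eq_integral f) auto
  have "(\<integral>x. 1 + f x \<partial>\<mu>) \<le> mgf f"
    unfolding mgf_def using f integrable_functional[of f] by (intro integral_mono exp_ge_add_one_self) auto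
  moreover have "(\<integral>x. 1 + f x \<partial>\<mu>) = 1"
    using integrable_functional[of f] mean_functional_zero[of f] \<mu>.prob_space by simp
  ultimately show L1: "mgf f \<ge> 1" by simp
  have tilt: "tilted \<mu> f = density \<mu> (\<lambda>x. ennreal (exp (f x) / mgf f))"
    using L L1 by (simp add: tilted_def divide_ennreal)
  show "sets (tilted \<mu> f) = sets borel" by (simp add: tilt)
  show "prob_space (tilted \<mu> f)"
  proof (rule prob_spaceI)
    have "emeasure (tilted \<mu> f) (space (tilted \<mu> f)) = (\<integral>\<^sup>+x. ennreal (exp (f x) / mgf f) \<partial>\<mu>)"
      unfolding tilt by (subst emeasure_density) (auto intro!: nn_integral_cong)
    also have "\<dots> = ennreal (\<integral>x. exp (f x) / mgf f \<partial>\<mu>)"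
      using f L1 by (intro nn_integral_eq_integral) auto
    also have "(\<integral>x. exp (f x) / mgf f \<partial>\<mu>) = 1" using L1 by (simp add: mgf_def)
    finally show "emeasure (tilted \<mu> f) (space (tilted \<mu> f)) = 1" by simp
  qed
  assume [measurable]: "F \<in> borel_measurable borel"
  have "integrable (tilted \<mu> f) F \<longleftrightarrow> integrable \<mu> (\<lambda>x. (exp (f x) / mgf f) *\<^sub>R F x)"
    unfolding tilt using L1 by (intro integrable_density) auto
  also have "\<dots> \<longleftrightarrow> integrable \<mu> (\<lambda>x. (1 / mgf f) *\<^sub>R (exp (f x) *\<^sub>R F x))"
    by simp
  also have "\<dots> \<longleftrightarrow> integrable \<mu> (\<lambda>x. exp (f x) *\<^sub>R F x)"
  proof
    assume *: "integrable \<mu> (\<lambda>x. (1 / mgf f) *\<^sub>R (exp (f x) *\<^sub>R F x))"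
    have "integrable \<mu> (\<lambda>x. mgf f *\<^sub>R ((1 / mgf f) *\<^sub>R (exp (f x) *\<^sub>R F x)))"
      by (rule integrable_scaleR_right) (rule *)
    then show "integrable \<mu> (\<lambda>x. exp (f x) *\<^sub>R F x)" using L1 by simp
  qed (intro integrable_scaleR_right)
  finally show "integrable (tilted \<mu> f) F \<longleftrightarrow> integrable \<mu> (\<lambda>x. exp (f x) *\<^sub>R F x)" .
  have "(\<integral>x. F x \<partial>tilted \<mu> f) = (\<integral>x. (exp (f x) / mgf f) *\<^sub>R F x \<partial>\<mu>)"
    unfolding tilt using L1 by (intro integral_density) auto
  also have "\<dots> = (\<integral>x. (1 / mgf f) *\<^sub>R (exp (f x) *\<^sub>R F x) \<partial>\<mu>)" by simp
  also have "\<dots> = (1 / mgf f) *\<^sub>R (\<integral>x. exp (f x) *\<^sub>R F x \<partial>\<mu>)" by (rule integral_scaleR_right)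
  finally show "(\<integral>x. F x \<partial>tilted \<mu> f) = (1 / mgf f) *\<^sub>R (\<integral>x. exp (f x) *\<^sub>R F x \<partial>\<mu>)" .
qed

text \<open>Taylor expansion in \<epsilon> under the integral sign. The terms without a second
  factor drop out because the means of \<open>g\<close> and of \<open>x\<close> vanish. The
  remainders are dominated by the two integrals whose maximum is \<open>A\<close>; the one
  containing \<open>norm x\<close> is finite by \<open>integrable_norm_power_exp\<close>.\<close>

lemma exp_functional_expansion:
  fixes g :: "'a \<Rightarrow>\<^sub>L real"
  shows "\<exists>t>0. t \<le> 1 \<and> (\<exists>A\<ge>0. \<forall>\<epsilon>. 0 < \<epsilon> \<and> \<epsilon> \<le> t \<longrightarrow>
    (\<forall>k. integrable \<mu> (\<lambda>x. exp (\<epsilon> * g x) * \<bar>g x\<bar> ^ k) \<and> integrable \<mu> (\<lambda>x. exp (\<epsilon> * g x) * g x ^ k)) \<and>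
    integrable \<mu> (\<lambda>x. exp (\<epsilon> * g x) *\<^sub>R x) \<and>
    \<bar>(\<integral>x. exp (\<epsilon> * g x) \<partial>\<mu>) - 1 - \<epsilon>\<^sup>2 * var g / 2\<bar> \<le> A * \<epsilon> ^ 3 \<and>
    \<bar>(\<integral>x. exp (\<epsilon> * g x) * g x \<partial>\<mu>) - \<epsilon> * var g\<bar> \<le> A * \<epsilon>\<^sup>2 \<and>
    \<bar>(\<integral>x. exp (\<epsilon> * g x) * (g x)\<^sup>2 \<partial>\<mu>) - var g\<bar> \<le> A * \<epsilon> \<and>
    (\<integral>x. exp (\<epsilon> * g x) * \<bar>g x\<bar> ^ 3 \<partial>\<mu>) \<le> A \<and>
    norm ((\<integral>x. exp (\<epsilon> * g x) *\<^sub>R x \<partial>\<mu>) - \<epsilon> *\<^sub>R (\<integral>x. g x *\<^sub>R x \<partial>\<mu>)) \<le> A * \<epsilon>\<^sup>2)"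
proof -
  obtain t0 where t0: "t0 > 0" "\<forall>k. \<forall>s\<le>t0. integrable \<mu> (\<lambda>x. \<bar>g x\<bar> ^ k * exp (s * \<bar>g x\<bar>)) \<and>
    integrable \<mu> (\<lambda>x. norm x * (\<bar>g x\<bar> ^ k * exp (s * \<bar>g x\<bar>)))"
    using integrable_norm_power_exp[of g] by blast
  define t where "t = min t0 1"
  have t: "t > 0" "t \<le> 1" and I: "integrable \<mu> (\<lambda>x. \<bar>g x\<bar> ^ k * exp (t * \<bar>g x\<bar>))"
    "integrable \<mu> (\<lambda>x. norm x * (\<bar>g x\<bar> ^ k * exp (t * \<bar>g x\<bar>)))" for k
    using t0 by (auto simp: t_def)
  define A where "A = max (\<integral>x. \<bar>g x\<bar> ^ 3 * exp (t * \<bar>g x\<bar>) \<partial>\<mu>) (\<integral>x. norm x * (\<bar>g x\<bar> ^ 2 * exp (t * \<bar>g x\<bar>)) \<partial>\<mu>)"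
  have A0: "A \<ge> 0" unfolding A_def by (intro max.coboundedI1 integral_nonneg_AE) auto
  have expt: "exp (\<epsilon> * y) \<le> exp (t * \<bar>y\<bar>)" "exp \<bar>\<epsilon> * y\<bar> \<le> exp (t * \<bar>y\<bar>)" if "0 < \<epsilon>" "\<epsilon> \<le> t" for \<epsilon> y :: real
  proof -
    have "\<epsilon> * y \<le> \<epsilon> * \<bar>y\<bar>" using that by (intro mult_left_mono) auto
    also have le: "\<epsilon> * \<bar>y\<bar> \<le> t * \<bar>y\<bar>" using that by (intro mult_right_mono) auto
    finally show "exp (\<epsilon> * y) \<le> exp (t * \<bar>y\<bar>)" "exp \<bar>\<epsilon> * y\<bar> \<le> exp (t * \<bar>y\<bar>)"
      using that le by (auto simp: abs_mult)
  qed
  show ?thesis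
  proof (rule exI[of _ t], intro conjI t, rule exI[of _ A], intro conjI A0 allI impI)
    fix \<epsilon> assume "0 < \<epsilon> \<and> \<epsilon> \<le> t"
    then have \<epsilon>: "0 < \<epsilon>" "\<epsilon> \<le> t" by auto
    note E = expt[OF \<epsilon>]
    show J1: "integrable \<mu> (\<lambda>x. exp (\<epsilon> * g x) * \<bar>g x\<bar> ^ k)" for k
      by (rule Bochner_Integration.integrable_bound[OF I(1)[of k]])
        (auto simp: abs_mult mult.commute intro!: AE_I2 mult_left_mono E)
    show J2: "integrable \<mu> (\<lambda>x. exp (\<epsilon> * g x) * g x ^ k)" for k
      by (rule Bochner_Integration.integrable_bound[OF J1[of k]]) (auto simp: abs_mult power_abs)
    show J3: "integrable \<mu> (\<lambda>x. exp (\<epsilon> * g x) *\<^sub>R x)"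
    proof (rule Bochner_Integration.integrable_bound[OF I(2)[of 0]])
      show "AE x in \<mu>. norm (exp (\<epsilon> * g x) *\<^sub>R x) \<le> norm (norm x * (\<bar>g x\<bar> ^ 0 * exp (t * \<bar>g x\<bar>)))"
        by (auto simp: abs_mult mult.commute[of "norm _"] intro!: mult_right_mono E)
    qed measurable
    have G: "integrable \<mu> (\<lambda>x. g x ^ k)" for k by (rule integrable_power)
    have J0: "integrable \<mu> (\<lambda>x. exp (\<epsilon> * g x))" using J1[of 0] by simp
    \<comment> \<open>The power in front and the order of the remainder add up to 3, so the three
      scalar expansions share the dominating function
      \<open>\<bar>g x\<bar> ^ 3 * exp (t * \<bar>g x\<bar>)\<close>.\<close>
    have taylor: "\<bar>\<integral>x. g x ^ k * (exp (\<epsilon> * g x) - (\<Sum>m<n. (\<epsilon> * g x) ^ m / fact m)) \<partial>\<mu>\<bar> \<le> A * \<epsilon> ^ n"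
      if "k + n = 3" for k n
    proof -
      have pt: "\<bar>y ^ k * (exp (\<epsilon> * y) - (\<Sum>m<n. (\<epsilon> * y) ^ m / fact m))\<bar> \<le> \<epsilon> ^ n * (\<bar>y\<bar> ^ 3 * exp (t * \<bar>y\<bar>))" for y
      proof -
        have "\<bar>y ^ k * (exp (\<epsilon> * y) - (\<Sum>m<n. (\<epsilon> * y) ^ m / fact m))\<bar> \<le> \<bar>y\<bar> ^ k * (\<bar>\<epsilon> * y\<bar> ^ n * exp \<bar>\<epsilon> * y\<bar>)"
          unfolding abs_mult[of "y ^ k"] power_abs by (intro mult_left_mono exp_taylor_bound) auto
        also have "\<dots> \<le> \<bar>y\<bar> ^ k * (\<bar>\<epsilon> * y\<bar> ^ n * exp (t * \<bar>y\<bar>))" by (intro mult_left_mono E) auto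
        also have "\<dots> = \<epsilon> ^ n * (\<bar>y\<bar> ^ (k + n) * exp (t * \<bar>y\<bar>))"
          using \<epsilon> by (simp add: abs_mult power_mult_distrib power_add)
        finally show ?thesis by (simp add: that)
      qed
      have G: "integrable \<mu> (\<lambda>x. \<epsilon> ^ n * (\<bar>g x\<bar> ^ 3 * exp (t * \<bar>g x\<bar>)))"
        using I(1)[of 3] by (rule integrable_mult_right)
      have "norm (\<integral>x. g x ^ k * (exp (\<epsilon> * g x) - (\<Sum>m<n. (\<epsilon> * g x) ^ m / fact m)) \<partial>\<mu>)
          \<le> (\<integral>x. \<epsilon> ^ n * (\<bar>g x\<bar> ^ 3 * exp (t * \<bar>g x\<bar>)) \<partial>\<mu>)"
      proof (rule norm_integral_le)
        show "integrable \<mu> (\<lambda>x. g x ^ k * (exp (\<epsilon> * g x) - (\<Sum>m<n. (\<epsilon> * g x) ^ m / fact m)))"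
          using pt \<epsilon> by (intro Bochner_Integration.integrable_bound[OF G]) (auto simp: abs_mult)
      qed (use pt G in auto)
      then have "\<bar>\<integral>x. g x ^ k * (exp (\<epsilon> * g x) - (\<Sum>m<n. (\<epsilon> * g x) ^ m / fact m)) \<partial>\<mu>\<bar>
          \<le> (\<integral>x. \<epsilon> ^ n * (\<bar>g x\<bar> ^ 3 * exp (t * \<bar>g x\<bar>)) \<partial>\<mu>)" by simp
      also have "\<dots> = \<epsilon> ^ n * (\<integral>x. \<bar>g x\<bar> ^ 3 * exp (t * \<bar>g x\<bar>) \<partial>\<mu>)" by simp
      also have "\<dots> \<le> \<epsilon> ^ n * A" using \<epsilon> by (intro mult_left_mono) (auto simp: A_def)
      finally show ?thesis by (simp add: mult.commute)
    qed
    have "(\<integral>x. g x ^ 0 * (exp (\<epsilon> * g x) - (\<Sum>m<3. (\<epsilon> * g x) ^ m / fact m)) \<partial>\<mu>)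
        = (\<integral>x. exp (\<epsilon> * g x) - 1 - \<epsilon> * g x - \<epsilon>\<^sup>2 / 2 * g x ^ 2 \<partial>\<mu>)"
      by (intro Bochner_Integration.integral_cong) (auto simp: eval_nat_numeral lessThan_Suc)
    also have "\<dots> = (\<integral>x. exp (\<epsilon> * g x) \<partial>\<mu>) - 1 - \<epsilon>\<^sup>2 * var g / 2"
      using J0 G[of 2] integrable_functional[of g] mean_functional_zero[of g] \<mu>.prob_space
      by (simp add: var_def)
    finally show "\<bar>(\<integral>x. exp (\<epsilon> * g x) \<partial>\<mu>) - 1 - \<epsilon>\<^sup>2 * var g / 2\<bar> \<le> A * \<epsilon> ^ 3"
      using taylor[of 0 3] by simp
    have "(\<integral>x. g x ^ 1 * (exp (\<epsilon> * g x) - (\<Sum>m<2. (\<epsilon> * g x) ^ m / fact m)) \<partial>\<mu>)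
        = (\<integral>x. exp (\<epsilon> * g x) * g x ^ 1 - g x - \<epsilon> * g x ^ 2 \<partial>\<mu>)"
      by (intro Bochner_Integration.integral_cong) (auto simp: eval_nat_numeral lessThan_Suc algebra_simps)
    also have "\<dots> = (\<integral>x. exp (\<epsilon> * g x) * g x \<partial>\<mu>) - \<epsilon> * var g"
      using J2[of 1] G[of 2] integrable_functional[of g] mean_functional_zero[of g]
      by (simp add: var_def)
    finally show "\<bar>(\<integral>x. exp (\<epsilon> * g x) * g x \<partial>\<mu>) - \<epsilon> * var g\<bar> \<le> A * \<epsilon>\<^sup>2"
      using taylor[of 1 2] by simp
    have "(\<integral>x. g x ^ 2 * (exp (\<epsilon> * g x) - (\<Sum>m<1. (\<epsilon> * g x) ^ m / fact m)) \<partial>\<mu>)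
        = (\<integral>x. exp (\<epsilon> * g x) * g x ^ 2 - g x ^ 2 \<partial>\<mu>)"
      by (intro Bochner_Integration.integral_cong) (auto simp: algebra_simps)
    also have "\<dots> = (\<integral>x. exp (\<epsilon> * g x) * (g x)\<^sup>2 \<partial>\<mu>) - var g"
      using J2[of 2] G[of 2] by (simp add: var_def)
    finally show "\<bar>(\<integral>x. exp (\<epsilon> * g x) * (g x)\<^sup>2 \<partial>\<mu>) - var g\<bar> \<le> A * \<epsilon>"
      using taylor[of 2 1] by simp
    have "(\<integral>x. exp (\<epsilon> * g x) * \<bar>g x\<bar> ^ 3 \<partial>\<mu>) \<le> (\<integral>x. \<bar>g x\<bar> ^ 3 * exp (t * \<bar>g x\<bar>) \<partial>\<mu>)"
      by (intro integral_mono J1 I) (auto simp: mult.commute intro!: mult_right_mono E)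
    then show "(\<integral>x. exp (\<epsilon> * g x) * \<bar>g x\<bar> ^ 3 \<partial>\<mu>) \<le> A" by (simp add: A_def)
    have "(\<integral>x. (exp (\<epsilon> * g x) - 1 - \<epsilon> * g x) *\<^sub>R x \<partial>\<mu>) = (\<integral>x. exp (\<epsilon> * g x) *\<^sub>R x - x - \<epsilon> *\<^sub>R (g x *\<^sub>R x) \<partial>\<mu>)"
      by (intro Bochner_Integration.integral_cong) (auto simp: algebra_simps)
    also have "\<dots> = (\<integral>x. exp (\<epsilon> * g x) *\<^sub>R x \<partial>\<mu>) - \<epsilon> *\<^sub>R (\<integral>x. g x *\<^sub>R x \<partial>\<mu>)"
      using J3 integrable_id integrable_functional_scaleR[of g] mean_zero by (simp del: scaleR_scaleR)
    finally have "norm ((\<integral>x. exp (\<epsilon> * g x) *\<^sub>R x \<partial>\<mu>) - \<epsilon> *\<^sub>R (\<integral>x. g x *\<^sub>R x \<partial>\<mu>))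
        = norm (\<integral>x. (exp (\<epsilon> * g x) - 1 - \<epsilon> * g x) *\<^sub>R x \<partial>\<mu>)" by simp
    also have "\<dots> \<le> (\<integral>x. \<epsilon>\<^sup>2 * (norm x * (\<bar>g x\<bar> ^ 2 * exp (t * \<bar>g x\<bar>))) \<partial>\<mu>)"
    proof (rule norm_integral_le)
      have eq: "(\<lambda>x. (exp (\<epsilon> * g x) - 1 - \<epsilon> * g x) *\<^sub>R x) = (\<lambda>x. exp (\<epsilon> * g x) *\<^sub>R x - x - \<epsilon> *\<^sub>R (g x *\<^sub>R x))"
        by (auto simp: algebra_simps)
      show "integrable \<mu> (\<lambda>x. (exp (\<epsilon> * g x) - 1 - \<epsilon> * g x) *\<^sub>R x)"
        unfolding eq using J3 integrable_id integrable_functional_scaleR[of g] by (simp del: scaleR_scaleR)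
      show "integrable \<mu> (\<lambda>x. \<epsilon>\<^sup>2 * (norm x * (\<bar>g x\<bar> ^ 2 * exp (t * \<bar>g x\<bar>))))"
        using I(2)[of 2] by (rule integrable_mult_right)
      fix x
      have "\<bar>exp (\<epsilon> * g x) - 1 - \<epsilon> * g x\<bar> \<le> \<bar>\<epsilon> * g x\<bar> ^ 2 * exp \<bar>\<epsilon> * g x\<bar>"
        using exp_taylor_bound[of "\<epsilon> * g x" 2] by (simp add: eval_nat_numeral lessThan_Suc diff_diff_eq)
      also have "\<dots> \<le> \<bar>\<epsilon> * g x\<bar> ^ 2 * exp (t * \<bar>g x\<bar>)" by (intro mult_left_mono E) auto
      also have "\<dots> = \<epsilon>\<^sup>2 * (\<bar>g x\<bar> ^ 2 * exp (t * \<bar>g x\<bar>))" by (simp add: power_mult_distrib)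
      finally have "\<bar>exp (\<epsilon> * g x) - 1 - \<epsilon> * g x\<bar> * norm x \<le> \<epsilon>\<^sup>2 * (\<bar>g x\<bar> ^ 2 * exp (t * \<bar>g x\<bar>)) * norm x"
        by (rule mult_right_mono) simp
      then show "norm ((exp (\<epsilon> * g x) - 1 - \<epsilon> * g x) *\<^sub>R x) \<le> \<epsilon>\<^sup>2 * (norm x * (\<bar>g x\<bar> ^ 2 * exp (t * \<bar>g x\<bar>)))"
        by (simp add: mult_ac)
    qed
    also have "\<dots> = \<epsilon>\<^sup>2 * (\<integral>x. norm x * (\<bar>g x\<bar> ^ 2 * exp (t * \<bar>g x\<bar>)) \<partial>\<mu>)" by simp
    also have "\<dots> \<le> \<epsilon>\<^sup>2 * A" by (intro mult_left_mono) (auto simp: A_def)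
    finally show "norm ((\<integral>x. exp (\<epsilon> * g x) *\<^sub>R x \<partial>\<mu>) - \<epsilon> *\<^sub>R (\<integral>x. g x *\<^sub>R x \<partial>\<mu>)) \<le> A * \<epsilon>\<^sup>2"
      by (simp add: mult.commute)
  qed
qed

text \<open>Dividing by \<open>L = mgf (\<epsilon> *\<^sub>R g)\<close> costs at most
  \<open>L - 1\<close> times the main term, and \<open>L - 1\<close> is of order \<epsilon>^2, which
  does not exceed the errors already present. The logarithm differs from \<open>L - 1\<close> by at
  most \<open>(L - 1)\<^sup>2\<close>, of order \<epsilon>^4.\<close>

lemma tilted_moments:
  fixes g :: "'a \<Rightarrow>\<^sub>L real"
  shows "\<exists>t>0. \<exists>C\<ge>0. \<forall>\<epsilon>. 0 < \<epsilon> \<and> \<epsilon> \<le> t \<longrightarrow> integrable \<mu> (\<lambda>x. exp ((\<epsilon> *\<^sub>R g) x)) \<and>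
    integrable (tilted \<mu> (\<epsilon> *\<^sub>R g)) (\<lambda>x. x) \<and>
    (\<forall>k. integrable (tilted \<mu> (\<epsilon> *\<^sub>R g)) (\<lambda>x. g x ^ k)) \<and>
    \<bar>ln (mgf (\<epsilon> *\<^sub>R g)) - \<epsilon>\<^sup>2 * var g / 2\<bar> \<le> C * \<epsilon> ^ 3 \<and>
    \<bar>(\<integral>x. g x \<partial>tilted \<mu> (\<epsilon> *\<^sub>R g)) - \<epsilon> * var g\<bar> \<le> C * \<epsilon>\<^sup>2 \<and>
    \<bar>(\<integral>x. (g x)\<^sup>2 \<partial>tilted \<mu> (\<epsilon> *\<^sub>R g)) - var g\<bar> \<le> C * \<epsilon> \<and>
    (\<integral>x. \<bar>g x\<bar> ^ 3 \<partial>tilted \<mu> (\<epsilon> *\<^sub>R g)) \<le> C \<and>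
    norm ((\<integral>x. x \<partial>tilted \<mu> (\<epsilon> *\<^sub>R g)) - \<epsilon> *\<^sub>R (\<integral>x. g x *\<^sub>R x \<partial>\<mu>)) \<le> C * \<epsilon>\<^sup>2"
proof -
  obtain t A where t: "t > 0" "t \<le> 1" and A: "A \<ge> 0" and H: "\<And>\<epsilon>. 0 < \<epsilon> \<and> \<epsilon> \<le> t \<Longrightarrow>
    (\<forall>k. integrable \<mu> (\<lambda>x. exp (\<epsilon> * g x) * \<bar>g x\<bar> ^ k) \<and> integrable \<mu> (\<lambda>x. exp (\<epsilon> * g x) * g x ^ k)) \<and>
    integrable \<mu> (\<lambda>x. exp (\<epsilon> * g x) *\<^sub>R x) \<and>
    \<bar>(\<integral>x. exp (\<epsilon> * g x) \<partial>\<mu>) - 1 - \<epsilon>\<^sup>2 * var g / 2\<bar> \<le> A * \<epsilon> ^ 3 \<and>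
    \<bar>(\<integral>x. exp (\<epsilon> * g x) * g x \<partial>\<mu>) - \<epsilon> * var g\<bar> \<le> A * \<epsilon>\<^sup>2 \<and>
    \<bar>(\<integral>x. exp (\<epsilon> * g x) * (g x)\<^sup>2 \<partial>\<mu>) - var g\<bar> \<le> A * \<epsilon> \<and>
    (\<integral>x. exp (\<epsilon> * g x) * \<bar>g x\<bar> ^ 3 \<partial>\<mu>) \<le> A \<and>
    norm ((\<integral>x. exp (\<epsilon> * g x) *\<^sub>R x \<partial>\<mu>) - \<epsilon> *\<^sub>R (\<integral>x. g x *\<^sub>R x \<partial>\<mu>)) \<le> A * \<epsilon>\<^sup>2"
    using exp_functional_expansion[of g] by blast
  define v where "v = var g"
  have v0: "v \<ge> 0" unfolding v_def by (rule var_nonneg)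
  define a where "a = (\<integral>x. g x *\<^sub>R x \<partial>\<mu>)"
  define c where "c = v / 2 + A"
  have c0: "c \<ge> 0" using v0 A by (simp add: c_def)
  define C where "C = A + c\<^sup>2 + c * v + c * norm a"
  have C: "C \<ge> A + c\<^sup>2" "C \<ge> A + c * v" "C \<ge> A + c * norm a" "C \<ge> A" "C \<ge> 0"
    using A v0 c0 by (auto simp: C_def)
  show ?thesis
  proof (rule exI[of _ t], intro conjI t(1), rule exI[of _ C], intro conjI C(5) allI impI)
    fix \<epsilon> assume "0 < \<epsilon> \<and> \<epsilon> \<le> t"
    note h = H[OF this, folded v_def a_def]
    have \<epsilon>: "0 < \<epsilon>" "\<epsilon> \<le> 1" using \<open>0 < \<epsilon> \<and> \<epsilon> \<le> t\<close> t by auto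
    let ?f = "\<epsilon> *\<^sub>R g"
    define L where "L = mgf ?f"
    have Leq: "L = (\<integral>x. exp (\<epsilon> * g x) \<partial>\<mu>)" by (simp add: L_def mgf_def blinfun.scaleR_left)
    have "integrable \<mu> (\<lambda>x. exp (\<epsilon> * g x) * \<bar>g x\<bar> ^ 0)" using h by blast
    then show int: "integrable \<mu> (\<lambda>x. exp (?f x))" by (simp add: blinfun.scaleR_left)
    note T = tilted_integral[OF int]
    have L1: "L \<ge> 1" unfolding L_def by (rule T)
    have e32: "\<epsilon> ^ 3 \<le> \<epsilon>\<^sup>2" using \<epsilon> by (intro power_decreasing) auto
    have "L - 1 \<le> \<epsilon>\<^sup>2 * v / 2 + A * \<epsilon> ^ 3" using h unfolding Leq by linarith
    also have "\<dots> \<le> \<epsilon>\<^sup>2 * v / 2 + A * \<epsilon>\<^sup>2" using A e32 by (intro add_left_mono mult_left_mono)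
    also have "\<dots> = c * \<epsilon>\<^sup>2" by (simp add: c_def algebra_simps)
    finally have \<delta>: "L - 1 \<le> c * \<epsilon>\<^sup>2" .
    show "integrable (tilted \<mu> ?f) (\<lambda>x. x)" using h T(5)[of "\<lambda>x. x"] by (simp add: blinfun.scaleR_left)
    show "integrable (tilted \<mu> ?f) (\<lambda>x. g x ^ k)" for k
      using h T(5)[of "\<lambda>x. g x ^ k"] by (simp add: blinfun.scaleR_left)
    show "\<bar>ln (mgf ?f) - \<epsilon>\<^sup>2 * var g / 2\<bar> \<le> C * \<epsilon> ^ 3"
    proof -
      have u: "ln L \<le> L - 1" using L1 by (intro ln_le_minus_one) auto
      \<comment> \<open>The lower bound for \<open>ln L\<close> is the upper bound
        \<open>u - 1\<close> for \<open>ln u\<close>, taken at \<open>u = 1 / L\<close>.\<close>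
      have "- ln L = ln (1 / L)" using L1 by (simp add: ln_div)
      also have "\<dots> \<le> 1 / L - 1" using L1 by (intro ln_le_minus_one) auto
      also have "\<dots> \<le> - (L - 1) + (L - 1)\<^sup>2"
      proof -
        have "(- (L - 1) + (L - 1)\<^sup>2) - (1 / L - 1) = (L - 1) ^ 3 / L + 0"
          using L1 by (simp add: field_simps power2_eq_square power3_eq_cube)
        moreover have "(L - 1) ^ 3 / L \<ge> 0" using L1 by simp
        ultimately show ?thesis by linarith
      qed
      finally have l: "ln L \<ge> (L - 1) - (L - 1)\<^sup>2" by simp
      have "(L - 1)\<^sup>2 \<le> (c * \<epsilon>\<^sup>2)\<^sup>2" using \<delta> L1 by (intro power_mono) auto
      also have "\<dots> = c\<^sup>2 * \<epsilon> ^ 4" by (simp add: power_mult_distrib flip: power_mult)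
      also have "\<dots> \<le> c\<^sup>2 * \<epsilon> ^ 3" using \<epsilon> by (intro mult_left_mono power_decreasing) auto
      finally have "\<bar>ln L - \<epsilon>\<^sup>2 * v / 2\<bar> \<le> c\<^sup>2 * \<epsilon> ^ 3 + A * \<epsilon> ^ 3" using u l h unfolding Leq[symmetric] by (simp add: abs_le_iff)
      also have "\<dots> = (A + c\<^sup>2) * \<epsilon> ^ 3" by (simp add: algebra_simps)
      also have "\<dots> \<le> C * \<epsilon> ^ 3" using C \<epsilon> by (intro mult_right_mono) auto
      finally show ?thesis by (simp add: L_def v_def)
    qed
    show "\<bar>(\<integral>x. g x \<partial>tilted \<mu> ?f) - \<epsilon> * var g\<bar> \<le> C * \<epsilon>\<^sup>2"
    proof -
      have "\<bar>(\<integral>x. g x \<partial>tilted \<mu> ?f) - \<epsilon> * v\<bar> = norm ((1 / L) *\<^sub>R (\<integral>x. exp (\<epsilon> * g x) * g x \<partial>\<mu>) - \<epsilon> * v)"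
        using T(6)[of "blinfun_apply g"] by (simp add: blinfun.scaleR_left L_def)
      also have "\<dots> \<le> norm ((\<integral>x. exp (\<epsilon> * g x) * g x \<partial>\<mu>) - \<epsilon> * v) + (L - 1) * norm (\<epsilon> * v)"
        by (rule norm_scaleR_inverse_diff_le[OF L1])
      also have "\<dots> \<le> A * \<epsilon>\<^sup>2 + (c * \<epsilon>\<^sup>2) * v"
      proof (rule add_mono)
        show "(L - 1) * norm (\<epsilon> * v) \<le> (c * \<epsilon>\<^sup>2) * v"
          using \<delta> L1 v0 c0 \<epsilon> by (intro mult_mono) (auto simp: abs_mult intro: mult_left_le_one_le)
      qed (use h in simp)
      also have "\<dots> = (A + c * v) * \<epsilon>\<^sup>2" by (simp add: algebra_simps)
      also have "\<dots> \<le> C * \<epsilon>\<^sup>2" using C by (intro mult_right_mono) auto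
      finally show ?thesis by (simp add: v_def)
    qed
    show "\<bar>(\<integral>x. (g x)\<^sup>2 \<partial>tilted \<mu> ?f) - var g\<bar> \<le> C * \<epsilon>"
    proof -
      have "\<bar>(\<integral>x. (g x)\<^sup>2 \<partial>tilted \<mu> ?f) - v\<bar> = norm ((1 / L) *\<^sub>R (\<integral>x. exp (\<epsilon> * g x) * (g x)\<^sup>2 \<partial>\<mu>) - v)"
        using T(6)[of "\<lambda>x. (g x)\<^sup>2"] by (simp add: blinfun.scaleR_left L_def)
      also have "\<dots> \<le> norm ((\<integral>x. exp (\<epsilon> * g x) * (g x)\<^sup>2 \<partial>\<mu>) - v) + (L - 1) * norm v"
        by (rule norm_scaleR_inverse_diff_le[OF L1])
      also have "\<dots> \<le> A * \<epsilon> + (c * \<epsilon>) * v"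
      proof (rule add_mono)
        have "c * \<epsilon>\<^sup>2 \<le> c * \<epsilon>" using \<epsilon> c0 by (intro mult_left_mono) (auto simp: power2_eq_square mult_left_le_one_le)
        then show "(L - 1) * norm v \<le> (c * \<epsilon>) * v"
          using \<delta> L1 v0 c0 \<epsilon> by (intro mult_mono) auto
      qed (use h in simp)
      also have "\<dots> = (A + c * v) * \<epsilon>" by (simp add: algebra_simps)
      also have "\<dots> \<le> C * \<epsilon>" using C \<epsilon> by (intro mult_right_mono) auto
      finally show ?thesis by (simp add: v_def)
    qed
    show "(\<integral>x. \<bar>g x\<bar> ^ 3 \<partial>tilted \<mu> ?f) \<le> C"
    proof -
      have nn: "(\<integral>x. exp (\<epsilon> * g x) * \<bar>g x\<bar> ^ 3 \<partial>\<mu>) \<ge> 0" by (intro integral_nonneg_AE) auto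
      have "(\<integral>x. \<bar>g x\<bar> ^ 3 \<partial>tilted \<mu> ?f) = (1 / L) * (\<integral>x. exp (\<epsilon> * g x) * \<bar>g x\<bar> ^ 3 \<partial>\<mu>)"
        using T(6)[of "\<lambda>x. \<bar>g x\<bar> ^ 3"] by (simp add: blinfun.scaleR_left L_def)
      also have "\<dots> \<le> 1 * (\<integral>x. exp (\<epsilon> * g x) * \<bar>g x\<bar> ^ 3 \<partial>\<mu>)"
        using nn L1 by (intro mult_right_mono) auto
      also have "\<dots> \<le> C" using h C by linarith
      finally show ?thesis .
    qed
    show "norm ((\<integral>x. x \<partial>tilted \<mu> ?f) - \<epsilon> *\<^sub>R (\<integral>x. g x *\<^sub>R x \<partial>\<mu>)) \<le> C * \<epsilon>\<^sup>2"
    proof -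
      have "norm ((\<integral>x. x \<partial>tilted \<mu> ?f) - \<epsilon> *\<^sub>R a) = norm ((1 / L) *\<^sub>R (\<integral>x. exp (\<epsilon> * g x) *\<^sub>R x \<partial>\<mu>) - \<epsilon> *\<^sub>R a)"
        using T(6)[of "\<lambda>x. x"] by (simp add: blinfun.scaleR_left L_def)
      also have "\<dots> \<le> norm ((\<integral>x. exp (\<epsilon> * g x) *\<^sub>R x \<partial>\<mu>) - \<epsilon> *\<^sub>R a) + (L - 1) * norm (\<epsilon> *\<^sub>R a)"
        by (rule norm_scaleR_inverse_diff_le[OF L1])
      also have "\<dots> \<le> A * \<epsilon>\<^sup>2 + (c * \<epsilon>\<^sup>2) * norm a"
      proof (rule add_mono)
        show "(L - 1) * norm (\<epsilon> *\<^sub>R a) \<le> (c * \<epsilon>\<^sup>2) * norm a"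
          using \<delta> L1 c0 \<epsilon> by (intro mult_mono) (auto intro: mult_left_le_one_le)
      qed (use h in simp)
      also have "\<dots> = (A + c * norm a) * \<epsilon>\<^sup>2" by (simp add: algebra_simps)
      also have "\<dots> \<le> C * \<epsilon>\<^sup>2" using C by (intro mult_right_mono) auto
      finally show ?thesis by (simp add: a_def)
    qed
  qed
qed

end

subsection \<open>A local bound by Gaussian smoothing\<close>

text \<open>The Gaussian is its own Fourier transform up to scaling. Taking the standard normal law
  as the measure on the frequency side builds the damping into the integrator and keeps all
  frequency integrals over a probability measure.\<close>

lemma normal_density_fourier:
  assumes "\<tau> > 0"
  shows "complex_of_real (normal_density 0 \<tau> z)
    = (1 / (\<tau> * sqrt (2 * pi))) *\<^sub>R (CLINT x|std_normal_distribution. iexp (z * (x / \<tau>)))"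
proof -
  have "(CLINT x|std_normal_distribution. iexp (z * (x / \<tau>))) = char std_normal_distribution (z / \<tau>)"
    by (simp add: char_def)
  also have "\<dots> = complex_of_real (exp (- (z / \<tau>)\<^sup>2 / 2))" by (simp add: char_std_normal_distribution)
  finally show ?thesis
    using assms by (simp add: normal_density_def scaleR_conv_of_real real_sqrt_mult power_divide mult_ac)
qed

text \<open>The left-hand side is the density at \<open>y\<close> of \<open>\<xi>\<close> plus an
  independent normal variable of standard deviation \<open>\<tau>\<close>. After Fubini,
  \<open>y\<close> enters only through a factor of modulus one, so the bound is uniform in
  \<open>y\<close>.\<close>

lemma (in prob_space) expectation_normal_density_le:
  assumes \<xi>[measurable]: "random_variable borel \<xi>" and "\<tau> > 0"
  shows "expectation (\<lambda>\<omega>. normal_density 0 \<tau> (\<xi> \<omega> - y))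
    \<le> (1 / (\<tau> * sqrt (2 * pi))) * (\<integral>x. cmod (char (distr M borel \<xi>) (x / \<tau>)) \<partial>std_normal_distribution)"
proof -
  interpret G: real_distribution std_normal_distribution by (rule real_dist_normal_dist)
  interpret D: real_distribution "distr M borel \<xi>" by simp
  interpret P: pair_prob_space M std_normal_distribution ..
  define F where "F \<omega> x = iexp ((\<xi> \<omega> - y) * (x / \<tau>))" for \<omega> x
  have F[measurable]: "(\<lambda>(\<omega>, x). F \<omega> x) \<in> borel_measurable (M \<Otimes>\<^sub>M std_normal_distribution)"
    unfolding F_def by measurable
  have int: "integrable (M \<Otimes>\<^sub>M std_normal_distribution) (\<lambda>(\<omega>, x). F \<omega> x)"
    by (rule P.integrable_const_bound[where B=1]) (auto simp: F_def)
  have "complex_of_real (expectation (\<lambda>\<omega>. normal_density 0 \<tau> (\<xi> \<omega> - y)))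
    = (CLINT \<omega>|M. complex_of_real (normal_density 0 \<tau> (\<xi> \<omega> - y)))" by simp
  also have "\<dots> = (CLINT \<omega>|M. (1 / (\<tau> * sqrt (2 * pi))) *\<^sub>R (CLINT x|std_normal_distribution. F \<omega> x))"
    unfolding F_def using assms by (simp only: normal_density_fourier)
  also have "\<dots> = (1 / (\<tau> * sqrt (2 * pi))) *\<^sub>R (CLINT \<omega>|M. (CLINT x|std_normal_distribution. F \<omega> x))"
    by (rule integral_scaleR_right)
  also have "(CLINT \<omega>|M. (CLINT x|std_normal_distribution. F \<omega> x)) = (CLINT x|std_normal_distribution. (CLINT \<omega>|M. F \<omega> x))"
    by (rule P.Fubini_integral[OF int, symmetric])
  also have "(\<lambda>x. (CLINT \<omega>|M. F \<omega> x)) = (\<lambda>x. iexp (- y * (x / \<tau>)) * char (distr M borel \<xi>) (x / \<tau>))"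
  proof
    fix x
    have "F \<omega> x = iexp (- y * (x / \<tau>)) * iexp ((x / \<tau>) * \<xi> \<omega>)" for \<omega>
      unfolding F_def exp_add[symmetric] by (simp add: algebra_simps)
    then have "(CLINT \<omega>|M. F \<omega> x) = iexp (- y * (x / \<tau>)) * (CLINT \<omega>|M. iexp ((x / \<tau>) * \<xi> \<omega>))"
      by (simp only: integral_mult_right_zero)
    then show "(CLINT \<omega>|M. F \<omega> x) = iexp (- y * (x / \<tau>)) * char (distr M borel \<xi>) (x / \<tau>)"
      unfolding char_def by (subst integral_distr) auto
  qed
  finally have eq: "complex_of_real (expectation (\<lambda>\<omega>. normal_density 0 \<tau> (\<xi> \<omega> - y)))
    = (1 / (\<tau> * sqrt (2 * pi))) *\<^sub>R (CLINT x|std_normal_distribution. iexp (- y * (x / \<tau>)) * char (distr M borel \<xi>) (x / \<tau>))" .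
  have "expectation (\<lambda>\<omega>. normal_density 0 \<tau> (\<xi> \<omega> - y)) \<le> cmod (complex_of_real (expectation (\<lambda>\<omega>. normal_density 0 \<tau> (\<xi> \<omega> - y))))"
    by (simp del: integral_complex_of_real)
  also have "\<dots> = (1 / (\<tau> * sqrt (2 * pi))) * cmod (CLINT x|std_normal_distribution. iexp (- y * (x / \<tau>)) * char (distr M borel \<xi>) (x / \<tau>))"
    unfolding eq using assms by simp
  also have "\<dots> \<le> (1 / (\<tau> * sqrt (2 * pi))) * (\<integral>x. cmod (iexp (- y * (x / \<tau>)) * char (distr M borel \<xi>) (x / \<tau>)) \<partial>std_normal_distribution)"
    using assms by (intro mult_left_mono integral_norm_bound) auto
  also have "(\<lambda>x. cmod (iexp (- y * (x / \<tau>)) * char (distr M borel \<xi>) (x / \<tau>))) = (\<lambda>x. cmod (char (distr M borel \<xi>) (x / \<tau>)))"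
    by (intro ext) (simp add: norm_mult del: of_real_mult of_real_divide of_real_minus)
  finally show ?thesis .
qed

lemma normal_density_ball:
  assumes "\<tau> > 0" "r > 0"
  shows "ennreal (1 - \<tau>\<^sup>2 / r\<^sup>2) \<le> (\<integral>\<^sup>+y. ennreal (normal_density x \<tau> y) * indicator {x - r..x + r} y \<partial>lborel)"
proof -
  interpret G: prob_space "density lborel (normal_density x \<tau>)" by (rule prob_space_normal_density) fact
  have m2: "integrable (density lborel (normal_density x \<tau>)) (\<lambda>y. (y - x)\<^sup>2)"
    "(\<integral>y. (y - x)\<^sup>2 \<partial>density lborel (normal_density x \<tau>)) = \<tau>\<^sup>2"
    using integrable_normal_moment[OF assms(1), of x 2] integral_normal_moment_even[OF assms(1), of x 1]
    by (simp_all add: integrable_density integral_density)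
  have "G.prob {y\<in>space (density lborel (normal_density x \<tau>)). r\<^sup>2 \<le> (y - x)\<^sup>2}
      \<le> (\<integral>y. (y - x)\<^sup>2 \<partial>density lborel (normal_density x \<tau>)) / r\<^sup>2"
    using assms by (intro integral_Markov_inequality_measure[where A="{}"] m2) auto
  then have "1 - \<tau>\<^sup>2 / r\<^sup>2 \<le> 1 - G.prob {y. r\<^sup>2 \<le> (y - x)\<^sup>2}" using m2 by simp
  also have "\<dots> = G.prob (space (density lborel (normal_density x \<tau>)) - {y. r\<^sup>2 \<le> (y - x)\<^sup>2})"
    by (subst G.prob_compl) auto
  also have "\<dots> \<le> G.prob {x - r..x + r}"
  proof (rule G.finite_measure_mono)
    show "space (density lborel (normal_density x \<tau>)) - {y. r\<^sup>2 \<le> (y - x)\<^sup>2} \<subseteq> {x - r..x + r}"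
    proof
      fix y assume "y \<in> space (density lborel (normal_density x \<tau>)) - {y. r\<^sup>2 \<le> (y - x)\<^sup>2}"
      then have "(y - x)\<^sup>2 < r\<^sup>2" by simp
      then have "\<bar>y - x\<bar> < r" using assms abs_square_less_1 by (metis abs_le_square_iff abs_of_pos linorder_not_less)
      then show "y \<in> {x - r..x + r}" by auto
    qed
  qed simp
  finally have "ennreal (1 - \<tau>\<^sup>2 / r\<^sup>2) \<le> emeasure (density lborel (normal_density x \<tau>)) {x - r..x + r}"
    by (simp add: G.emeasure_eq_measure ennreal_leI)
  then show ?thesis by (simp add: emeasure_density)
qed

lemma nn_integral_exp_neg:
  "(\<integral>\<^sup>+y. ennreal (exp (- y)) * indicator {a..} y \<partial>lborel) = ennreal (exp (- a))" for a :: real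
proof -
  have lim: "((\<lambda>y::real. - exp (- y)) \<longlongrightarrow> 0) at_top" by real_asymp
  have "(\<integral>\<^sup>+y. ennreal (exp (- y)) * indicator {a..} y \<partial>lborel) = ennreal (0 - (- exp (- a)))"
    by (rule nn_integral_FTC_atLeast[OF _ _ _ lim]) (auto intro!: derivative_eq_intros)
  then show ?thesis by simp
qed

text \<open>Smoothing \<open>\<xi>\<close> by an independent normal variable of standard deviation \<open>\<tau>\<close> gives a density bounded by the
  right-hand factor; shifting by at most \<open>r\<close> costs the remaining factors.\<close>

lemma (in prob_space) exp_neg_smoothing:
  assumes \<xi>[measurable]: "random_variable borel \<xi>" and "\<tau> > 0" "r > \<tau>"
    and B: "(1 / (\<tau> * sqrt (2 * pi))) * (\<integral>x. cmod (char (distr M borel \<xi>) (x / \<tau>)) \<partial>std_normal_distribution) \<le> B"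
  shows "(\<integral>\<^sup>+\<omega>. ennreal (exp (- \<xi> \<omega>)) * indicator {- \<delta>..} (\<xi> \<omega>) \<partial>M) \<le> ennreal (exp (2 * r + \<delta>) / (1 - \<tau>\<^sup>2 / r\<^sup>2) * B)"
proof -
  define p where "p = 1 - \<tau>\<^sup>2 / r\<^sup>2"
  have "\<tau>\<^sup>2 < r\<^sup>2" using assms by (intro power_strict_mono) auto
  then have p: "p > 0" using assms by (simp add: p_def field_simps)
  interpret P: pair_sigma_finite M lborel ..
  have nd: "normal_density 0 \<tau> (\<xi> \<omega> - y) = normal_density (\<xi> \<omega>) \<tau> y" for \<omega> y
    by (simp add: normal_density_def power2_commute)
  have B0: "B \<ge> 0"
  proof (rule order_trans[OF _ B])
    show "0 \<le> (1 / (\<tau> * sqrt (2 * pi))) * (\<integral>x. cmod (char (distr M borel \<xi>) (x / \<tau>)) \<partial>std_normal_distribution)"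
      using assms by (intro mult_nonneg_nonneg integral_nonneg_AE) auto
  qed
  \<comment> \<open>The normal law around \<open>z\<close> has mass at least \<open>p\<close> within
    distance \<open>r\<close>, and \<open>exp (- y)\<close> is at least \<open>exp (- z - r)\<close>
    there. The half-line must be extended by \<open>r\<close> to contain these \<open>y\<close>;
    this and the shift of the exponential together produce the \<open>2 * r\<close> in the final
    exponent.\<close>
  have pt: "ennreal (exp (- r) * p) * (ennreal (exp (- z)) * indicator {- \<delta>..} z)
      \<le> (\<integral>\<^sup>+y. ennreal (exp (- y)) * indicator {- \<delta> - r..} y * ennreal (normal_density z \<tau> y) \<partial>lborel)" for z
  proof (cases "z \<ge> - \<delta>")
    case True
    have "ennreal (exp (- r) * p) * ennreal (exp (- z)) = ennreal (exp (- z - r)) * ennreal p"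
      using p by (simp add: exp_diff exp_minus field_simps flip: ennreal_mult)
    also have "\<dots> \<le> ennreal (exp (- z - r)) * (\<integral>\<^sup>+y. ennreal (normal_density z \<tau> y) * indicator {z - r..z + r} y \<partial>lborel)"
      unfolding p_def using assms by (intro mult_left_mono normal_density_ball) auto
    also have "\<dots> = (\<integral>\<^sup>+y. ennreal (exp (- z - r)) * (ennreal (normal_density z \<tau> y) * indicator {z - r..z + r} y) \<partial>lborel)"
      by (rule nn_integral_cmult[symmetric]) measurable
    also have "\<dots> \<le> (\<integral>\<^sup>+y. ennreal (exp (- y)) * indicator {- \<delta> - r..} y * ennreal (normal_density z \<tau> y) \<partial>lborel)"
      using True by (intro nn_integral_mono) (auto split: split_indicator simp: mult_right_mono)
    finally show ?thesis using True by simp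
  qed simp
  have "ennreal (exp (- r) * p) * (\<integral>\<^sup>+\<omega>. ennreal (exp (- \<xi> \<omega>)) * indicator {- \<delta>..} (\<xi> \<omega>) \<partial>M)
    = (\<integral>\<^sup>+\<omega>. ennreal (exp (- r) * p) * (ennreal (exp (- \<xi> \<omega>)) * indicator {- \<delta>..} (\<xi> \<omega>)) \<partial>M)"
    by (rule nn_integral_cmult[symmetric]) measurable
  also have "\<dots> \<le> (\<integral>\<^sup>+\<omega>. (\<integral>\<^sup>+y. ennreal (exp (- y)) * indicator {- \<delta> - r..} y * ennreal (normal_density 0 \<tau> (\<xi> \<omega> - y)) \<partial>lborel) \<partial>M)"
    unfolding nd by (intro nn_integral_mono pt)
  also have "\<dots> = (\<integral>\<^sup>+y. (\<integral>\<^sup>+\<omega>. ennreal (exp (- y)) * indicator {- \<delta> - r..} y * ennreal (normal_density 0 \<tau> (\<xi> \<omega> - y)) \<partial>M) \<partial>lborel)"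
    by (rule P.Fubini'[symmetric]) measurable
  also have "\<dots> \<le> (\<integral>\<^sup>+y. ennreal (exp (- y)) * indicator {- \<delta> - r..} y * ennreal B \<partial>lborel)"
  proof (rule nn_integral_mono)
    fix y :: real
    have "(\<integral>\<^sup>+\<omega>. ennreal (normal_density 0 \<tau> (\<xi> \<omega> - y)) \<partial>M) = ennreal (expectation (\<lambda>\<omega>. normal_density 0 \<tau> (\<xi> \<omega> - y)))"
    proof (rule nn_integral_eq_integral)
      show "integrable M (\<lambda>\<omega>. normal_density 0 \<tau> (\<xi> \<omega> - y))"
        using assms by (intro integrable_const_bound[where B="1 / sqrt (2 * pi * \<tau>\<^sup>2)"]) (auto simp: normal_density_def intro!: AE_I2 divide_right_mono)
    qed auto
    also have "\<dots> \<le> ennreal B"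
      using expectation_normal_density_le[OF \<xi> \<open>\<tau> > 0\<close>, of y] B by (intro ennreal_leI) linarith
    finally have "ennreal (exp (- y)) * indicator {- \<delta> - r..} y * (\<integral>\<^sup>+\<omega>. ennreal (normal_density 0 \<tau> (\<xi> \<omega> - y)) \<partial>M)
      \<le> ennreal (exp (- y)) * indicator {- \<delta> - r..} y * ennreal B" by (rule mult_left_mono) simp
    then show "(\<integral>\<^sup>+\<omega>. ennreal (exp (- y)) * indicator {- \<delta> - r..} y * ennreal (normal_density 0 \<tau> (\<xi> \<omega> - y)) \<partial>M)
      \<le> ennreal (exp (- y)) * indicator {- \<delta> - r..} y * ennreal B"
      by (subst nn_integral_cmult) auto
  qed
  also have "\<dots> = ennreal (exp (\<delta> + r) * B)"
    using B0 by (subst nn_integral_multc) (auto simp: nn_integral_exp_neg ennreal_mult add.commute)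
  finally have main: "ennreal (exp (- r) * p) * (\<integral>\<^sup>+\<omega>. ennreal (exp (- \<xi> \<omega>)) * indicator {- \<delta>..} (\<xi> \<omega>) \<partial>M) \<le> ennreal (exp (\<delta> + r) * B)" .
  have "(\<integral>\<^sup>+\<omega>. ennreal (exp (- \<xi> \<omega>)) * indicator {- \<delta>..} (\<xi> \<omega>) \<partial>M)
    = ennreal (exp r / p) * (ennreal (exp (- r) * p) * (\<integral>\<^sup>+\<omega>. ennreal (exp (- \<xi> \<omega>)) * indicator {- \<delta>..} (\<xi> \<omega>) \<partial>M))"
    using p by (simp add: exp_minus flip: mult.assoc ennreal_mult)
  also have "\<dots> \<le> ennreal (exp r / p) * ennreal (exp (\<delta> + r) * B)" by (intro mult_left_mono main) auto
  also have "\<dots> = ennreal (exp r / p * (exp (\<delta> + r) * B))" using p B0 by (simp flip: ennreal_mult)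
  also have "exp r / p * (exp (\<delta> + r) * B) = exp (2 * r + \<delta>) / p * B"
    by (simp add: exp_add[symmetric] field_simps)
  finally show ?thesis by (simp add: p_def)
qed

lemma std_normal_exp_square:
  assumes "q \<ge> 0"
  shows "(\<integral>x. exp (- q * x\<^sup>2 / 2) \<partial>std_normal_distribution) = 1 / sqrt (1 + q)"
proof -
  have "(\<integral>x. exp (- q * x\<^sup>2 / 2) \<partial>std_normal_distribution) = (\<integral>x. std_normal_density x * exp (- q * x\<^sup>2 / 2) \<partial>lborel)"
    by (subst integral_density) auto
  also have "\<dots> = (\<integral>x. (1 / sqrt (1 + q)) * normal_density 0 (1 / sqrt (1 + q)) x \<partial>lborel)"
  proof (rule Bochner_Integration.integral_cong)
    fix x :: real
    have "- x\<^sup>2 / 2 + - q * x\<^sup>2 / 2 = - (x\<^sup>2 * (1 + q)) / 2" by (simp add: algebra_simps add_divide_distrib diff_divide_distrib)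
    then have "exp (- x\<^sup>2 / 2) * exp (- q * x\<^sup>2 / 2) = exp (- (x\<^sup>2 * (1 + q)) / 2)" by (metis exp_add)
    then show "std_normal_density x * exp (- q * x\<^sup>2 / 2) = (1 / sqrt (1 + q)) * normal_density 0 (1 / sqrt (1 + q)) x"
      using assms by (simp add: normal_density_def power_divide real_sqrt_divide)
  qed simp
  also have "\<dots> = 1 / sqrt (1 + q)" using assms by simp
  finally show ?thesis .
qed

lemma std_normal_tail: "R > 0 \<Longrightarrow> measure std_normal_distribution {x. R \<le> \<bar>x\<bar>} \<le> 1 / R\<^sup>2"
proof -
  assume R: "R > 0"
  have "measure std_normal_distribution {x\<in>space std_normal_distribution. R\<^sup>2 \<le> x\<^sup>2} \<le> (\<integral>x. x\<^sup>2 \<partial>std_normal_distribution) / R\<^sup>2"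
    using R integrable_std_normal_distribution_moment[of 2] by (intro integral_Markov_inequality_measure[where A="{}"]) auto
  also have "(\<integral>x. x\<^sup>2 \<partial>std_normal_distribution) = 1"
    using std_normal_distribution_even_moments(1)[of 1] by simp
  also have "{x\<in>space std_normal_distribution. R\<^sup>2 \<le> x\<^sup>2} = {x. R \<le> \<bar>x\<bar>}"
    using R by (auto simp: abs_le_square_iff[symmetric])
  finally show ?thesis .
qed

text \<open>Below \<open>\<tau> * R\<close> the Gaussian bound applies, above it the trivial bound 1
  together with Chebyshev's inequality for the standard normal law. The first term does not depend
  on \<open>\<tau>\<close>: it is the maximal value of the normal density with variance
  \<open>q\<close>, which is what makes the final constant sharp.\<close>

lemma char_smoothing_integral_le:
  assumes "real_distribution \<rho>" and "\<tau> > 0" "R > 0" "q > 0"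
    and bd: "\<And>u. \<bar>u\<bar> \<le> R \<Longrightarrow> cmod (char \<rho> u) \<le> exp (- q * u\<^sup>2 / 2)"
  shows "(1 / (\<tau> * sqrt (2 * pi))) * (\<integral>x. cmod (char \<rho> (x / \<tau>)) \<partial>std_normal_distribution)
    \<le> 1 / sqrt (2 * pi * q) + 1 / (\<tau> ^ 3 * R\<^sup>2 * sqrt (2 * pi))"
proof -
  interpret real_distribution \<rho> by fact
  interpret G: real_distribution std_normal_distribution by (rule real_dist_normal_dist)
  let ?q = "q / \<tau>\<^sup>2"
  have q: "?q > 0" using assms by simp
  have pt: "cmod (char \<rho> (x / \<tau>)) \<le> exp (- ?q * x\<^sup>2 / 2) + indicator {x. \<tau> * R \<le> \<bar>x\<bar>} x" for x
  proof (cases "\<tau> * R \<le> \<bar>x\<bar>")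
    case False
    then have "\<bar>x / \<tau>\<bar> \<le> R" using assms by (simp add: field_simps)
    from bd[OF this] show ?thesis using False by (simp add: power_divide)
  qed (use cmod_char_le_1[of "x / \<tau>"] in \<open>simp add: add_increasing\<close>)
  have ie: "integrable std_normal_distribution (\<lambda>x. exp (- ?q * x\<^sup>2 / 2))"
    using assms by (intro G.integrable_const_bound[where B=1] AE_I2) auto
  have [measurable]: "{x::real. \<tau> * R \<le> \<bar>x\<bar>} \<in> sets borel" by measurable
  have "(\<integral>x. cmod (char \<rho> (x / \<tau>)) \<partial>std_normal_distribution)
    \<le> (\<integral>x. exp (- ?q * x\<^sup>2 / 2) + indicator {x. \<tau> * R \<le> \<bar>x\<bar>} x \<partial>std_normal_distribution)"
  proof (rule integral_mono)
    show "integrable std_normal_distribution (\<lambda>x. cmod (char \<rho> (x / \<tau>)))"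
      by (intro G.integrable_const_bound[where B=1]) (auto simp: cmod_char_le_1)
    show "integrable std_normal_distribution (\<lambda>x. exp (- ?q * x\<^sup>2 / 2) + indicator {x. \<tau> * R \<le> \<bar>x\<bar>} x)"
      by (intro Bochner_Integration.integrable_add ie G.integrable_const_bound[where B=1]) auto
  qed (rule pt)
  also have "\<dots> = 1 / sqrt (1 + ?q) + measure std_normal_distribution {x. \<tau> * R \<le> \<bar>x\<bar>}"
    using q by (subst Bochner_Integration.integral_add[OF ie])
      (auto simp: std_normal_exp_square[OF less_imp_le[OF q], simplified] intro!: G.integrable_const_bound[where B=1])
  also have "\<dots> \<le> \<tau> / sqrt q + 1 / (\<tau> * R)\<^sup>2"
  proof (rule add_mono)
    have "sqrt ?q \<le> sqrt (1 + ?q)" by (rule real_sqrt_le_mono) simp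
    moreover have "sqrt ?q = sqrt q / \<tau>" using assms by (simp add: real_sqrt_divide)
    moreover have "sqrt ?q > 0" using q by simp
    ultimately have "1 / sqrt (1 + ?q) \<le> 1 / (sqrt q / \<tau>)" by (intro frac_le) auto
    then show "1 / sqrt (1 + ?q) \<le> \<tau> / sqrt q" by simp
    show "measure std_normal_distribution {x. \<tau> * R \<le> \<bar>x\<bar>} \<le> 1 / (\<tau> * R)\<^sup>2"
      using assms by (intro std_normal_tail) simp
  qed
  finally have "(1 / (\<tau> * sqrt (2 * pi))) * (\<integral>x. cmod (char \<rho> (x / \<tau>)) \<partial>std_normal_distribution)
    \<le> (1 / (\<tau> * sqrt (2 * pi))) * (\<tau> / sqrt q + 1 / (\<tau> * R)\<^sup>2)"
    using assms by (intro mult_left_mono) auto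
  also have "\<dots> = 1 / sqrt (2 * pi * q) + 1 / (\<tau> ^ 3 * R\<^sup>2 * sqrt (2 * pi))"
    using assms by (simp add: real_sqrt_mult distrib_left power_mult_distrib power2_eq_square power3_eq_cube mult_ac)
  finally show ?thesis .
qed

text \<open>In the second-order expansion the third-moment remainder is at most
  \<open>\<theta>\<^sup>2 * (w - \<kappa>) / 2\<close> by the first condition on
  \<open>\<theta>\<close>; it is paid for by lowering the variance from \<open>w\<close> to
  \<open>\<kappa>\<close>. The second condition keeps the main term nonnegative.\<close>

lemma (in prob_space) cmod_char_le_exp:
  fixes Y :: "'a \<Rightarrow> real"
  assumes [measurable]: "random_variable borel Y"
    and int: "integrable M Y" "integrable M (\<lambda>\<omega>. (Y \<omega>)\<^sup>2)" "integrable M (\<lambda>\<omega>. \<bar>Y \<omega>\<bar> ^ 3)"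
    and m: "expectation Y = 0" "expectation (\<lambda>\<omega>. (Y \<omega>)\<^sup>2) = w" "expectation (\<lambda>\<omega>. \<bar>Y \<omega>\<bar> ^ 3) \<le> C"
    and \<theta>: "\<bar>\<theta>\<bar> * C \<le> 3 * (w - \<kappa>)" "\<theta>\<^sup>2 * w \<le> 2"
  shows "cmod (char (distr M borel Y) \<theta>) \<le> exp (- \<kappa> * \<theta>\<^sup>2 / 2)"
proof -
  let ?\<chi> = "char (distr M borel Y) \<theta>"
  have "cmod (?\<chi> - (1 - \<theta>\<^sup>2 * w / 2)) \<le> (\<theta>\<^sup>2 / 6) * expectation (\<lambda>\<omega>. min (6 * (Y \<omega>)\<^sup>2) (\<bar>\<theta>\<bar> * \<bar>Y \<omega>\<bar> ^ 3))"
    using int m by (intro char_approx3') auto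
  also have "\<dots> \<le> (\<theta>\<^sup>2 / 6) * (\<bar>\<theta>\<bar> * C)"
  proof (intro mult_left_mono)
    have "expectation (\<lambda>\<omega>. min (6 * (Y \<omega>)\<^sup>2) (\<bar>\<theta>\<bar> * \<bar>Y \<omega>\<bar> ^ 3)) \<le> expectation (\<lambda>\<omega>. \<bar>\<theta>\<bar> * \<bar>Y \<omega>\<bar> ^ 3)"
      using int by (intro integral_mono) (auto intro!: integrable_min)
    also have "\<dots> \<le> \<bar>\<theta>\<bar> * C" using m by (simp add: mult_left_mono)
    finally show "expectation (\<lambda>\<omega>. min (6 * (Y \<omega>)\<^sup>2) (\<bar>\<theta>\<bar> * \<bar>Y \<omega>\<bar> ^ 3)) \<le> \<bar>\<theta>\<bar> * C" .
  qed simp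
  also have "\<dots> \<le> (\<theta>\<^sup>2 / 6) * (3 * (w - \<kappa>))" using \<theta> by (intro mult_left_mono) auto
  also have "\<dots> = \<theta>\<^sup>2 * (w - \<kappa>) / 2" by simp
  finally have 1: "cmod (?\<chi> - (1 - \<theta>\<^sup>2 * w / 2)) \<le> \<theta>\<^sup>2 * (w - \<kappa>) / 2" .
  have "cmod ?\<chi> \<le> cmod (?\<chi> - (1 - \<theta>\<^sup>2 * w / 2)) + cmod (1 - \<theta>\<^sup>2 * w / 2)"
    by (metis diff_add_cancel norm_triangle_ineq)
  also have "cmod (1 - \<theta>\<^sup>2 * w / 2) = \<bar>1 - \<theta>\<^sup>2 * w / 2\<bar>"
    by (metis norm_of_real of_real_1 of_real_diff of_real_divide of_real_mult of_real_numeral)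
  also have "\<dots> = 1 - \<theta>\<^sup>2 * w / 2" using \<theta> by simp
  finally have "cmod ?\<chi> \<le> 1 + - \<kappa> * \<theta>\<^sup>2 / 2" using 1 by (simp add: algebra_simps diff_divide_distrib)
  also have "\<dots> \<le> exp (- \<kappa> * \<theta>\<^sup>2 / 2)" by (rule exp_ge_add_one_self)
  finally show ?thesis .
qed

text \<open>The bound for one summand holds up to frequency \<open>\<theta>\<close>, hence the bound
  for the sum scaled by \<open>\<epsilon>\<close> holds up to \<open>\<theta> / \<epsilon>\<close>.
  The smoothing scale is \<open>r\<^sup>2\<close> and the permitted shift is \<open>r\<close>: with
  this choice both \<open>exp (2 * r)\<close> and \<open>1 - r\<^sup>2\<close>, the mass bound for
  the shift, tend to 1 as \<open>r\<close> tends to 0.\<close>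

lemma (in prob_space) exp_neg_sum_bound:
  fixes Y :: "'i \<Rightarrow> 'a \<Rightarrow> real"
  assumes J: "finite J" "J \<noteq> {}" and indep: "indep_vars (\<lambda>_. borel) Y J"
    and int: "\<And>j. j \<in> J \<Longrightarrow> integrable M (Y j)" "\<And>j. j \<in> J \<Longrightarrow> integrable M (\<lambda>\<omega>. (Y j \<omega>)\<^sup>2)"
      "\<And>j. j \<in> J \<Longrightarrow> integrable M (\<lambda>\<omega>. \<bar>Y j \<omega>\<bar> ^ 3)"
    and m: "\<And>j. j \<in> J \<Longrightarrow> expectation (Y j) = 0" "\<And>j. j \<in> J \<Longrightarrow> expectation (\<lambda>\<omega>. (Y j \<omega>)\<^sup>2) = w"
      "\<And>j. j \<in> J \<Longrightarrow> expectation (\<lambda>\<omega>. \<bar>Y j \<omega>\<bar> ^ 3) \<le> C"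
    and \<theta>: "\<theta> > 0" "\<theta> * C \<le> 3 * (w - \<kappa>)" "\<theta>\<^sup>2 * w \<le> 2" and "C \<ge> 0" "w \<ge> 0" "\<kappa> > 0" "\<epsilon> > 0" "0 < r" "r < 1"
  shows "(\<integral>\<^sup>+\<omega>. ennreal (exp (- (\<epsilon> * (\<Sum>j\<in>J. Y j \<omega>)))) * indicator {- \<delta>..} (\<epsilon> * (\<Sum>j\<in>J. Y j \<omega>)) \<partial>M)
    \<le> ennreal (exp (2 * r + \<delta>) / (1 - r\<^sup>2) *
        (1 / sqrt (2 * pi * (real (card J) * \<epsilon>\<^sup>2 * \<kappa>)) + \<epsilon>\<^sup>2 / (r ^ 6 * \<theta>\<^sup>2 * sqrt (2 * pi))))"
proof -
  have [measurable]: "random_variable borel (Y j)" if "j \<in> J" for j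
    using indep that by (auto simp: indep_vars_def)
  define \<xi> where "\<xi> \<omega> = \<epsilon> * (\<Sum>j\<in>J. Y j \<omega>)" for \<omega>
  have \<xi>[measurable]: "random_variable borel \<xi>" unfolding \<xi>_def by measurable
  interpret D: real_distribution "distr M borel \<xi>" by simp
  have n: "real (card J) > 0" using J by (simp add: card_gt_0_iff)
  have bd: "cmod (char (distr M borel \<xi>) u) \<le> exp (- (real (card J) * \<epsilon>\<^sup>2 * \<kappa>) * u\<^sup>2 / 2)" if u: "\<bar>u\<bar> \<le> \<theta> / \<epsilon>" for u
  proof -
    have "char (distr M borel \<xi>) u = char (distr M borel (\<lambda>\<omega>. \<Sum>j\<in>J. \<epsilon> * Y j \<omega>)) u"
      by (simp add: \<xi>_def[abs_def] sum_distrib_left)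
    also have "\<dots> = (\<Prod>j\<in>J. char (distr M borel (\<lambda>\<omega>. \<epsilon> * Y j \<omega>)) u)"
      by (rule char_distr_sum, rule indep_vars_compose2[OF indep]) simp
    also have "\<dots> = (\<Prod>j\<in>J. char (distr M borel (Y j)) (\<epsilon> * u))"
    proof (rule prod.cong)
      fix j assume "j \<in> J"
      then show "char (distr M borel (\<lambda>\<omega>. \<epsilon> * Y j \<omega>)) u = char (distr M borel (Y j)) (\<epsilon> * u)"
        unfolding char_def by (subst (1 2) integral_distr) (auto simp: mult_ac)
    qed simp
    finally have "cmod (char (distr M borel \<xi>) u) = (\<Prod>j\<in>J. cmod (char (distr M borel (Y j)) (\<epsilon> * u)))"
      by (simp add: prod_norm)
    also have "\<dots> \<le> (\<Prod>j\<in>J. exp (- \<kappa> * (\<epsilon> * u)\<^sup>2 / 2))"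
    proof (intro prod_mono conjI)
      fix j assume j: "j \<in> J"
      have au: "\<bar>\<epsilon> * u\<bar> \<le> \<theta>" using u \<open>\<epsilon> > 0\<close> by (simp add: abs_mult field_simps)
      have "\<bar>\<epsilon> * u\<bar> * C \<le> \<theta> * C" using au \<open>C \<ge> 0\<close> by (rule mult_right_mono)
      moreover have "(\<epsilon> * u)\<^sup>2 \<le> \<theta>\<^sup>2" using au \<theta>(1) by (simp add: abs_le_square_iff[symmetric])
      then have "(\<epsilon> * u)\<^sup>2 * w \<le> \<theta>\<^sup>2 * w" using \<open>w \<ge> 0\<close> by (rule mult_right_mono)
      ultimately show "cmod (char (distr M borel (Y j)) (\<epsilon> * u)) \<le> exp (- \<kappa> * (\<epsilon> * u)\<^sup>2 / 2)"
        using j \<theta> int m by (intro cmod_char_le_exp[where w=w and C=C]) auto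
    qed simp
    also have "\<dots> = exp (- (real (card J) * \<epsilon>\<^sup>2 * \<kappa>) * u\<^sup>2 / 2)"
      by (simp add: power_mult_distrib mult_ac flip: exp_of_nat_mult)
    finally show ?thesis .
  qed
  have "(1 / (r\<^sup>2 * sqrt (2 * pi))) * (\<integral>x. cmod (char (distr M borel \<xi>) (x / r\<^sup>2)) \<partial>std_normal_distribution)
    \<le> 1 / sqrt (2 * pi * (real (card J) * \<epsilon>\<^sup>2 * \<kappa>)) + 1 / ((r\<^sup>2) ^ 3 * (\<theta> / \<epsilon>)\<^sup>2 * sqrt (2 * pi))"
    using assms n by (intro char_smoothing_integral_le bd D.real_distribution_axioms) auto
  also have "1 / ((r\<^sup>2) ^ 3 * (\<theta> / \<epsilon>)\<^sup>2 * sqrt (2 * pi)) = \<epsilon>\<^sup>2 / (r ^ 6 * \<theta>\<^sup>2 * sqrt (2 * pi))"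
    by (simp add: power_divide flip: power_mult)
  finally have B: "(1 / (r\<^sup>2 * sqrt (2 * pi))) * (\<integral>x. cmod (char (distr M borel \<xi>) (x / r\<^sup>2)) \<partial>std_normal_distribution)
    \<le> 1 / sqrt (2 * pi * (real (card J) * \<epsilon>\<^sup>2 * \<kappa>)) + \<epsilon>\<^sup>2 / (r ^ 6 * \<theta>\<^sup>2 * sqrt (2 * pi))" .
  have "r\<^sup>2 < r" using \<open>0 < r\<close> \<open>r < 1\<close> by (simp add: power2_eq_square)
  then have "(\<integral>\<^sup>+\<omega>. ennreal (exp (- \<xi> \<omega>)) * indicator {- \<delta>..} (\<xi> \<omega>) \<partial>M)
    \<le> ennreal (exp (2 * r + \<delta>) / (1 - (r\<^sup>2)\<^sup>2 / r\<^sup>2) * (1 / sqrt (2 * pi * (real (card J) * \<epsilon>\<^sup>2 * \<kappa>)) + \<epsilon>\<^sup>2 / (r ^ 6 * \<theta>\<^sup>2 * sqrt (2 * pi))))"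
    using \<open>0 < r\<close> by (intro exp_neg_smoothing \<xi> B) auto
  also have "(r\<^sup>2)\<^sup>2 / r\<^sup>2 = r\<^sup>2" by (simp add: power2_eq_square)
  finally show ?thesis by (simp add: \<xi>_def)
qed

subsection \<open>Positivity of the probabilities\<close>

context iid_seq
begin

lemma prob_ball_sum_add:
  assumes I: "finite I" "finite J" "I \<inter> J = {}"
    and z: "prob {\<omega>\<in>space M. (\<Sum>i\<in>I. X i \<omega>) \<in> ball z d} > 0"
    and z': "prob {\<omega>\<in>space M. (\<Sum>i\<in>J. X i \<omega>) \<in> ball z' d'} > 0"
  shows "prob {\<omega>\<in>space M. (\<Sum>i\<in>I \<union> J. X i \<omega>) \<in> ball (z + z') (d + d')} > 0"
proof -
  have "0 < prob {\<omega>\<in>space M. (\<Sum>i\<in>I. X i \<omega>) \<in> ball z d} * prob {\<omega>\<in>space M. (\<Sum>i\<in>J. X i \<omega>) \<in> ball z' d'}"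
    using z z' by simp
  also have "\<dots> = prob {\<omega>\<in>space M. (\<Sum>i\<in>I. X i \<omega>) \<in> ball z d \<and> (\<Sum>i\<in>J. X i \<omega>) \<in> ball z' d'}"
    using I by (intro prob_sum_inter[symmetric]) auto
  also have "\<dots> \<le> prob {\<omega>\<in>space M. (\<Sum>i\<in>I \<union> J. X i \<omega>) \<in> ball (z + z') (d + d')}"
  proof (rule finite_measure_mono)
    have "dist (z + z') (a + b) < d + d'" if "dist z a < d" "dist z' b < d'" for a b
      using dist_triangle_add[of z z' a b] that by linarith
    then show "{\<omega>\<in>space M. (\<Sum>i\<in>I. X i \<omega>) \<in> ball z d \<and> (\<Sum>i\<in>J. X i \<omega>) \<in> ball z' d'}
      \<subseteq> {\<omega>\<in>space M. (\<Sum>i\<in>I \<union> J. X i \<omega>) \<in> ball (z + z') (d + d')}"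
      using I by (auto simp: sum.union_disjoint)
  qed (simp only: mem_ball, measurable)
  finally show ?thesis .
qed

text \<open>Centre and radius grow by the same factor, so a long sum of independent blocks can be
  steered with a fixed relative precision.\<close>

lemma prob_ball_sum_multiple:
  assumes "prob {\<omega>\<in>space M. (\<Sum>i<m. X i \<omega>) \<in> ball z d} > 0"
  shows "prob {\<omega>\<in>space M. (\<Sum>i<Suc k * m. X i \<omega>) \<in> ball (real (Suc k) *\<^sub>R z) (real (Suc k) * d)} > 0"
proof (induction k)
  case (Suc k)
  have "prob {\<omega>\<in>space M. (\<Sum>i\<in>{Suc k * m..<Suc (Suc k) * m}. X i \<omega>) \<in> ball z d} > 0"
    using assms prob_sum_cong[of "{Suc k * m..<Suc (Suc k) * m}" "{..<m}" "ball z d"] by simp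
  moreover have "{..<Suc k * m} \<inter> {Suc k * m..<Suc (Suc k) * m} = {}" by auto
  ultimately have "prob {\<omega>\<in>space M. (\<Sum>i\<in>{..<Suc k * m} \<union> {Suc k * m..<Suc (Suc k) * m}. X i \<omega>)
    \<in> ball (real (Suc k) *\<^sub>R z + z) (real (Suc k) * d + d)} > 0"
    using Suc by (intro prob_ball_sum_add finite_lessThan finite_atLeastLessThan)
  also have "{..<Suc k * m} \<union> {Suc k * m..<Suc (Suc k) * m} = {..<Suc (Suc k) * m}" by auto
  also have "real (Suc k) *\<^sub>R z + z = (real (Suc k) + 1) *\<^sub>R z" by (simp only: scaleR_add_left scaleR_one)
  also have "real (Suc k) + 1 = real (Suc (Suc k))" by simp
  also have "real (Suc k) * d + d = real (Suc (Suc k)) * d" by (simp add: algebra_simps)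
  finally show ?case .
qed (use assms in simp)

end

context clt_seq
begin

lemma reachable_positive_multiple:
  assumes D: "open D" "convex D" "D \<inter> gen_hilbert \<gamma> \<noteq> {}"
  shows "\<exists>c>0. \<exists>x\<in>D. \<exists>n. \<forall>d>0. prob {\<omega>\<in>space M. (\<Sum>i<n. X i \<omega>) \<in> ball (c *\<^sub>R x) d} > 0"
proof (rule ccontr)
  assume contra: "\<not> ?thesis"
  define R where "R = {y. \<exists>n. \<forall>d>0. prob {\<omega>\<in>space M. (\<Sum>i<n. X i \<omega>) \<in> ball y d} > 0}"
  obtain x F where x: "x \<in> D" "(\<lambda>k. cov_op \<gamma> (F k)) \<longlonglongrightarrow> x"
    using D(3) by (auto simp: gen_hilbert_def)
  \<comment> \<open>As \<open>D\<close> is open, some member of the approximating sequence already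
    lies in it, so the separating functional has to be evaluated only on the range of
    \<open>cov_op\<close>.\<close>
  then have "eventually (\<lambda>k. cov_op \<gamma> (F k) \<in> D) sequentially"
    using topological_tendstoD[OF x(2) D(1)] by simp
  then obtain f where f: "cov_op \<gamma> f \<in> D" by (metis eventually_happens'[OF sequentially_bot])
  have "\<exists>h::'a \<Rightarrow>\<^sub>L real. (\<forall>x\<in>D. h x > 0) \<and> (\<forall>x\<in>R. h x \<le> 0)"
  proof (rule semigroup_separation)
    show "0 \<in> R" by (auto simp: R_def prob_space intro!: exI[of _ 0])
    show "y + z \<in> R" if "y \<in> R" "z \<in> R" for y z
    proof -
      obtain m where m: "\<forall>d>0. prob {\<omega>\<in>space M. (\<Sum>i<m. X i \<omega>) \<in> ball y d} > 0" using \<open>y \<in> R\<close> by (auto simp: R_def)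
      obtain n where n: "\<forall>d>0. prob {\<omega>\<in>space M. (\<Sum>i<n. X i \<omega>) \<in> ball z d} > 0" using \<open>z \<in> R\<close> by (auto simp: R_def)
      have "prob {\<omega>\<in>space M. (\<Sum>i<m+n. X i \<omega>) \<in> ball (y + z) d} > 0" if "d > 0" for d
      proof -
        have "prob {\<omega>\<in>space M. (\<Sum>i\<in>{m..<m+n}. X i \<omega>) \<in> ball z (d/2)} > 0"
          using n[rule_format, of "d/2"] that prob_sum_cong[of "{m..<m+n}" "{..<n}" "ball z (d/2)"] by simp
        moreover have "prob {\<omega>\<in>space M. (\<Sum>i<m. X i \<omega>) \<in> ball y (d/2)} > 0" using m[rule_format, of "d/2"] that by simp
        ultimately have "prob {\<omega>\<in>space M. (\<Sum>i\<in>{..<m} \<union> {m..<m+n}. X i \<omega>) \<in> ball (y + z) (d/2 + d/2)} > 0"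
          by (intro prob_ball_sum_add) auto
        also have "{..<m} \<union> {m..<m+n} = {..<m+n}" by auto
        finally show ?thesis by simp
      qed
      then show ?thesis unfolding R_def by blast
    qed
    show "c *\<^sub>R y \<notin> R" if "c > 0" "y \<in> D" for c y using contra that by (auto simp: R_def)
  qed (use D f in auto)
  then obtain h :: "'a \<Rightarrow>\<^sub>L real" where h: "\<And>x. x \<in> D \<Longrightarrow> h x > 0" "\<And>x. x \<in> R \<Longrightarrow> h x \<le> 0" by blast
  have opn: "open {x. h x > 0}" by (intro open_Collect_less continuous_intros)
  \<comment> \<open>An open set of positive measure contains a support point of
    \<open>\<mu>\<close>, and support points are reachable by a single summand.\<close>
  have null: "emeasure \<mu> {x. h x > 0} = 0"
  proof (rule ccontr)
    assume "emeasure \<mu> {x. h x > 0} \<noteq> 0"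
    then obtain y where y: "h y > 0" "\<And>d. d > 0 \<Longrightarrow> emeasure \<mu> (ball y d) \<noteq> 0"
      using open_positive_imp_support_point[OF sets_law opn] by auto
    have "prob {\<omega>\<in>space M. (\<Sum>i<1. X i \<omega>) \<in> ball y d} > 0" if "d > 0" for d
    proof -
      have "emeasure \<mu> (ball y d) = emeasure M {\<omega>\<in>space M. (\<Sum>i<1. X i \<omega>) \<in> ball y d}"
        unfolding law[of 0, symmetric] by (subst emeasure_distr) (auto intro!: arg_cong[where f="emeasure M"])
      then show ?thesis using y(2)[OF that] by (simp add: emeasure_eq_measure zero_less_measure_iff)
    qed
    then have "y \<in> R" unfolding R_def by blast
    then show False using h(2) y(1) by fastforce
  qed
  have "{x. h x > 0} \<in> sets \<mu>" using opn by simp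
  then have "AE x in \<mu>. \<not> h x > 0" using null by (intro AE_I[of _ _ "{x. h x > 0}"]) auto
  then have "AE x in \<mu>. 0 \<le> - h x" by eventually_elim simp
  moreover have "integrable \<mu> (\<lambda>x. - h x)" using integrable_functional[of h] by simp
  moreover have "(\<integral>x. - h x \<partial>\<mu>) = 0" using mean_functional_zero[of h] by simp
  ultimately have "AE x in \<mu>. - h x = 0" using integral_nonneg_eq_0_iff_AE by blast
  then have "var h = (\<integral>x. 0 \<partial>\<mu>)" unfolding var_def by (intro integral_cong_AE) (auto elim!: eventually_mono)
  then have "h (cov_op \<gamma> f) = 0" by (intro functional_cov_op_zero) simp
  then show False using h(1)[OF f] by simp
qed

text \<open>About \<open>b n / c\<close> blocks of length \<open>n1\<close> bring the sum close to
  \<open>b n *\<^sub>R x\<close>; they fit into \<open>n\<close> steps because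
  \<open>b n / n\<close> tends to 0. The remaining steps stay within order \<open>sqrt n\<close>
  with probability at least 3/4, which is negligible on the scale \<open>b n\<close>.\<close>

lemma eventually_prob_positive:
  assumes D: "open D" "convex D" "D \<inter> gen_hilbert \<gamma> \<noteq> {}"
    and b: "filterlim (\<lambda>n. b n / sqrt (real n)) at_top sequentially" "(\<lambda>n. b n / real n) \<longlonglongrightarrow> 0"
  shows "eventually (\<lambda>n. prob {\<omega>\<in>space M. (1 / b n) *\<^sub>R (\<Sum>i<n. X i \<omega>) \<in> D} > 0) sequentially"
proof -
  obtain c x n1 where c: "c > 0" and x: "x \<in> D"
    and n1: "\<And>d. d > 0 \<Longrightarrow> prob {\<omega>\<in>space M. (\<Sum>i<n1. X i \<omega>) \<in> ball (c *\<^sub>R x) d} > 0"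
    using reachable_positive_multiple[OF D] by blast
  obtain e where e: "e > 0" "ball x e \<subseteq> D" using D(1) x by (meson open_contains_ball)
  obtain K where K: "K > 0" "\<And>n. prob {\<omega>\<in>space M. norm (\<Sum>i<n. X i \<omega>) > K * sqrt (real n)} \<le> 1 / 4"
    using tight by blast
  \<comment> \<open>The multiple of \<open>1 / e\<close> keeps the norm bound for the remaining
    steps and the rounding error \<open>c * norm x\<close> together below a quarter of
    \<open>b n * e\<close>; the extra \<open>c\<close> ensures that \<open>b n\<close> is at least
    \<open>c\<close>, so that there is at least one block.\<close>
  have "eventually (\<lambda>n. b n / sqrt (real n) \<ge> 4 * (K + 1 + c * norm x) / e + c) sequentially"
    using b(1) by (simp add: filterlim_at_top)
  moreover have "eventually (\<lambda>n. b n / real n < c / (real n1 + 1)) sequentially"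
    using order_tendstoD(2)[OF b(2)] c by simp
  moreover have "eventually (\<lambda>n. n \<ge> (1::nat)) sequentially" by (rule eventually_ge_at_top)
  ultimately show ?thesis
  proof eventually_elim
    case (elim n)
    define A where "A = K + 1 + c * norm x"
    have A: "A > 0" using K c by (simp add: A_def add_pos_nonneg)
    have sn: "sqrt (real n) \<ge> 1" using elim by simp
    have "4 * A / e + c \<le> b n / sqrt (real n)" using elim by (simp add: A_def)
    then have bn: "(4 * A / e + c) * sqrt (real n) \<le> b n" using sn by (simp add: pos_le_divide_eq)
    have q: "4 * A / e > 0" using A e by simp
    have "c * 1 \<le> (4 * A / e + c) * sqrt (real n)" using q c sn by (intro mult_mono) auto
    then have bc: "b n \<ge> c" using bn by simp
    then have b0: "b n > 0" using c by simp
    have "(4 * A / e) * sqrt (real n) \<le> (4 * A / e + c) * sqrt (real n)" using c by (intro mult_right_mono) auto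
    then have bA: "A * sqrt (real n) \<le> b n * e / 4" using bn e by (simp add: field_simps)
    define k where "k = nat \<lfloor>b n / c\<rfloor>"
    have k: "real k \<le> b n / c" "b n / c < real k + 1"
      using b0 c unfolding k_def by (auto simp: of_nat_nat intro: less_imp_le)
    have "k \<ge> 1" using bc c unfolding k_def by (simp add: le_nat_iff le_floor_iff)
    then obtain k' where k': "k = Suc k'" by (cases k) auto
    have "real (k * n1) \<le> b n / c * real n1" using mult_right_mono[OF k(1), of "real n1"] by simp
    also have "\<dots> \<le> b n / c * (real n1 + 1)" using b0 c by (intro mult_left_mono) auto
    also have "\<dots> \<le> real n" using elim c by (simp add: field_simps)
    finally have kn: "k * n1 \<le> n" by (simp only: of_nat_le_iff)
    \<comment> \<open>With this precision for each block, all \<open>k\<close> blocks together miss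
      their target by at most \<open>b n * e / 4\<close>.\<close>
    have "c * e / 4 > 0" using c e by simp
    from prob_ball_sum_multiple[OF n1[OF this], of k']
    have 1: "prob {\<omega>\<in>space M. (\<Sum>i<k * n1. X i \<omega>) \<in> ball (real k *\<^sub>R c *\<^sub>R x) (real k * (c * e / 4))} > 0"
      unfolding k' .
    have 2: "prob {\<omega>\<in>space M. (\<Sum>i\<in>{k * n1..<n}. X i \<omega>) \<in> ball 0 (K * sqrt (real n) + 1)} > 0"
    proof -
      let ?m = "n - k * n1"
      have le: "K * sqrt (real ?m) < K * sqrt (real n) + 1"
      proof -
        have "sqrt (real ?m) \<le> sqrt (real n)" by simp
        from mult_left_mono[OF this less_imp_le[OF K(1)]] show ?thesis by linarith
      qed
      have "3 / 4 \<le> 1 - prob {\<omega>\<in>space M. norm (\<Sum>i<?m. X i \<omega>) > K * sqrt (real ?m)}" using K(2)[of ?m] by simp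
      also have "\<dots> = prob (space M - {\<omega>\<in>space M. norm (\<Sum>i<?m. X i \<omega>) > K * sqrt (real ?m)})"
        by (rule prob_compl[symmetric]) measurable
      also have "\<dots> \<le> prob {\<omega>\<in>space M. (\<Sum>i<?m. X i \<omega>) \<in> ball 0 (K * sqrt (real n) + 1)}"
        using le by (intro finite_measure_mono) auto
      also have "\<dots> = prob {\<omega>\<in>space M. (\<Sum>i\<in>{k * n1..<n}. X i \<omega>) \<in> ball 0 (K * sqrt (real n) + 1)}"
        by (rule prob_sum_cong) auto
      finally show ?thesis by simp
    qed
    have "0 < prob {\<omega>\<in>space M. (\<Sum>i\<in>{..<k * n1} \<union> {k * n1..<n}. X i \<omega>)
        \<in> ball (real k *\<^sub>R c *\<^sub>R x + 0) (real k * (c * e / 4) + (K * sqrt (real n) + 1))}"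
      by (rule prob_ball_sum_add[OF _ _ _ 1 2]) auto
    also have "{..<k * n1} \<union> {k * n1..<n} = {..<n}" using kn by auto
    also have "prob {\<omega>\<in>space M. (\<Sum>i<n. X i \<omega>) \<in> ball (real k *\<^sub>R c *\<^sub>R x + 0) (real k * (c * e / 4) + (K * sqrt (real n) + 1))}
        \<le> prob {\<omega>\<in>space M. (1 / b n) *\<^sub>R (\<Sum>i<n. X i \<omega>) \<in> D}"
    proof (rule finite_measure_mono)
      have "(1 / b n) *\<^sub>R s \<in> D" if "dist (real k *\<^sub>R c *\<^sub>R x) s < real k * (c * e / 4) + (K * sqrt (real n) + 1)" for s
      proof -
        have kc: "real k * c \<le> b n" "b n - real k * c \<le> c" using k c by (auto simp: field_simps)
        have "norm (b n *\<^sub>R x - s) \<le> norm (b n *\<^sub>R x - (real k * c) *\<^sub>R x) + norm ((real k * c) *\<^sub>R x - s)"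
          by (metis diff_add_cancel add_diff_eq norm_triangle_ineq)
        also have "norm (b n *\<^sub>R x - (real k * c) *\<^sub>R x) = (b n - real k * c) * norm x"
          using kc by (simp flip: scaleR_diff_left)
        also have "\<dots> \<le> c * norm x" using kc by (intro mult_right_mono) auto
        also have "norm ((real k * c) *\<^sub>R x - s) < real k * (c * e / 4) + (K * sqrt (real n) + 1)"
          using that by (simp add: dist_norm)
        also have "real k * (c * e / 4) \<le> b n * e / 4" using kc e mult_right_mono[of "real k * c" "b n" "e/4"] by simp
        finally have "norm (b n *\<^sub>R x - s) < c * norm x + (b n * e / 4 + (K * sqrt (real n) + 1))" by simp
        also have "\<dots> \<le> b n * e / 4 + A * sqrt (real n)"
          using sn c mult_left_mono[OF sn, of "1 + c * norm x"] by (simp add: A_def algebra_simps)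
        also have "\<dots> < b n * e" using bA mult_pos_pos[OF b0 e(1)] by linarith
        finally have "norm (b n *\<^sub>R x - s) < b n * e" .
        moreover have "b n *\<^sub>R x - s = b n *\<^sub>R (x - (1 / b n) *\<^sub>R s)" using b0 by (simp add: scaleR_diff_right)
        ultimately have "b n * norm (x - (1 / b n) *\<^sub>R s) < b n * e" using b0 by simp
        then have "(1 / b n) *\<^sub>R s \<in> ball x e" using b0 by (simp add: dist_norm)
        then show ?thesis using e by blast
      qed
      then show "{\<omega>\<in>space M. (\<Sum>i<n. X i \<omega>) \<in> ball (real k *\<^sub>R c *\<^sub>R x + 0) (real k * (c * e / 4) + (K * sqrt (real n) + 1))}
        \<subseteq> {\<omega>\<in>space M. (1 / b n) *\<^sub>R (\<Sum>i<n. X i \<omega>) \<in> D}" by auto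
      have [measurable]: "D \<in> sets borel" using D(1) by simp
      show "{\<omega>\<in>space M. (1 / b n) *\<^sub>R (\<Sum>i<n. X i \<omega>) \<in> D} \<in> events" by measurable
    qed
    finally show ?case .
  qed
qed

end

subsection \<open>The moderate deviation asymptotics\<close>

lemma iid_with_law_integral:
  fixes F :: "'a::{banach, second_countable_topology} \<Rightarrow> 'b::{banach, second_countable_topology}"
  assumes Z: "iid_with_law N \<nu> I Z" "i \<in> I" and F[measurable]: "F \<in> borel_measurable borel"
  shows "integrable N (\<lambda>\<omega>. F (Z i \<omega>)) \<longleftrightarrow> integrable \<nu> F" "(\<integral>\<omega>. F (Z i \<omega>) \<partial>N) = (\<integral>x. F x \<partial>\<nu>)"
proof -
  have \<nu>: "\<nu> = distr N borel (Z i)" using Z by (auto simp: iid_with_law_def)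
  have [measurable]: "Z i \<in> borel_measurable N" by (rule iid_with_law_rv[OF Z])
  show "integrable N (\<lambda>\<omega>. F (Z i \<omega>)) \<longleftrightarrow> integrable \<nu> F" "(\<integral>\<omega>. F (Z i \<omega>) \<partial>N) = (\<integral>x. F x \<partial>\<nu>)"
    unfolding \<nu> by (auto simp: integrable_distr_eq integral_distr)
qed

section \<open>The exact tilted representation and the bound for its expectation\<close>

context clt_seq
begin

lemma iid: "iid_with_law M \<mu> UNIV X"
  using prob_space_axioms indep law by (simp add: iid_with_law_def)

text \<open>The change of measure leaves the factor
  \<open>mgf (\<epsilon> *\<^sub>R g) ^ n * exp (- \<epsilon> * g s)\<close> with \<open>s\<close>
  the sum; centring \<open>\<epsilon> * g s\<close> at its mean \<open>n * \<epsilon> * m\<close>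
  turns it into a constant times \<open>exp (- \<xi>)\<close>. Since
  \<open>\<epsilon> = \<beta> / n\<close>, membership of \<open>\<epsilon> s\<close> in the dilated
  set means that \<open>s / \<beta>\<close> lies in \<open>D\<close>. The half-space containing
  \<open>D\<close> bounds \<open>\<xi>\<close> below, which makes \<open>W\<close> bounded and gives
  the last inequality.\<close>

lemma tilted_representation:
  fixes g :: "'a \<Rightarrow>\<^sub>L real" and Q :: "'v measure" and Z :: "nat \<Rightarrow> 'v \<Rightarrow> 'a" and \<beta> v :: real
  assumes n: "n \<ge> 1" and \<beta>: "\<beta> > 0" and \<epsilon>: "\<epsilon> = \<beta> / real n"
    and int: "integrable \<mu> (\<lambda>x. exp ((\<epsilon> *\<^sub>R g) x))" "integrable (tilted \<mu> (\<epsilon> *\<^sub>R g)) (\<lambda>x. x)"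
    and Z: "iid_with_law Q (tilted \<mu> (\<epsilon> *\<^sub>R g)) {0..n} Z"
    and D: "open D" "D \<subseteq> {x. g x \<ge> v}"
    and T: "T = (\<lambda>\<omega>. \<epsilon> *\<^sub>R (\<Sum>j=1..n. Z j \<omega>))"
    and W: "W = (\<lambda>\<omega>. exp (- g (T \<omega> - (\<integral>\<omega>'. T \<omega>' \<partial>Q))) * indicator ((\<lambda>x. (\<beta>\<^sup>2 / real n) *\<^sub>R x) ` D) (T \<omega>))"
    and m: "m = (\<integral>x. g x \<partial>tilted \<mu> (\<epsilon> *\<^sub>R g))"
  shows "integrable Q (Z 0)" "(\<integral>\<omega>. Z 0 \<omega> \<partial>Q) = (\<integral>x. x \<partial>tilted \<mu> (\<epsilon> *\<^sub>R g))" "integrable Q T" "integrable Q W"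
    "0 \<le> (\<integral>\<omega>. W \<omega> \<partial>Q)"
    "prob {\<omega>\<in>space M. (1 / \<beta>) *\<^sub>R (\<Sum>j=1..n. X j \<omega>) \<in> D}
      = exp (real n * ln (mgf (\<epsilon> *\<^sub>R g)) - real n * \<epsilon> * m) * (\<integral>\<omega>. W \<omega> \<partial>Q)"
    "ennreal (\<integral>\<omega>. W \<omega> \<partial>Q) \<le> (\<integral>\<^sup>+\<omega>. ennreal (exp (- (\<epsilon> * (\<Sum>j\<in>{1..n}. g (Z j \<omega>) - m)))) *
      indicator {- (real n * \<epsilon> * (m - \<epsilon> * v))..} (\<epsilon> * (\<Sum>j\<in>{1..n}. g (Z j \<omega>) - m)) \<partial>Q)"
proof -
  interpret Q: prob_space Q using Z by (simp add: iid_with_law_def)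
  have rv[measurable]: "Z j \<in> borel_measurable Q" if "j \<in> {0..n}" for j by (rule iid_with_law_rv[OF Z that])
  have n0: "real n > 0" using n by simp
  have \<epsilon>0: "\<epsilon> > 0" using n \<beta> by (simp add: \<epsilon>)
  have \<beta>\<epsilon>: "\<beta> = real n * \<epsilon>" using n by (simp add: \<epsilon>)
  note L = tilted_integral(1,2)[OF int(1)]
  have meas_id: "(\<lambda>x::'a. x) \<in> borel_measurable borel" by simp
  have id: "integrable Q (Z j)" "(\<integral>\<omega>. Z j \<omega> \<partial>Q) = (\<integral>x. x \<partial>tilted \<mu> (\<epsilon> *\<^sub>R g))" if "j \<in> {0..n}" for j
    by (rule iid_with_law_integral(1)[OF Z that meas_id, THEN iffD2, OF int(2)])
      (rule iid_with_law_integral(2)[OF Z that meas_id])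
  show "integrable Q (Z 0)" "(\<integral>\<omega>. Z 0 \<omega> \<partial>Q) = (\<integral>x. x \<partial>tilted \<mu> (\<epsilon> *\<^sub>R g))" using id[of 0] by auto
  show iT: "integrable Q T" unfolding T by (intro integrable_scaleR_right Bochner_Integration.integrable_sum id) auto
  have [measurable]: "T \<in> borel_measurable Q" using iT by auto
  have "(\<integral>\<omega>. T \<omega> \<partial>Q) = \<epsilon> *\<^sub>R (real n *\<^sub>R (\<integral>x. x \<partial>tilted \<mu> (\<epsilon> *\<^sub>R g)))"
    unfolding T using id by (subst integral_scaleR_right, subst Bochner_Integration.integral_sum) (auto simp: sum_constant_scaleR)
  moreover have "g (\<integral>x. x \<partial>tilted \<mu> (\<epsilon> *\<^sub>R g)) = m"
    unfolding m by (rule integral_bounded_linear[OF blinfun.bounded_linear_right int(2), symmetric])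
  ultimately have gET: "g (\<integral>\<omega>. T \<omega> \<partial>Q) = real n * \<epsilon> * m" by (simp add: blinfun.scaleR_right)
  define s where "s \<omega> = (\<Sum>j\<in>{1..n}. Z j \<omega>)" for \<omega>
  have [measurable]: "s \<in> borel_measurable Q" unfolding s_def by (intro borel_measurable_sum rv) auto
  have Ts: "T \<omega> = \<epsilon> *\<^sub>R s \<omega>" for \<omega> by (simp add: T s_def)
  define \<xi> where "\<xi> \<omega> = \<epsilon> * (\<Sum>j\<in>{1..n}. g (Z j \<omega>) - m)" for \<omega>
  have \<xi>: "\<xi> \<omega> = \<epsilon> * g (s \<omega>) - real n * \<epsilon> * m" for \<omega>
    by (simp add: \<xi>_def s_def blinfun.sum_right sum_subtractf algebra_simps)
  have ind: "indicator ((\<lambda>x. (\<beta>\<^sup>2 / real n) *\<^sub>R x) ` D) (T \<omega>) = (indicator D ((1 / \<beta>) *\<^sub>R s \<omega>) :: real)" for \<omega>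
  proof -
    have c: "\<beta>\<^sup>2 / real n > 0" using \<beta> n0 by simp
    have eq: "T \<omega> = (\<beta>\<^sup>2 / real n) *\<^sub>R ((1 / \<beta>) *\<^sub>R s \<omega>)"
      using \<beta> by (simp add: Ts \<epsilon> power2_eq_square)
    have "T \<omega> \<in> (\<lambda>x. (\<beta>\<^sup>2 / real n) *\<^sub>R x) ` D \<longleftrightarrow> (1 / \<beta>) *\<^sub>R s \<omega> \<in> D"
      unfolding eq using c by (subst inj_image_mem_iff) (auto simp: inj_on_def)
    then show ?thesis by (simp split: split_indicator)
  qed
  have W\<xi>: "W \<omega> = exp (- \<xi> \<omega>) * indicator D ((1 / \<beta>) *\<^sub>R s \<omega>)" for \<omega>
    unfolding W ind by (simp add: \<xi> blinfun.diff_right gET Ts blinfun.scaleR_right)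
  have [measurable]: "D \<in> sets borel" using D by simp
  have [measurable]: "blinfun_apply g \<in> borel_measurable borel" by simp
  have [measurable]: "\<xi> \<in> borel_measurable Q" unfolding \<xi> by measurable
  have [measurable]: "W \<in> borel_measurable Q" unfolding W\<xi> by measurable
  \<comment> \<open>\<open>- \<delta>\<close> is the value of \<open>\<xi>\<close> on the hyperplane
    bounding the half-space. When \<open>v\<close> is the variance of \<open>g\<close>, the
    expansion of \<open>m\<close> makes it of order n \<epsilon>^3.\<close>
  define \<delta> where "\<delta> = real n * \<epsilon> * (m - \<epsilon> * v)"
  have \<xi>\<delta>: "\<xi> \<omega> \<ge> - \<delta>" if "(1 / \<beta>) *\<^sub>R s \<omega> \<in> D" for \<omega>
  proof -
    have "v \<le> g ((1 / \<beta>) *\<^sub>R s \<omega>)" using D that by auto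
    then have "\<beta> * v \<le> g (s \<omega>)" using \<beta> by (simp add: blinfun.scaleR_right field_simps)
    then have "\<epsilon> * (\<beta> * v) \<le> \<epsilon> * g (s \<omega>)" using \<epsilon>0 by (intro mult_left_mono) auto
    then show ?thesis by (simp add: \<xi> \<delta>_def \<beta>\<epsilon> algebra_simps)
  qed
  have W0: "W \<omega> \<ge> 0" for \<omega> by (simp add: W\<xi>)
  show iW: "integrable Q W"
    using \<xi>\<delta> by (intro Q.integrable_const_bound[where B="exp \<delta>"] AE_I2) (auto simp: W\<xi> split: split_indicator intro: minus_le_iff[THEN iffD1])
  show "0 \<le> (\<integral>\<omega>. W \<omega> \<partial>Q)" using W0 by (intro integral_nonneg_AE) auto
  have nnW: "ennreal (\<integral>\<omega>. W \<omega> \<partial>Q) = (\<integral>\<^sup>+\<omega>. ennreal (W \<omega>) \<partial>Q)"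
    using iW W0 by (intro nn_integral_eq_integral[symmetric]) auto
  also have "\<dots> \<le> (\<integral>\<^sup>+\<omega>. ennreal (exp (- \<xi> \<omega>)) * indicator {- \<delta>..} (\<xi> \<omega>) \<partial>Q)"
    using \<xi>\<delta> by (intro nn_integral_mono) (auto simp: W\<xi> split: split_indicator)
  finally show "ennreal (\<integral>\<omega>. W \<omega> \<partial>Q) \<le> (\<integral>\<^sup>+\<omega>. ennreal (exp (- (\<epsilon> * (\<Sum>j\<in>{1..n}. g (Z j \<omega>) - m)))) *
      indicator {- (real n * \<epsilon> * (m - \<epsilon> * v))..} (\<epsilon> * (\<Sum>j\<in>{1..n}. g (Z j \<omega>) - m)) \<partial>Q)"
    by (simp add: \<xi>_def \<delta>_def)
  define c where "c = exp (real n * ln (mgf (\<epsilon> *\<^sub>R g)) - real n * \<epsilon> * m)"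
  have c: "mgf (\<epsilon> *\<^sub>R g) ^ n * exp (- (\<epsilon> *\<^sub>R g) x) = c * exp (- (\<epsilon> * g x - real n * \<epsilon> * m))" for x
  proof -
    have "mgf (\<epsilon> *\<^sub>R g) ^ n = exp (real n * ln (mgf (\<epsilon> *\<^sub>R g)))" using L(2) by (simp add: exp_of_nat_mult)
    then show ?thesis by (simp add: c_def blinfun.scaleR_left flip: exp_add)
  qed
  have "ennreal (prob {\<omega>\<in>space M. (1 / \<beta>) *\<^sub>R (\<Sum>j=1..n. X j \<omega>) \<in> D})
    = (\<integral>\<^sup>+\<omega>. indicator {\<omega>\<in>space M. (1 / \<beta>) *\<^sub>R (\<Sum>j=1..n. X j \<omega>) \<in> D} \<omega> \<partial>M)"
    by (subst nn_integral_indicator) (auto simp: emeasure_eq_measure)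
  also have "\<dots> = (\<integral>\<^sup>+\<omega>. indicator D ((1 / \<beta>) *\<^sub>R (\<Sum>j\<in>{1..n}. X j \<omega>)) \<partial>M)"
    by (intro nn_integral_cong) (auto split: split_indicator)
  also have "\<dots> = (\<integral>\<^sup>+\<omega>. ennreal (mgf (\<epsilon> *\<^sub>R g) ^ card {1..n} * exp (- (\<epsilon> *\<^sub>R g) (\<Sum>j\<in>{1..n}. Z j \<omega>))) *
      indicator D ((1 / \<beta>) *\<^sub>R (\<Sum>j\<in>{1..n}. Z j \<omega>)) \<partial>Q)"
    using n L by (intro change_of_measure_sum[OF iid Z, where F="\<lambda>x. indicator D ((1 / \<beta>) *\<^sub>R x)"]) auto
  also have "\<dots> = (\<integral>\<^sup>+\<omega>. ennreal c * ennreal (W \<omega>) \<partial>Q)"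
  proof (rule nn_integral_cong)
    fix \<omega>
    have "mgf (\<epsilon> *\<^sub>R g) ^ card {1..n} * exp (- (\<epsilon> *\<^sub>R g) (s \<omega>)) = c * exp (- \<xi> \<omega>)"
      using c[of "s \<omega>"] by (simp add: \<xi>)
    then show "ennreal (mgf (\<epsilon> *\<^sub>R g) ^ card {1..n} * exp (- (\<epsilon> *\<^sub>R g) (\<Sum>j\<in>{1..n}. Z j \<omega>))) *
      indicator D ((1 / \<beta>) *\<^sub>R (\<Sum>j\<in>{1..n}. Z j \<omega>)) = ennreal c * ennreal (W \<omega>)"
      unfolding s_def[symmetric] W\<xi> by (simp add: c_def ennreal_mult split: split_indicator)
  qed
  also have "\<dots> = ennreal c * ennreal (\<integral>\<omega>. W \<omega> \<partial>Q)" unfolding nnW by (rule nn_integral_cmult) measurable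
  also have "\<dots> = ennreal (c * (\<integral>\<omega>. W \<omega> \<partial>Q))" by (simp add: c_def ennreal_mult')
  finally have "ennreal (prob {\<omega>\<in>space M. (1 / \<beta>) *\<^sub>R (\<Sum>j=1..n. X j \<omega>) \<in> D}) = ennreal (c * (\<integral>\<omega>. W \<omega> \<partial>Q))" .
  then show "prob {\<omega>\<in>space M. (1 / \<beta>) *\<^sub>R (\<Sum>j=1..n. X j \<omega>) \<in> D}
      = exp (real n * ln (mgf (\<epsilon> *\<^sub>R g)) - real n * \<epsilon> * m) * (\<integral>\<omega>. W \<omega> \<partial>Q)"
    using \<open>0 \<le> (\<integral>\<omega>. W \<omega> \<partial>Q)\<close> by (subst (asm) ennreal_inj) (auto simp: c_def)
qed

text \<open>Supplies the centred moments of \<open>g\<close> under the tilted law to the general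
  estimate; the factor 4 in the condition on \<open>C\<close> comes from bounding the cube of a sum
  by four times the sum of the cubes.\<close>

lemma tilted_sum_bound:
  fixes g :: "'a \<Rightarrow>\<^sub>L real" and Q :: "'v measure" and Z :: "nat \<Rightarrow> 'v \<Rightarrow> 'a"
  assumes n: "n \<ge> 1" and \<epsilon>: "0 < \<epsilon>"
    and Z: "iid_with_law Q \<nu> {0..n} Z"
    and int: "\<And>k. integrable \<nu> (\<lambda>x. g x ^ k)"
    and m: "m = (\<integral>x. g x \<partial>\<nu>)" and w: "w = (\<integral>x. (g x)\<^sup>2 \<partial>\<nu>) - m\<^sup>2"
    and C: "4 * ((\<integral>x. \<bar>g x\<bar> ^ 3 \<partial>\<nu>) + \<bar>m\<bar> ^ 3) \<le> C"
    and \<theta>: "\<theta> > 0" "\<theta> * C \<le> 3 * (w - \<kappa>)" "\<theta>\<^sup>2 * w \<le> 2" "w \<ge> 0" "\<kappa> > 0" and r: "0 < r" "r < 1"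
  shows "(\<integral>\<^sup>+\<omega>. ennreal (exp (- (\<epsilon> * (\<Sum>j\<in>{1..n}. g (Z j \<omega>) - m)))) *
      indicator {- \<delta>..} (\<epsilon> * (\<Sum>j\<in>{1..n}. g (Z j \<omega>) - m)) \<partial>Q)
    \<le> ennreal (exp (2 * r + \<delta>) / (1 - r\<^sup>2) *
        (1 / sqrt (2 * pi * (real n * \<epsilon>\<^sup>2 * \<kappa>)) + \<epsilon>\<^sup>2 / (r ^ 6 * \<theta>\<^sup>2 * sqrt (2 * pi))))"
proof -
  interpret Q: prob_space Q using Z by (simp add: iid_with_law_def)
  have \<nu>: "\<nu> = distr Q borel (Z 0)" using Z by (auto simp: iid_with_law_def)
  have [measurable]: "Z 0 \<in> borel_measurable Q" by (rule iid_with_law_rv[OF Z]) simp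
  interpret \<nu>: prob_space \<nu> unfolding \<nu> by (rule Q.prob_space_distr) simp
  have [measurable_cong]: "sets \<nu> = sets borel" by (simp add: \<nu>)
  have iabs: "integrable \<nu> (\<lambda>x. \<bar>g x\<bar> ^ 3)" using integrable_abs[OF int[of 3]] by (simp add: power_abs)
  have i1: "integrable \<nu> (blinfun_apply g)" using int[of 1] by simp
  have cube: "\<bar>a - b\<bar> ^ 3 \<le> 4 * (\<bar>a\<bar> ^ 3 + \<bar>b\<bar> ^ 3)" for a b :: real
  proof -
    have "\<bar>a - b\<bar> ^ 3 \<le> (\<bar>a\<bar> + \<bar>b\<bar>) ^ 3" by (intro power_mono abs_triangle_ineq4) auto
    also have "\<dots> \<le> 4 * (\<bar>a\<bar> ^ 3 + \<bar>b\<bar> ^ 3)"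
    proof -
      have "4 * (x ^ 3 + y ^ 3) - (x + y) ^ 3 = 3 * ((x + y) * (x - y)\<^sup>2)" for x y :: real
        by (simp add: power2_eq_square power3_eq_cube algebra_simps)
      then have "4 * (\<bar>a\<bar> ^ 3 + \<bar>b\<bar> ^ 3) - (\<bar>a\<bar> + \<bar>b\<bar>) ^ 3 = 3 * ((\<bar>a\<bar> + \<bar>b\<bar>) * (\<bar>a\<bar> - \<bar>b\<bar>)\<^sup>2)" .
      moreover have "3 * ((\<bar>a\<bar> + \<bar>b\<bar>) * (\<bar>a\<bar> - \<bar>b\<bar>)\<^sup>2) \<ge> 0" by simp
      ultimately show ?thesis by linarith
    qed
    finally show ?thesis .
  qed
  have I3: "integrable \<nu> (\<lambda>x. 4 * (\<bar>g x\<bar> ^ 3 + \<bar>m\<bar> ^ 3))" using iabs by simp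
  have J3: "integrable \<nu> (\<lambda>x. \<bar>g x - m\<bar> ^ 3)"
    using cube by (intro Bochner_Integration.integrable_bound[OF I3]) (auto simp: power_abs)
  have E3: "(\<integral>x. \<bar>g x - m\<bar> ^ 3 \<partial>\<nu>) \<le> C"
  proof -
    have "(\<integral>x. \<bar>g x - m\<bar> ^ 3 \<partial>\<nu>) \<le> (\<integral>x. 4 * (\<bar>g x\<bar> ^ 3 + \<bar>m\<bar> ^ 3) \<partial>\<nu>)"
      by (intro integral_mono J3 I3 cube)
    also have "\<dots> = 4 * ((\<integral>x. \<bar>g x\<bar> ^ 3 \<partial>\<nu>) + \<bar>m\<bar> ^ 3)" using iabs \<nu>.prob_space by simp
    finally show ?thesis using C by linarith
  qed
  have sq: "(\<lambda>x. (g x - m)\<^sup>2) = (\<lambda>x. (g x)\<^sup>2 - 2 * m * g x + m\<^sup>2)" by (auto simp: power2_eq_square algebra_simps)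
  have J2: "integrable \<nu> (\<lambda>x. (g x - m)\<^sup>2)" unfolding sq using int[of 2] i1 by simp
  have E2: "(\<integral>x. (g x - m)\<^sup>2 \<partial>\<nu>) = w"
    unfolding sq using int[of 2] i1 \<nu>.prob_space by (simp add: w m power2_eq_square)
  have J1: "integrable \<nu> (\<lambda>x. g x - m)" and E1: "(\<integral>x. g x - m \<partial>\<nu>) = 0"
    using i1 \<nu>.prob_space by (auto simp: m)
  have C0: "C \<ge> 0" using E3 by (rule order_trans[rotated]) (intro integral_nonneg_AE, auto)
  have tr: "integrable Q (\<lambda>\<omega>. F (Z j \<omega>)) \<longleftrightarrow> integrable \<nu> F" "(\<integral>\<omega>. F (Z j \<omega>) \<partial>Q) = (\<integral>x. F x \<partial>\<nu>)"
    if "j \<in> {1..n}" "F \<in> borel_measurable borel" for j and F :: "'a \<Rightarrow> real"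
    using iid_with_law_integral[OF Z, of j F] that by auto
  have "Q.indep_vars (\<lambda>_. borel) Z {0..n}" using Z by (simp add: iid_with_law_def)
  then have "Q.indep_vars (\<lambda>_. borel) Z {1..n}" by (rule Q.indep_vars_subset) auto
  then have ind: "Q.indep_vars (\<lambda>_. borel) (\<lambda>j \<omega>. g (Z j \<omega>) - m) {1..n}"
    by (rule Q.indep_vars_compose2) simp
  have "(\<integral>\<^sup>+\<omega>. ennreal (exp (- (\<epsilon> * (\<Sum>j\<in>{1..n}. g (Z j \<omega>) - m)))) *
      indicator {- \<delta>..} (\<epsilon> * (\<Sum>j\<in>{1..n}. g (Z j \<omega>) - m)) \<partial>Q)
    \<le> ennreal (exp (2 * r + \<delta>) / (1 - r\<^sup>2) *
        (1 / sqrt (2 * pi * (real (card {1..n}) * \<epsilon>\<^sup>2 * \<kappa>)) + \<epsilon>\<^sup>2 / (r ^ 6 * \<theta>\<^sup>2 * sqrt (2 * pi))))"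
  proof (rule Q.exp_neg_sum_bound[where w=w and C=C])
    fix j assume j: "j \<in> {1..n}"
    show "integrable Q (\<lambda>\<omega>. g (Z j \<omega>) - m)" "(\<integral>\<omega>. g (Z j \<omega>) - m \<partial>Q) = 0"
      using tr[OF j, of "\<lambda>x. g x - m"] J1 E1 by auto
    show "integrable Q (\<lambda>\<omega>. (g (Z j \<omega>) - m)\<^sup>2)" "(\<integral>\<omega>. (g (Z j \<omega>) - m)\<^sup>2 \<partial>Q) = w"
      using tr[OF j, of "\<lambda>x. (g x - m)\<^sup>2"] J2 E2 by auto
    show "integrable Q (\<lambda>\<omega>. \<bar>g (Z j \<omega>) - m\<bar> ^ 3)" "(\<integral>\<omega>. \<bar>g (Z j \<omega>) - m\<bar> ^ 3 \<partial>Q) \<le> C"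
      using tr[OF j, of "\<lambda>x. \<bar>g x - m\<bar> ^ 3"] J3 E3 by auto
  qed (use n \<epsilon> \<theta> r C0 ind in auto)
  then show ?thesis by simp
qed

end

theorem theorem1:
  fixes M :: "'w measure"
    and X :: "nat \<Rightarrow> 'w \<Rightarrow> 'a::{banach, second_countable_topology}"
    and S :: "nat \<Rightarrow> 'w \<Rightarrow> 'a"
    and \<mu> \<gamma> :: "'a measure"
    and b :: "nat \<Rightarrow> real"
    and D :: "'a set" and a0 :: 'a and g :: "'a \<Rightarrow>\<^sub>L real"
    and N :: "nat \<Rightarrow> 'v measure"
    and Z :: "nat \<Rightarrow> nat \<Rightarrow> 'v \<Rightarrow> 'a"
    and T :: "nat \<Rightarrow> 'v \<Rightarrow> 'a"
    and \<sigma>sq :: real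
  assumes iid: "iid_with_law M \<mu> UNIV X"
      \<comment> \<open>\<open>X 0\<close> is the generic copy \<open>X\<close>; the sums run over \<open>X 1, X 2, \<dots>\<close>\<close>
    and S: "S = (\<lambda>n \<omega>. \<Sum>j=1..n. X j \<omega>)"
    and \<gamma>: "sets \<gamma> = sets borel" "prob_space \<gamma>" "nondegenerate_measure \<gamma>"
    and clt: "weak_conv_to (\<lambda>n. distr M borel (\<lambda>\<omega>. (1 / real n powr (1/2)) *\<^sub>R S n \<omega>)) \<gamma>"
    and b_pos: "\<And>n. n \<ge> 1 \<Longrightarrow> b n > 0"
    and b_lower: "filterlim (\<lambda>n. b n / real n powr (1/2)) at_top sequentially"
    and b_upper: "(\<lambda>n. b n / real n powr (2/3)) \<longlonglongrightarrow> 0"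
    and exp_moments: "\<And>f :: 'a \<Rightarrow>\<^sub>L real. \<exists>t\<^sub>f>0. \<forall>t. 0 < \<bar>t\<bar> \<and> \<bar>t\<bar> < t\<^sub>f \<longrightarrow>
        integrable M (\<lambda>\<omega>. exp (t * \<bar>blinfun_apply f (X 0 \<omega>)\<bar>))"
    and D: "open D" "convex D" "D \<inter> gen_hilbert \<gamma> \<noteq> {}" "0 \<notin> closure D"
    and a0: "dominating_point \<gamma> D a0"
    and g: "associated_functional \<gamma> D a0 g"
      \<comment> \<open>\<open>Z n 0\<close> is \<open>Z\<^sup>(\<^sup>n\<^sup>)\<close>\<close>
    and Z: "\<And>n. n \<ge> 1 \<Longrightarrow> laplace \<mu> ((b n / real n) *\<^sub>R g) < \<infinity> \<Longrightarrow>
        iid_with_law (N n) (tilted \<mu> ((b n / real n) *\<^sub>R g)) {0..n} (Z n)"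
    and T: "T = (\<lambda>n \<omega>. (b n / real n) *\<^sub>R (\<Sum>j=1..n. Z n j \<omega>))"
    and \<sigma>sq: "\<sigma>sq = (\<integral>\<omega>. (blinfun_apply g (X 0 \<omega>))\<^sup>2 \<partial>M)"
  defines "P \<equiv> (\<lambda>n. measure M {\<omega> \<in> space M. (1 / b n) *\<^sub>R S n \<omega> \<in> D})"
    and "\<Lambda> \<equiv> real_of_ereal (rate \<gamma> a0)"
    and "W \<equiv> (\<lambda>n \<omega>. exp (- blinfun_apply g (T n \<omega> - (\<integral>\<omega>'. T n \<omega>' \<partial>N n))) *
                indicator ((\<lambda>x. ((b n)\<^sup>2 / real n) *\<^sub>R x) ` D) (T n \<omega>))"
  shows
    "(\<forall>\<^sub>F n in sequentially. laplace \<mu> ((b n / real n) *\<^sub>R g) < \<infinity> \<and>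
        integrable (N n) (Z n 0) \<and> integrable (N n) (T n) \<and> integrable (N n) (W n)) \<and>
     (\<lambda>n. P n / (exp (- ((b n)\<^sup>2 / real n) * \<Lambda>) * (\<integral>\<omega>. W n \<omega> \<partial>N n))) \<longlonglongrightarrow> 1 \<and>
     (\<lambda>n. norm ((\<integral>\<omega>. Z n 0 \<omega> \<partial>N n) - (b n / real n) *\<^sub>R a0)) \<in> O(\<lambda>n. (b n)\<^sup>2 / (real n)\<^sup>2) \<and>
     limsup (\<lambda>n. ereal (real n powr (-1/2) * b n * P n * exp ((b n)\<^sup>2 / real n * \<Lambda>)))
       \<le> ereal ((2 * pi * \<sigma>sq) powr (-1/2))"
proof -
  have prob: "prob_space M" and indep: "prob_space.indep_vars M (\<lambda>_. borel) X UNIV"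
    and law: "\<And>i. distr M borel (X i) = \<mu>"
    using iid by (auto simp: iid_with_law_def)
  interpret iid_seq M X \<mu>
    using prob indep law by (simp add: iid_seq_def iid_seq_axioms_def)
  have clt': "weak_conv_to (\<lambda>n. distr M borel (\<lambda>\<omega>. (1 / sqrt (real n)) *\<^sub>R (\<Sum>i<n. X i \<omega>))) \<gamma>"
  proof -
    have "distr M borel (\<lambda>\<omega>. (1 / real n powr (1/2)) *\<^sub>R S n \<omega>)
      = distr M borel (\<lambda>\<omega>. (1 / sqrt (real n)) *\<^sub>R (\<Sum>i<n. X i \<omega>))" for n
    proof -
      have scale: "distr M borel (\<lambda>\<omega>. (1 / sqrt (real n)) *\<^sub>R (\<Sum>i\<in>I. X i \<omega>))
        = distr (distr M borel (\<lambda>\<omega>. \<Sum>i\<in>I. X i \<omega>)) borel (\<lambda>x. (1 / sqrt (real n)) *\<^sub>R x)" for I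
        by (subst distr_distr) (auto simp: comp_def)
      show ?thesis
        using distr_sum_cong[of "{1..n}" "{..<n}"] scale[of "{1..n}"] scale[of "{..<n}"]
        by (simp add: S powr_half_sqrt)
    qed
    then show ?thesis using clt by simp
  qed
  have exp_moments': "\<exists>t>0. integrable \<mu> (\<lambda>x. exp (t * \<bar>f x\<bar>))" for f :: "'a \<Rightarrow>\<^sub>L real"
  proof -
    obtain t where t: "t > 0" "\<forall>s. 0 < \<bar>s\<bar> \<and> \<bar>s\<bar> < t \<longrightarrow> integrable M (\<lambda>\<omega>. exp (s * \<bar>f (X 0 \<omega>)\<bar>))"
      using exp_moments[of f] by blast
    have [measurable]: "blinfun_apply f \<in> borel_measurable borel"
      by (intro borel_measurable_continuous_onI continuous_intros)
    have "integrable M (\<lambda>\<omega>. exp ((t / 2) * \<bar>f (X 0 \<omega>)\<bar>))" using t(1) t(2)[rule_format, of "t / 2"] by simp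
    then have "integrable \<mu> (\<lambda>x. exp ((t / 2) * \<bar>f x\<bar>))"
      unfolding law[of 0, symmetric] by (subst integrable_distr_eq) auto
    then show ?thesis using t by (intro exI[of _ "t / 2"]) simp
  qed
  interpret clt_seq M X \<mu> \<gamma>
    by (intro clt_seq.intro clt_seq_axioms.intro iid_seq_axioms \<gamma>(1,2) clt' exp_moments')
  define v where "v = var g"
  have dom: "dominating_functional \<gamma> D a0 g" using g by (auto simp: associated_functional_def)
  then have hb: "has_bochner_integral \<gamma> (\<lambda>x. exp (g x - var g / 2) *\<^sub>R x) a0"
    by (simp add: dominating_functional_def log_laplace_gaussian)
  have a0_eq: "a0 = (\<integral>x. g x *\<^sub>R x \<partial>\<mu>)" by (rule tilted_gaussian_mean[OF hb])
  have g_a0: "g a0 = v"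
    using functional_tilted_gaussian_mean[OF hb, of g] by (simp add: v_def var_def power2_eq_square)
  \<comment> \<open>This is \<open>v - v / 2\<close>: the value of \<open>g\<close> at
    \<open>a0\<close> minus the quadratic log-transform of the Gaussian law.\<close>
  have \<Lambda>: "\<Lambda> = v / 2"
    using dom by (simp add: \<Lambda>_def dominating_functional_def log_laplace_gaussian g_a0 v_def)
  have DV: "D \<subseteq> {x. g x \<ge> v}" using dom by (simp add: dominating_functional_def g_a0)
  have \<sigma>v: "\<sigma>sq = v"
    using integral_law[of "\<lambda>x. (g x)\<^sup>2" 0] by (simp add: \<sigma>sq v_def var_def)
  \<comment> \<open>A functional of variance zero would give \<open>a0 = 0\<close>, although
    \<open>a0\<close> lies in the closure of \<open>D\<close>.\<close>
  have v: "v > 0"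
  proof (rule ccontr)
    assume "\<not> v > 0"
    then have "var g = 0" using var_nonneg[of g] by (simp add: v_def)
    then have "AE x in \<mu>. g x = 0" by (rule var_zero_AE)
    then have "a0 = (\<integral>x. 0 \<partial>\<mu>)" unfolding a0_eq by (intro integral_cong_AE) (auto elim!: eventually_mono)
    moreover have "a0 \<in> closure D" using a0 by (auto simp: dominating_point_def frontier_def)
    ultimately show False using D(4) by simp
  qed
  define \<epsilon> where "\<epsilon> n = b n / real n" for n
  have \<epsilon>_pos: "\<epsilon> n > 0" if "n \<ge> 1" for n using b_pos[OF that] that by (simp add: \<epsilon>_def)
  have b_sqrt: "filterlim (\<lambda>n. b n / sqrt (real n)) at_top sequentially"
    using b_lower by (simp add: powr_half_sqrt)
  have \<epsilon>_lim: "\<epsilon> \<longlonglongrightarrow> 0"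
  proof -
    have "(\<lambda>n. real n powr (- 1 / 3)) \<longlonglongrightarrow> 0" by real_asymp
    from tendsto_mult[OF b_upper this]
    have "(\<lambda>n. b n / real n powr (2/3) * real n powr (- 1 / 3)) \<longlonglongrightarrow> 0" by simp
    moreover have "b n / real n powr (2/3) * real n powr (- 1 / 3) = \<epsilon> n" if "n \<ge> 1" for n
    proof -
      have "real n powr (2/3) * real n powr (1/3) = real n" using that by (simp flip: powr_add)
      then show ?thesis using that by (simp add: \<epsilon>_def powr_minus field_simps)
    qed
    ultimately show ?thesis
      by (elim Lim_transform_eventually) (auto simp: eventually_sequentially intro!: exI[of _ "1::nat"])
  qed
  \<comment> \<open>The common size of all errors in the exponent. It is the cube of
    \<open>b n / n powr (2/3)\<close>, so the upper growth condition says precisely that it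
    vanishes.\<close>
  define q where "q n = real n * \<epsilon> n ^ 3" for n
  have q_lim: "q \<longlonglongrightarrow> 0"
  proof -
    have "(\<lambda>n. (b n / real n powr (2/3)) ^ 3) \<longlonglongrightarrow> 0" using tendsto_power[OF b_upper, of 3] by simp
    moreover have "(b n / real n powr (2/3)) ^ 3 = q n" if "n \<ge> 1" for n
    proof -
      have "(real n powr (2/3)) ^ 3 = real n powr 2" using that by (simp add: powr_power)
      also have "\<dots> = (real n)\<^sup>2" using that by (simp add: powr_numeral)
      finally show ?thesis using that
        by (simp add: q_def \<epsilon>_def power_divide power2_eq_square power3_eq_cube)
    qed
    ultimately show ?thesis
      by (elim Lim_transform_eventually) (auto simp: eventually_sequentially intro!: exI[of _ "1::nat"])
  qed
  \<comment> \<open>Both the prefactor in the limsup and, up to a constant, the standard deviation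
    of \<open>g\<close> applied to the tilted sum.\<close>
  define s where "s n = b n / sqrt (real n)" for n
  have s\<epsilon>: "s n = sqrt (real n) * \<epsilon> n" if "n \<ge> 1" for n
    using that by (simp add: s_def \<epsilon>_def real_div_sqrt field_simps)
  have s\<epsilon>2_lim: "(\<lambda>n. s n * (\<epsilon> n)\<^sup>2) \<longlonglongrightarrow> 0"
  proof -
    have "(\<lambda>n. 1 / sqrt (real n)) \<longlonglongrightarrow> 0" by real_asymp
    from tendsto_mult[OF q_lim this] have "(\<lambda>n. q n * (1 / sqrt (real n))) \<longlonglongrightarrow> 0" by simp
    moreover have "q n * (1 / sqrt (real n)) = s n * (\<epsilon> n)\<^sup>2" if "n \<ge> 1" for n
    proof -
      have "q n * (1 / sqrt (real n)) = (real n / sqrt (real n)) * \<epsilon> n ^ 3" by (simp add: q_def)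
      also have "real n / sqrt (real n) = sqrt (real n)" by (rule real_div_sqrt) simp
      also have "sqrt (real n) * \<epsilon> n ^ 3 = s n * (\<epsilon> n)\<^sup>2" using that by (simp add: s\<epsilon> power2_eq_square power3_eq_cube)
      finally show ?thesis .
    qed
    ultimately show ?thesis
      by (elim Lim_transform_eventually) (auto simp: eventually_sequentially intro!: exI[of _ "1::nat"])
  qed
  obtain t C where t: "t > 0" and C: "C \<ge> 0" and H: "\<And>\<epsilon>. 0 < \<epsilon> \<and> \<epsilon> \<le> t \<Longrightarrow> integrable \<mu> (\<lambda>x. exp ((\<epsilon> *\<^sub>R g) x)) \<and>
    integrable (tilted \<mu> (\<epsilon> *\<^sub>R g)) (\<lambda>x. x) \<and>
    (\<forall>k. integrable (tilted \<mu> (\<epsilon> *\<^sub>R g)) (\<lambda>x. g x ^ k)) \<and>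
    \<bar>ln (mgf (\<epsilon> *\<^sub>R g)) - \<epsilon>\<^sup>2 * v / 2\<bar> \<le> C * \<epsilon> ^ 3 \<and>
    \<bar>(\<integral>x. g x \<partial>tilted \<mu> (\<epsilon> *\<^sub>R g)) - \<epsilon> * v\<bar> \<le> C * \<epsilon>\<^sup>2 \<and>
    \<bar>(\<integral>x. (g x)\<^sup>2 \<partial>tilted \<mu> (\<epsilon> *\<^sub>R g)) - v\<bar> \<le> C * \<epsilon> \<and>
    (\<integral>x. \<bar>g x\<bar> ^ 3 \<partial>tilted \<mu> (\<epsilon> *\<^sub>R g)) \<le> C \<and>
    norm ((\<integral>x. x \<partial>tilted \<mu> (\<epsilon> *\<^sub>R g)) - \<epsilon> *\<^sub>R a0) \<le> C * \<epsilon>\<^sup>2"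
    using tilted_moments[of g] unfolding v_def a0_eq by blast
  define good where "good n \<longleftrightarrow> n \<ge> 1 \<and> \<epsilon> n \<le> t" for n
  have "eventually (\<lambda>n. \<epsilon> n < t) sequentially" using order_tendstoD(2)[OF \<epsilon>_lim t] .
  then have ev_good: "eventually good sequentially"
    using eventually_ge_at_top[of 1] unfolding good_def by eventually_elim simp
  define \<nu> where "\<nu> n = tilted \<mu> (\<epsilon> n *\<^sub>R g)" for n
  define m where "m n = (\<integral>x. g x \<partial>\<nu> n)" for n
  have good: "n \<ge> 1" "0 < \<epsilon> n" "b n > 0" and goodH: "integrable \<mu> (\<lambda>x. exp ((\<epsilon> n *\<^sub>R g) x))" "integrable (\<nu> n) (\<lambda>x. x)"
    "\<And>k. integrable (\<nu> n) (\<lambda>x. g x ^ k)"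
    "\<bar>ln (mgf (\<epsilon> n *\<^sub>R g)) - (\<epsilon> n)\<^sup>2 * v / 2\<bar> \<le> C * \<epsilon> n ^ 3"
    "\<bar>m n - \<epsilon> n * v\<bar> \<le> C * (\<epsilon> n)\<^sup>2" "\<bar>(\<integral>x. (g x)\<^sup>2 \<partial>\<nu> n) - v\<bar> \<le> C * \<epsilon> n"
    "(\<integral>x. \<bar>g x\<bar> ^ 3 \<partial>\<nu> n) \<le> C" "norm ((\<integral>x. x \<partial>\<nu> n) - \<epsilon> n *\<^sub>R a0) \<le> C * (\<epsilon> n)\<^sup>2"
    and goodZ: "iid_with_law (N n) (\<nu> n) {0..n} (Z n)" and lap: "laplace \<mu> (\<epsilon> n *\<^sub>R g) < \<infinity>" if "good n" for n
  proof -
    show n: "n \<ge> 1" "0 < \<epsilon> n" "b n > 0" using that \<epsilon>_pos b_pos by (auto simp: good_def)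
    have "0 < \<epsilon> n \<and> \<epsilon> n \<le> t" using n that by (simp add: good_def)
    note h = H[OF this]
    show int: "integrable \<mu> (\<lambda>x. exp ((\<epsilon> n *\<^sub>R g) x))" using h by blast
    show "integrable (\<nu> n) (\<lambda>x. x)" "\<And>k. integrable (\<nu> n) (\<lambda>x. g x ^ k)"
      "\<bar>ln (mgf (\<epsilon> n *\<^sub>R g)) - (\<epsilon> n)\<^sup>2 * v / 2\<bar> \<le> C * \<epsilon> n ^ 3"
      "\<bar>m n - \<epsilon> n * v\<bar> \<le> C * (\<epsilon> n)\<^sup>2" "\<bar>(\<integral>x. (g x)\<^sup>2 \<partial>\<nu> n) - v\<bar> \<le> C * \<epsilon> n"
      "(\<integral>x. \<bar>g x\<bar> ^ 3 \<partial>\<nu> n) \<le> C" "norm ((\<integral>x. x \<partial>\<nu> n) - \<epsilon> n *\<^sub>R a0) \<le> C * (\<epsilon> n)\<^sup>2"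
      using h unfolding \<nu>_def m_def by blast+
    show lap: "laplace \<mu> (\<epsilon> n *\<^sub>R g) < \<infinity>" using tilted_integral(1)[OF int] by simp
    show "iid_with_law (N n) (\<nu> n) {0..n} (Z n)"
      unfolding \<nu>_def \<epsilon>_def using n lap by (intro Z) (auto simp: \<epsilon>_def)
  qed
  have P_eq: "P n = prob {\<omega>\<in>space M. (1 / b n) *\<^sub>R (\<Sum>j=1..n. X j \<omega>) \<in> D}" for n
    by (simp add: P_def S)
  have rep: "integrable (N n) (Z n 0)" "(\<integral>\<omega>. Z n 0 \<omega> \<partial>N n) = (\<integral>x. x \<partial>\<nu> n)"
    "integrable (N n) (T n)" "integrable (N n) (W n)" "0 \<le> (\<integral>\<omega>. W n \<omega> \<partial>N n)"
    "P n = exp (real n * ln (mgf (\<epsilon> n *\<^sub>R g)) - real n * \<epsilon> n * m n) * (\<integral>\<omega>. W n \<omega> \<partial>N n)"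
    "ennreal (\<integral>\<omega>. W n \<omega> \<partial>N n) \<le> (\<integral>\<^sup>+\<omega>. ennreal (exp (- (\<epsilon> n * (\<Sum>j\<in>{1..n}. g (Z n j \<omega>) - m n)))) *
      indicator {- (real n * \<epsilon> n * (m n - \<epsilon> n * v))..} (\<epsilon> n * (\<Sum>j\<in>{1..n}. g (Z n j \<omega>) - m n)) \<partial>N n)"
    if "good n" for n
  proof -
    have Tn: "T n = (\<lambda>\<omega>. \<epsilon> n *\<^sub>R (\<Sum>j=1..n. Z n j \<omega>))" by (simp add: T \<epsilon>_def)
    have Wn: "W n = (\<lambda>\<omega>. exp (- g (T n \<omega> - (\<integral>\<omega>'. T n \<omega>' \<partial>N n))) *
        indicator ((\<lambda>x. ((b n)\<^sup>2 / real n) *\<^sub>R x) ` D) (T n \<omega>))" by (simp add: W_def)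
    note R = tilted_representation[OF good(1,3)[OF that] \<epsilon>_def goodH(1)[OF that] goodH(2)[OF that, unfolded \<nu>_def]
        goodZ[OF that, unfolded \<nu>_def] D(1) DV Tn Wn m_def[unfolded \<nu>_def]]
    show "integrable (N n) (Z n 0)" "(\<integral>\<omega>. Z n 0 \<omega> \<partial>N n) = (\<integral>x. x \<partial>\<nu> n)"
      "integrable (N n) (T n)" "integrable (N n) (W n)" "0 \<le> (\<integral>\<omega>. W n \<omega> \<partial>N n)"
      "P n = exp (real n * ln (mgf (\<epsilon> n *\<^sub>R g)) - real n * \<epsilon> n * m n) * (\<integral>\<omega>. W n \<omega> \<partial>N n)"
      "ennreal (\<integral>\<omega>. W n \<omega> \<partial>N n) \<le> (\<integral>\<^sup>+\<omega>. ennreal (exp (- (\<epsilon> n * (\<Sum>j\<in>{1..n}. g (Z n j \<omega>) - m n)))) *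
        indicator {- (real n * \<epsilon> n * (m n - \<epsilon> n * v))..} (\<epsilon> n * (\<Sum>j\<in>{1..n}. g (Z n j \<omega>) - m n)) \<partial>N n)"
      using R unfolding \<nu>_def P_eq by blast+
  qed
  define EW where "EW n = (\<integral>\<omega>. W n \<omega> \<partial>N n)" for n
  \<comment> \<open>The exponent left over after the main term. Its second-order parts cancel, since
    n \<epsilon>^2 v / 2 from the logarithm and from the rate add up to the n \<epsilon>^2 v of the
    centring; what remains is of order \<open>q n\<close>.\<close>
  define x where "x n = real n * ln (mgf (\<epsilon> n *\<^sub>R g)) - real n * \<epsilon> n * m n + (b n)\<^sup>2 / real n * \<Lambda>" for n
  have P_x: "P n = exp (- ((b n)\<^sup>2 / real n) * \<Lambda>) * (exp (x n) * EW n)" if "good n" for n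
    using rep(6)[OF that] by (simp add: EW_def x_def mult.assoc[symmetric] flip: exp_add)
  have \<delta>_le: "\<bar>real n * \<epsilon> n * (m n - \<epsilon> n * v)\<bar> \<le> C * q n" if "good n" for n
  proof -
    have "\<bar>real n * \<epsilon> n * (m n - \<epsilon> n * v)\<bar> = real n * \<epsilon> n * \<bar>m n - \<epsilon> n * v\<bar>"
      using good(2)[OF that] by (simp add: abs_mult)
    also have "\<dots> \<le> real n * \<epsilon> n * (C * (\<epsilon> n)\<^sup>2)"
      using good(2)[OF that] goodH(5)[OF that] by (intro mult_left_mono) auto
    also have "\<dots> = C * q n" by (simp add: q_def power2_eq_square power3_eq_cube)
    finally show ?thesis .
  qed
  have x_le: "\<bar>x n\<bar> \<le> 2 * C * q n" if "good n" for n
  proof -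
    have "(b n)\<^sup>2 / real n = real n * (\<epsilon> n)\<^sup>2"
      using good(1)[OF that] by (simp add: \<epsilon>_def power2_eq_square)
    then have "x n = real n * (ln (mgf (\<epsilon> n *\<^sub>R g)) - (\<epsilon> n)\<^sup>2 * v / 2) - real n * \<epsilon> n * (m n - \<epsilon> n * v)"
      by (simp add: x_def \<Lambda> power2_eq_square algebra_simps)
    moreover have "\<bar>real n * (ln (mgf (\<epsilon> n *\<^sub>R g)) - (\<epsilon> n)\<^sup>2 * v / 2)\<bar> \<le> C * q n"
      using mult_left_mono[OF goodH(4)[OF that], of "real n"] by (simp add: abs_mult q_def mult_ac)
    ultimately show ?thesis using \<delta>_le[OF that] by linarith
  qed
  have x_lim: "x \<longlonglongrightarrow> 0"
  proof (rule Lim_null_comparison)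
    show "eventually (\<lambda>n. norm (x n) \<le> 2 * C * q n) sequentially"
      using ev_good by eventually_elim (use x_le in simp)
    show "(\<lambda>n. 2 * C * q n) \<longlonglongrightarrow> 0" using tendsto_mult_right_zero[OF q_lim] by simp
  qed
  have "eventually (\<lambda>n. P n > 0) sequentially"
  proof -
    have "prob {\<omega>\<in>space M. (1 / b n) *\<^sub>R (\<Sum>i<n. X i \<omega>) \<in> D} = P n" for n
    proof -
      have "(\<lambda>x. (1 / b n) *\<^sub>R x) -` D \<in> sets borel"
        using D(1) by (intro borel_open open_vimage continuous_intros)
      from prob_sum_cong[OF _ _ _ this, of "{..<n}" "{1..n}"] show ?thesis by (simp add: P_eq)
    qed
    then show ?thesis
      using eventually_prob_positive[OF D(1-3) b_sqrt \<epsilon>_lim[unfolded \<epsilon>_def]] by simp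
  qed
  \<comment> \<open>Positivity of \<open>P n\<close> excludes \<open>EW n = 0\<close>, for which the
    quotient would be 0 and not \<open>exp (x n)\<close>.\<close>
  then have ev_ratio: "eventually (\<lambda>n. exp (x n) = P n / (exp (- ((b n)\<^sup>2 / real n) * \<Lambda>) * EW n)) sequentially"
    using ev_good
  proof eventually_elim
    case (elim n)
    then have "EW n \<noteq> 0" using P_x[of n] by auto
    then show ?case using P_x[OF elim(2)] by simp
  qed
  have c1: "\<forall>\<^sub>F n in sequentially. laplace \<mu> ((b n / real n) *\<^sub>R g) < \<infinity> \<and>
        integrable (N n) (Z n 0) \<and> integrable (N n) (T n) \<and> integrable (N n) (W n)"
    using ev_good
  proof eventually_elim
    case (elim n)
    show ?case using lap[OF elim] rep(1,3,4)[OF elim] by (auto simp: \<epsilon>_def)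
  qed
  have c2: "(\<lambda>n. P n / (exp (- ((b n)\<^sup>2 / real n) * \<Lambda>) * (\<integral>\<omega>. W n \<omega> \<partial>N n))) \<longlonglongrightarrow> 1"
    using Lim_transform_eventually[OF _ ev_ratio, of 1] tendsto_exp[OF x_lim] by (simp add: EW_def)
  have c3: "(\<lambda>n. norm ((\<integral>\<omega>. Z n 0 \<omega> \<partial>N n) - (b n / real n) *\<^sub>R a0)) \<in> O(\<lambda>n. (b n)\<^sup>2 / (real n)\<^sup>2)"
  proof (rule bigoI)
    show "\<forall>\<^sub>F n in sequentially. norm (norm ((\<integral>\<omega>. Z n 0 \<omega> \<partial>N n) - (b n / real n) *\<^sub>R a0)) \<le> C * norm ((b n)\<^sup>2 / (real n)\<^sup>2)"
      using ev_good
    proof eventually_elim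
      case (elim n)
      show ?case using goodH(8)[OF elim] rep(2)[OF elim] by (simp add: \<epsilon>_def power_divide)
    qed
  qed
  have target: "(2 * pi * \<sigma>sq) powr (-1/2) = 1 / sqrt (2 * pi * v)"
    using v by (simp add: \<sigma>v powr_minus_divide powr_half_sqrt)
  have c4: "limsup (\<lambda>n. ereal (real n powr (-1/2) * b n * P n * exp ((b n)\<^sup>2 / real n * \<Lambda>)))
       \<le> ereal ((2 * pi * \<sigma>sq) powr (-1/2))"
    unfolding target Limsup_le_iff
  proof (intro allI impI)
    fix y :: ereal assume y: "ereal (1 / sqrt (2 * pi * v)) < y"
    then obtain y' where y': "1 / sqrt (2 * pi * v) < y'" "ereal y' \<le> y"
      by (metis ereal_dense2 ereal_less_eq(3) less_imp_le less_ereal.simps(1))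
    \<comment> \<open>For fixed \<open>r\<close> this is the limit of the bounds \<open>V n\<close>
      below, and it tends to the target value as \<open>r\<close> tends to 0. Hence \<open>r\<close>
      is fixed first, with \<open>B r < y'\<close>, and only then does \<open>n\<close>
      grow.\<close>
    define B where "B r = exp (2 * r) / (1 - r\<^sup>2) * (1 / sqrt (2 * pi * (v * (1 - r))))" for r
    have "(B \<longlongrightarrow> exp (2 * 0) / (1 - 0\<^sup>2) * (1 / sqrt (2 * pi * (v * (1 - 0))))) (at_right 0)"
      unfolding B_def using v by (intro tendsto_intros) auto
    then have "(B \<longlongrightarrow> 1 / sqrt (2 * pi * v)) (at_right 0)" by simp
    then have "eventually (\<lambda>r. B r < y') (at_right 0)" using y'(1) by (rule order_tendstoD)
    moreover have "eventually (\<lambda>r::real. 0 < r \<and> r < 1) (at_right 0)"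
      using eventually_at_right_less[of "0::real"] by (auto simp: eventually_at_right_field intro: exI[of _ 1])
    ultimately have "eventually (\<lambda>r. B r < y' \<and> 0 < r \<and> r < 1) (at_right 0)" by (rule eventually_conj)
    then obtain r where r: "B r < y'" "0 < r" "r < 1" using eventually_happens'[of "at_right (0::real)"] by force
    define \<kappa> where "\<kappa> = v * (1 - r)"
    have \<kappa>: "\<kappa> > 0" using v r by (simp add: \<kappa>_def)
    \<comment> \<open>A bound for the centred third moments, using that the tilted mean is at most
      \<open>v + C\<close> in absolute value; the added 1 keeps it visibly positive.\<close>
    define C' where "C' = 4 * (C + (v + C) ^ 3) + 1"
    have C': "C' > 0" using C v by (simp add: C'_def add_nonneg_pos)
    \<comment> \<open>The first entry ensures \<open>\<theta> * C' \<le> 3 * (w - \<kappa>)\<close>,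
      because \<open>w - \<kappa>\<close> is at least \<open>v * r / 2\<close> once \<open>w\<close>
      is within \<open>v * r / 2\<close> of \<open>v\<close>; the second ensures
      \<open>\<theta>\<^sup>2 * w \<le> 2\<close>, because \<open>w\<close> is at most
      \<open>v + 1\<close>.\<close>
    define \<theta> where "\<theta> = min (3 * (v * r / 2) / C') (sqrt (2 / (v + 1)))"
    have \<theta>: "\<theta> > 0" using C' v r by (simp add: \<theta>_def)
    have \<theta>C: "\<theta> * C' \<le> 3 * (v * r / 2)"
      using C' by (simp add: \<theta>_def min_def field_simps)
    have \<theta>2: "\<theta>\<^sup>2 * (v + 1) \<le> 2"
    proof -
      have "\<theta>\<^sup>2 \<le> (sqrt (2 / (v + 1)))\<^sup>2" using \<theta> by (intro power_mono) (auto simp: \<theta>_def)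
      also have "\<dots> = 2 / (v + 1)" using v by simp
      finally show ?thesis using v by (simp add: field_simps)
    qed
    \<comment> \<open>For \<open>\<epsilon> n\<close> up to this value the tilted variance
      \<open>w\<close> differs from \<open>v\<close> by at most both \<open>v * r / 2\<close> and
      1.\<close>
    define e0 where "e0 = min (v * r / 2) 1 / (C + (v + C)\<^sup>2 + 1)"
    have den: "C + (v + C)\<^sup>2 + 1 > 0" using C by (simp add: add_nonneg_pos)
    have e0: "e0 > 0" using den v r by (simp add: e0_def)
    \<comment> \<open>Of the exponent \<open>3 * C * q n\<close>, two parts bound \<open>x n\<close>
      and one bounds the offset \<open>\<delta>\<close> of the half-line. The last summand is the
      high-frequency error multiplied by \<open>s n\<close>.\<close>
    define V where "V n = exp (2 * r + 3 * C * q n) / (1 - r\<^sup>2) * (1 / sqrt (2 * pi * \<kappa>) + s n * (\<epsilon> n)\<^sup>2 / (r ^ 6 * \<theta>\<^sup>2 * sqrt (2 * pi)))" for n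
    have "V \<longlonglongrightarrow> exp (2 * r + 3 * C * 0) / (1 - r\<^sup>2) * (1 / sqrt (2 * pi * \<kappa>) + 0 / (r ^ 6 * \<theta>\<^sup>2 * sqrt (2 * pi)))"
      unfolding V_def using r \<theta> by (intro tendsto_intros q_lim s\<epsilon>2_lim) (auto simp: power2_eq_1_iff)
    then have "V \<longlonglongrightarrow> B r" by (simp add: B_def \<kappa>_def)
    then have "eventually (\<lambda>n. V n < y') sequentially" using r(1) by (rule order_tendstoD)
    moreover have "eventually (\<lambda>n. \<epsilon> n < min e0 1) sequentially" using e0 by (intro order_tendstoD(2)[OF \<epsilon>_lim]) simp
    ultimately show "\<forall>\<^sub>F n in sequentially. ereal (real n powr (-1/2) * b n * P n * exp ((b n)\<^sup>2 / real n * \<Lambda>)) < y"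
      using ev_good
    proof eventually_elim
      case (elim n)
      note n = good[OF elim(3)]
      have \<epsilon>1: "\<epsilon> n \<le> 1" "\<epsilon> n \<le> e0" using elim(2) by auto
      have m_abs: "\<bar>m n\<bar> \<le> (v + C) * \<epsilon> n"
      proof -
        have "\<bar>m n\<bar> \<le> \<epsilon> n * v + C * (\<epsilon> n)\<^sup>2"
          using goodH(5)[OF elim(3)] mult_pos_pos[OF n(2) v] by linarith
        also have "(\<epsilon> n)\<^sup>2 \<le> \<epsilon> n" using \<epsilon>1(1) n(2) by (simp add: power2_eq_square mult_left_le_one_le)
        then have "\<epsilon> n * v + C * (\<epsilon> n)\<^sup>2 \<le> \<epsilon> n * v + C * \<epsilon> n" using C by (intro add_left_mono mult_left_mono) auto
        finally show ?thesis by (simp add: algebra_simps)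
      qed
      define w where "w = (\<integral>x. (g x)\<^sup>2 \<partial>\<nu> n) - (m n)\<^sup>2"
      have "(m n)\<^sup>2 \<le> ((v + C) * \<epsilon> n)\<^sup>2"
        using m_abs by (intro abs_le_square_iff[THEN iffD1]) simp
      also have "\<dots> = (v + C)\<^sup>2 * (\<epsilon> n)\<^sup>2" by (simp add: power_mult_distrib)
      also have "\<dots> \<le> (v + C)\<^sup>2 * \<epsilon> n"
        using \<epsilon>1(1) n(2) by (intro mult_left_mono) (auto simp: power2_eq_square mult_left_le_one_le)
      finally have m2: "(m n)\<^sup>2 \<le> (v + C)\<^sup>2 * \<epsilon> n" .
      have "\<bar>w - v\<bar> \<le> C * \<epsilon> n + (v + C)\<^sup>2 * \<epsilon> n"
        using goodH(6)[OF elim(3)] m2 zero_le_power2[of "m n"] unfolding w_def by linarith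
      also have "\<dots> \<le> (C + (v + C)\<^sup>2 + 1) * \<epsilon> n" using n(2) by (simp add: algebra_simps)
      also have "\<dots> \<le> (C + (v + C)\<^sup>2 + 1) * e0" using \<epsilon>1 den by (intro mult_left_mono) auto
      also have "\<dots> = min (v * r / 2) 1" using den by (simp add: e0_def)
      finally have w: "\<bar>w - v\<bar> \<le> v * r / 2" "\<bar>w - v\<bar> \<le> 1" by auto
      have vr: "v * r < v" using v r by simp
      have w0: "w \<ge> 0" using w(1) vr v by linarith
      have "w - \<kappa> = (w - v) + v * r" by (simp add: \<kappa>_def algebra_simps)
      moreover define u where "u = v * r / 2"
      moreover have "v * r = u + u" by (simp add: u_def)
      ultimately have "u \<le> w - \<kappa>" using w(1) by linarith
      then have "3 * (v * r / 2) \<le> 3 * (w - \<kappa>)" unfolding u_def by (rule mult_left_mono) simp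
      then have th1: "\<theta> * C' \<le> 3 * (w - \<kappa>)" by (rule order_trans[OF \<theta>C])
      have "\<theta>\<^sup>2 * w \<le> \<theta>\<^sup>2 * (v + 1)" using w(2) by (intro mult_left_mono) auto
      then have th2: "\<theta>\<^sup>2 * w \<le> 2" using \<theta>2 by linarith
      have C'_ge: "4 * ((\<integral>x. \<bar>g x\<bar> ^ 3 \<partial>\<nu> n) + \<bar>m n\<bar> ^ 3) \<le> C'"
      proof -
        have "(v + C) * \<epsilon> n \<le> (v + C) * 1" using \<epsilon>1(1) v C by (intro mult_left_mono) auto
        then have "\<bar>m n\<bar> \<le> v + C" using m_abs by simp
        then have "\<bar>m n\<bar> ^ 3 \<le> (v + C) ^ 3" by (intro power_mono) auto
        then show ?thesis using goodH(7)[OF elim(3)] by (simp add: C'_def)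
      qed
      define \<delta> where "\<delta> = real n * \<epsilon> n * (m n - \<epsilon> n * v)"
      define U where "U = 1 / sqrt (2 * pi * (real n * (\<epsilon> n)\<^sup>2 * \<kappa>)) + (\<epsilon> n)\<^sup>2 / (r ^ 6 * \<theta>\<^sup>2 * sqrt (2 * pi))"
      have U0: "U \<ge> 0" using \<kappa> by (simp add: U_def)
      have r2: "1 - r\<^sup>2 > 0" using r by (simp add: power_less_one_iff)
      have "ennreal (EW n) \<le> ennreal (exp (2 * r + \<delta>) / (1 - r\<^sup>2) * U)"
        unfolding EW_def U_def \<delta>_def
        by (rule order_trans[OF rep(7)[OF elim(3)]],
            rule tilted_sum_bound[OF n(1,2) goodZ[OF elim(3)] goodH(3)[OF elim(3)] m_def w_def C'_ge \<theta> th1 th2 w0 \<kappa> r(2,3)])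
      then have EW_le: "EW n \<le> exp (2 * r + \<delta>) / (1 - r\<^sup>2) * U"
        using U0 r2 by (subst (asm) ennreal_le_iff) auto
      have s0: "s n > 0" using n by (simp add: s_def)
      have "real n powr (-1/2) * b n = s n" by (simp add: s_def powr_minus_divide powr_half_sqrt)
      then have "real n powr (-1/2) * b n * P n * exp ((b n)\<^sup>2 / real n * \<Lambda>) = s n * exp (x n) * EW n"
        by (simp add: P_x[OF elim(3)] exp_minus)
      also have "\<dots> \<le> s n * exp (2 * C * q n) * (exp (2 * r + C * q n) / (1 - r\<^sup>2) * U)"
      proof (intro mult_mono)
        show "exp (x n) \<le> exp (2 * C * q n)" using x_le[OF elim(3)] by simp
        have "exp (2 * r + \<delta>) / (1 - r\<^sup>2) * U \<le> exp (2 * r + C * q n) / (1 - r\<^sup>2) * U"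
          using \<delta>_le[OF elim(3)] U0 r2 by (intro mult_right_mono divide_right_mono) (auto simp: \<delta>_def)
        then show "EW n \<le> exp (2 * r + C * q n) / (1 - r\<^sup>2) * U" using EW_le by linarith
        show "0 \<le> EW n" using rep(5)[OF elim(3)] by (simp add: EW_def)
      qed (use s0 in auto)
      also have "\<dots> = (exp (2 * C * q n) * exp (2 * r + C * q n)) / (1 - r\<^sup>2) * (s n * U)" by simp
      also have "exp (2 * C * q n) * exp (2 * r + C * q n) = exp (2 * r + 3 * C * q n)"
        by (simp flip: exp_add)
      \<comment> \<open>The prefactor cancels the scale \<open>sqrt n * \<epsilon> n\<close> of the
        standard deviation, which leaves the constant with \<open>\<kappa>\<close> in place of
        \<open>v\<close>.\<close>
      also have "s n * U = 1 / sqrt (2 * pi * \<kappa>) + s n * (\<epsilon> n)\<^sup>2 / (r ^ 6 * \<theta>\<^sup>2 * sqrt (2 * pi))"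
      proof -
        have "sqrt (2 * pi * (real n * (\<epsilon> n)\<^sup>2 * \<kappa>)) = sqrt ((s n)\<^sup>2 * (2 * pi * \<kappa>))"
          using n by (simp add: s\<epsilon> power_mult_distrib mult_ac)
        also have "\<dots> = s n * sqrt (2 * pi * \<kappa>)" using s0 by (simp add: real_sqrt_mult)
        finally show ?thesis using s0 by (simp add: U_def distrib_left)
      qed
      finally have "real n powr (-1/2) * b n * P n * exp ((b n)\<^sup>2 / real n * \<Lambda>) \<le> V n" by (simp add: V_def)
      also have "\<dots> < y'" by (rule elim)
      finally show ?case using y'(2) by (metis less_ereal.simps(1) order_less_le_trans)
    qed
  qed
  show ?thesis using c1 c2 c3 c4 by blast
qed

end
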